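(* Let $n\ge 2$ be an integer. Let $f:\mathbb R\to\mathbb R$ be continuous and odd, $f(0)=0$, and put $F(s)=\int_0^s f(t)\,dt$. Assume that there exist $\beta>b>0$ such that $f(s)>0$ for $s>b$, $f(s)\le 0$ for $s\in[0,b]$, $f\not\equiv 0$ on $[0,b]$, and $F(\beta)=0$. Assume also that $f$ is continuously differentiable in $(0,\infty)$ and $f'\in L^1(0,1)$. Suppose that at least one of the following holds: (A) $f(s)\ge f'(s)(s-\beta)$ for all $s\ge\beta$, and $\bigl(\frac{F}{f}\bigr)'(s)\ge\frac{n-2}{2n}$ for all $s>\beta$; (B) $n>2$, the function $s\mapsto \frac{sf'(s)}{f(s)}$ decreases on $[\beta,\infty)$, and $\frac{\beta f'(\beta)}{f(\beta)}\le\frac{n}{n-2}$. Then the problem $$u''(r)+\frac{n-1}{r}u'(r)+f(u(r))=0\quad (r>0),\qquad u'(0)=0,\qquad \lim_{r\to\infty}u(r)=0$$ has at most one solution satisfying $u(0)>0$ which has exactly one sign change in $(0,\infty)$.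
   Context: Solutions are $C^2$ functions $u$ on $[0,\infty)$; $'$ on $u$ denotes $d/dr$. The problem is the radial form of $\Delta u+f(u)=0$ in $\mathbb R^n$. *)

theory Defs
  imports "HOL-Analysis.Analysis"
begin

text \<open>The interval integral is oriented, so this is also the intended function for \<open>s < 0\<close>.\<close>

definition antideriv :: "(real \<Rightarrow> real) \<Rightarrow> real \<Rightarrow> real" where
  "antideriv f s = (LBINT t=0..s. f t)"

text \<open>
  Here \<open>v\<close> and \<open>w\<close> are the first and second derivatives of \<open>u\<close> on the closed half-line,
  one-sided at \<open>0\<close>. The values of \<open>u\<close> at negative arguments are irrelevant.
\<close>

definition radial_solution :: "nat \<Rightarrow> (real \<Rightarrow> real) \<Rightarrow> (real \<Rightarrow> real) \<Rightarrow> bool" where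
  "radial_solution n f u \<longleftrightarrow>
    (\<exists>v w.
      (\<forall>r\<ge>0. (u has_real_derivative v r) (at r within {0..})) \<and>
      (\<forall>r\<ge>0. (v has_real_derivative w r) (at r within {0..})) \<and>
      continuous_on {0..} w \<and>
      (\<forall>r>0. w r + (real n - 1) / r * v r + f (u r) = 0) \<and>
      v 0 = 0 \<and>
      (u \<longlongrightarrow> 0) at_top)"

text \<open>
  Sign changes are counted by alternating values, so zeros where \<open>u\<close> does not pass to the
  opposite sign do not count, and neither does \<open>u\<close> vanishing on a whole interval
  (solutions may have compact support, since \<open>f\<close> need not be Lipschitz at \<open>0\<close>).
\<close>

definition one_sign_change_on :: "real set \<Rightarrow> (real \<Rightarrow> real) \<Rightarrow> bool" where
  "one_sign_change_on S u \<longleftrightarrow>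
    (\<exists>x\<in>S. \<exists>y\<in>S. x < y \<and> u x * u y < 0) \<and>
    \<not> (\<exists>x\<in>S. \<exists>y\<in>S. \<exists>z\<in>S. x < y \<and> y < z \<and> u x * u y < 0 \<and> u y * u z < 0)"

end

(* Let u1, u2 be two solutions with u1(0) < u2(0).  On each monotone piece take the value s of the
   solution as independent variable; the piece is then described by the radius r(s) and the speed
   h(s) = |u'(r(s))|, with r' = -1/h and h' = (n-1)/r - f/h, whatever the sign of f.  Following both
   solutions down from the top to -U and then, for -u, from U to 0, one shows h1 < h2 throughout.

   Where |s| > beta the crossing h1 = h2 is excluded by the Pohozaev type quantity
   P = r^n (h^2 + 2F) / 2 - n r^(n-1) h F / f, which satisfies
   P' = - r^(n-1) h (n (F/f)' - (n-2)/2) and so is monotone under either hypothesis.  Where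
   |s| <= beta it is excluded by W = r sqrt(h^2 + 2F), as W2 - W1 grows while s decreases.  To pass
   through s = -beta one also needs r1^(n-1) h1 <= r2^(n-1) h2 at s = beta; under (A) this is Sturm
   comparison of u - beta, under (B) it follows by comparing the two solutions at equal values of
   h / sqrt(2F).  In the last piece W2 - W1 stays above a positive constant, whereas W2 tends to 0.

   Solutions with u1(0) = u2(0) coincide: f is Lipschitz away from 0, and the zero is crossed with
   nonzero speed, where the equation in the variables (r, h) is Lipschitz for continuous f. *)
theory Submission
  imports Defs
begin

text \<open>Where h1 = h2, the derivatives of the speeds differ only by (n-1)(1/r2 - 1/r1). So h1 <
  h2 can be lost on the way down only where r2 < r1, and every auxiliary quantity serves one
  purpose: to order the radii at a hypothetical crossing.

  P cannot be used on all values, because F/f is singular where f vanishes. For |s| \<le> \<beta>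
  the energies h^2 + 2F agree at a crossing, so the order of W is the order of the radii; F \<le> 0
  makes W2 - W1 monotone.

  The two quantities must be matched at \<beta> and -\<beta>. There F = 0, W = r h and P = (r^(n-1)
  h)(r h)/2. Passing from P to W only needs the order of r h, but passing from W to P at -\<beta>
  also needs the order of the fluxes r^(n-1) h. This is the reason for the flux condition at \<beta>
  on the first descent, and the only place where (A) and (B) require different arguments. On the
  last piece P is left at \<beta> for good.

  Since f may fail to be Lipschitz at 0, a solution may vanish beyond a finite radius or stay
  negative forever. With the value as variable both cases look alike: the energy tends to 0 as s
  tends to 0.\<close>

text \<open>The form \<open>r s ^ m / r s\<close> avoids a second exponent \<open>m - 1\<close>, so
  that the derivatives below share the factor \<open>r s ^ m\<close>.\<close>

lemma DERIV_power_div: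
  fixes r :: "real \<Rightarrow> real"
  assumes "(r has_real_derivative d) (at s within S)" "r s \<noteq> 0"
  shows "((\<lambda>x. r x ^ m) has_real_derivative real m * r s ^ m / r s * d) (at s within S)"
proof -
  have "((\<lambda>x. r x ^ m) has_real_derivative real m * r s ^ (m - 1) * d) (at s within S)"
    using assms(1) by (auto intro!: derivative_eq_intros)
  moreover have "real m * r s ^ (m - 1) = real m * r s ^ m / r s"
    using assms(2) by (cases m) auto
  ultimately show ?thesis by simp
qed

text \<open>Collects what (A) and (B) have in common: \<open>K\<close> is the derivative of F/f, and
  both hypotheses yield \<open>frac_ge\<close>. What distinguishes them enters later, as one of two
  monotonicity properties above \<beta>.\<close>

locale radial_nonlinearity =
  fixes n :: nat and f F K :: "real \<Rightarrow> real" and b \<beta> :: real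
  assumes n_ge_2: "2 \<le> n"
    and f_cont: "continuous_on UNIV f"
    and F_deriv: "\<And>s. (F has_real_derivative f s) (at s)"
    and f_odd: "\<And>s. f (- s) = - f s"
    and F_even: "\<And>s. F (- s) = F s"
    and F_0: "F 0 = 0" and F_beta: "F \<beta> = 0"
    and b_pos: "0 < b" and b_less: "b < \<beta>"
    and f_pos: "\<And>s. b < s \<Longrightarrow> 0 < f s"
    and f_nonpos: "\<And>s. 0 \<le> s \<Longrightarrow> s \<le> b \<Longrightarrow> f s \<le> 0"
    and F_neg: "\<And>s. b \<le> s \<Longrightarrow> s < \<beta> \<Longrightarrow> F s < 0"
    and frac_deriv: "\<And>s. \<beta> < s \<Longrightarrow> ((\<lambda>t. F t / f t) has_real_derivative K s) (at s)"
    and frac_ge: "\<And>s. \<beta> < s \<Longrightarrow> (real n - 2) / (2 * real n) \<le> K s"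
begin

section \<open>Signs of \<open>f\<close> and \<open>F\<close>, and branches of solutions\<close>

lemma beta_pos: "0 < \<beta>" using b_pos b_less by simp

lemma F_cont: "continuous_on S F"
  using F_deriv by (meson DERIV_isCont continuous_at_imp_continuous_on)

lemma f_cont_on: "continuous_on S f"
  using f_cont continuous_on_subset by blast

lemma F_abs: "F \<bar>s\<bar> = F s"
  using F_even[of s] by (cases "s \<ge> 0") auto

lemma F_nonpos: "\<bar>s\<bar> \<le> \<beta> \<Longrightarrow> F s \<le> 0"
proof -
  assume s: "\<bar>s\<bar> \<le> \<beta>"
  show "F s \<le> 0"
  proof (cases "\<bar>s\<bar> \<le> b")
    case True
    have "F \<bar>s\<bar> \<le> F 0"
      by (rule DERIV_nonpos_imp_nonincreasing[of 0 "\<bar>s\<bar>"])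
         (use True F_deriv f_nonpos in \<open>auto intro!: exI[of _ "f _"]\<close>)
    then show ?thesis using F_0 F_abs by simp
  next
    case False
    then show ?thesis using F_neg[of "\<bar>s\<bar>"] s F_beta F_abs[of s] by (cases "\<bar>s\<bar> = \<beta>") auto
  qed
qed

lemma F_strict_mono: "b \<le> s \<Longrightarrow> s < t \<Longrightarrow> F s < F t"
  by (rule DERIV_pos_imp_increasing_open) (use F_deriv F_cont f_pos in \<open>auto intro!: exI[of _ "f _"]\<close>)

lemma F_pos: "\<beta> < s \<Longrightarrow> 0 < F s"
  using F_strict_mono[of \<beta> s] F_beta b_less by auto

lemma f_neg: "s < - b \<Longrightarrow> f s < 0"
  using f_pos[of "- s"] f_odd[of s] by simp

lemma frac_deriv_neg:
  assumes "s < - \<beta>"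
  shows "((\<lambda>t. F t / f t) has_real_derivative K (- s)) (at s)"
proof -
  have "((\<lambda>t. F t / f t) has_real_derivative K (- s)) (at (- s))"
    using frac_deriv[of "- s"] assms by simp
  then have "((\<lambda>t. F (- t) / f (- t)) has_real_derivative - K (- s)) (at s)"
    by (simp add: DERIV_mirror)
  then have "((\<lambda>t. - (F (- t) / f (- t))) has_real_derivative K (- s)) (at s)"
    using DERIV_minus by fastforce
  then show ?thesis by (simp add: F_even f_odd)
qed

text \<open>A monotone piece of a solution is described by the radius \<open>r s\<close> at which the value \<open>s\<close> is
  taken and the speed \<open>h s = - u' (r s)\<close>.\<close>

definition branch :: "real \<Rightarrow> real \<Rightarrow> (real \<Rightarrow> real) \<Rightarrow> (real \<Rightarrow> real) \<Rightarrow> bool" where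
  "branch a c r h \<longleftrightarrow> (\<forall>s\<in>{a<..<c}. 0 < r s \<and> 0 < h s \<and>
     (r has_real_derivative - 1 / h s) (at s) \<and>
     (h has_real_derivative (real n - 1) / r s - f s / h s) (at s))"

lemma branchD:
  assumes "branch a c r h" "a < s" "s < c"
  shows "0 < r s" "0 < h s" "(r has_real_derivative - 1 / h s) (at s)"
    "(h has_real_derivative (real n - 1) / r s - f s / h s) (at s)"
    "isCont r s" "isCont h s"
  using assms unfolding branch_def by (auto intro: DERIV_isCont)

lemma branch_subset: "branch a c r h \<Longrightarrow> a \<le> a' \<Longrightarrow> c' \<le> c \<Longrightarrow> branch a' c' r h"
  unfolding branch_def by auto

lemma branch_cont:
  assumes "branch a c r h" "S \<subseteq> {a<..<c}"
  shows "continuous_on S r" "continuous_on S h"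
  using assms branchD(5,6)[OF assms(1)]
  by (auto intro!: continuous_at_imp_continuous_on)

section \<open>Propagation of h1 < h2 towards smaller values\<close>

text \<open>(r2 - r1)' = 1/h1 - 1/h2 \<ge> 0, so the order r1 \<le> r2 at a left end spreads over
  the whole interval to its right.\<close>

lemma r_diff_mono:
  assumes B: "branch a t r1 h1" "branch a t r2 h2"
    and c: "continuous_on {a..t} r1" "continuous_on {a..t} r2"
    and lt: "\<And>s. a < s \<Longrightarrow> s < t \<Longrightarrow> h1 s \<le> h2 s"
    and xy: "a \<le> x" "x \<le> y" "y \<le> t"
  shows "r2 x - r1 x \<le> r2 y - r1 y"
proof (rule DERIV_nonneg_imp_increasing_open[OF xy(2)])
  fix s assume s: "x < s" "s < y"
  then have as: "a < s" "s < t" using xy by auto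
  have "((\<lambda>s. r2 s - r1 s) has_real_derivative (- 1 / h2 s) - (- 1 / h1 s)) (at s)"
    using branchD(3)[OF B(1) as] branchD(3)[OF B(2) as] by (rule DERIV_diff[rotated])
  moreover have "0 \<le> (- 1 / h2 s) - (- 1 / h1 s)"
    using branchD(2)[OF B(1) as] lt[OF as] by (simp add: frac_le)
  ultimately show "\<exists>y. ((\<lambda>s. r2 s - r1 s) has_real_derivative y) (at s) \<and> 0 \<le> y" by blast
next
  have "{x..y} \<subseteq> {a..t}" using xy by auto
  then show "continuous_on {x..y} (\<lambda>s. r2 s - r1 s)"
    using c by (auto intro!: continuous_intros intro: continuous_on_subset)
qed

text \<open>While \<open>r2 \<ge> r1\<close>, the function \<open>r1\<^bsup>2n-2\<^esup> (h2\<^sup>2 - h1\<^sup>2)\<close> is nonincreasing in \<open>s\<close>.\<close>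

lemma h_less_at_left:
  assumes "a < t" and B: "branch a t r1 h1" "branch a t r2 h2"
    and c: "continuous_on {a..t} r1" "continuous_on {a..t} r2"
      "continuous_on {a..t} h1" "continuous_on {a..t} h2"
    and lt: "\<And>s. a < s \<Longrightarrow> s < t \<Longrightarrow> h1 s < h2 s"
    and ra: "r1 a \<le> r2 a"
  shows "(h1 a)\<^sup>2 < (h2 a)\<^sup>2"
proof -
  define \<phi> where "\<phi> = (\<lambda>s. r1 s ^ (2 * (n - 1)) * ((h2 s)\<^sup>2 - (h1 s)\<^sup>2))"
  \<comment> \<open>Strict inequality of the speeds is known inside the interval only, so \<phi> at
    \<open>a\<close> is compared with \<phi> at an interior point.\<close>
  define m where "m = (a + t) / 2"
  have m: "a < m" "m < t" using \<open>a < t\<close> unfolding m_def by auto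
  have rn: "real (2 * (n - 1)) = 2 * (real n - 1)" using n_ge_2 by auto
  have "\<phi> a \<ge> \<phi> m"
  proof (rule DERIV_nonpos_imp_decreasing_open[where f = \<phi>])
    show "a \<le> m" using m by simp
    have "{a..m} \<subseteq> {a..t}" using m by auto
    then show "continuous_on {a..m} \<phi>" unfolding \<phi>_def
      using c by (auto intro!: continuous_intros intro: continuous_on_subset)
    fix s assume s: "a < s" "s < m"
    then have as: "a < s" "s < t" using m by auto
    note b1 = branchD[OF B(1) as] and b2 = branchD[OF B(2) as]
    define q where "q = r1 s ^ (2 * (n - 1))"
    have q: "q > 0" using b1 unfolding q_def by simp
    have r12: "r1 s \<le> r2 s"
      using r_diff_mono[OF B c(1,2), of a s] lt as ra by fastforce
    have h12: "h1 s < h2 s" using lt as by simp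
    define d where "d = (2 * (real n - 1) * q / r1 s * (- 1 / h1 s)) * ((h2 s)\<^sup>2 - (h1 s)\<^sup>2)
       + q * (2 * h2 s * ((real n - 1) / r2 s - f s / h2 s) - 2 * h1 s * ((real n - 1) / r1 s - f s / h1 s))"
    have "((\<lambda>s. (h2 s)\<^sup>2 - (h1 s)\<^sup>2) has_real_derivative
        2 * h2 s * ((real n - 1) / r2 s - f s / h2 s) - 2 * h1 s * ((real n - 1) / r1 s - f s / h1 s)) (at s)"
      using DERIV_diff[OF DERIV_power[OF b2(4), of 2] DERIV_power[OF b1(4), of 2]] by (simp add: mult_ac)
    from DERIV_mult'[OF DERIV_power_div[OF b1(3), of "2 * (n - 1)"] this]
    have "(\<phi> has_real_derivative d) (at s)"
      using b1(1) unfolding \<phi>_def d_def q_def rn by (simp add: add.commute)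
    moreover have "d \<le> 0"
    proof -
      \<comment> \<open>(h^2)' = 2(n-1)h/r - 2f, so \<open>f\<close> cancels in the difference
        whatever its sign.\<close>
      have "2 * h2 s * ((real n - 1) / r2 s - f s / h2 s) - 2 * h1 s * ((real n - 1) / r1 s - f s / h1 s)
        = 2 * (real n - 1) * (h2 s / r2 s - h1 s / r1 s)"
        using b1 b2 by (simp add: field_simps)
      also have "\<dots> \<le> 2 * (real n - 1) * (h2 s / r1 s - h1 s / r1 s)"
        using n_ge_2 b1 b2 r12 by (intro mult_left_mono) (auto intro!: divide_left_mono)
      finally have 1: "2 * h2 s * ((real n - 1) / r2 s - f s / h2 s) - 2 * h1 s * ((real n - 1) / r1 s - f s / h1 s)
         \<le> 2 * (real n - 1) * ((h2 s - h1 s) / r1 s)" by (simp add: diff_divide_distrib)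
      have "d \<le> (2 * (real n - 1) * q / r1 s * (- 1 / h1 s)) * ((h2 s)\<^sup>2 - (h1 s)\<^sup>2)
         + q * (2 * (real n - 1) * ((h2 s - h1 s) / r1 s))"
        unfolding d_def using 1 q by (intro add_left_mono mult_left_mono) auto
      \<comment> \<open>The decay of the weight outweighs the growth of h2^2 - h1^2, since 1 - (h1 +
        h2)/h1 = -h2/h1.\<close>
      also have "\<dots> = (2 * (real n - 1) * q / r1 s) * (h2 s - h1 s) * (- h2 s / h1 s)"
        using b1 by (simp add: field_simps power2_eq_square)
      also have "\<dots> \<le> 0"
        using n_ge_2 q b1 b2 h12 by (intro mult_nonneg_nonpos) auto
      finally show ?thesis .
    qed
    ultimately show "\<exists>y. (\<phi> has_real_derivative y) (at s) \<and> y \<le> 0" by blast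
  qed
  moreover have "\<phi> m > 0"
    using branchD[OF B(1) m] branchD[OF B(2) m] lt[OF m] unfolding \<phi>_def
    by (auto intro!: mult_pos_pos power_strict_mono)
  ultimately have "\<phi> a > 0" by simp
  then have "0 < r1 a ^ (2 * (n - 1)) * ((h2 a)\<^sup>2 - (h1 a)\<^sup>2)" unfolding \<phi>_def .
  moreover have "0 \<le> r1 a ^ (2 * (n - 1))" by (simp add: power_mult)
  ultimately show ?thesis by (simp add: zero_less_mult_iff)
qed

text \<open>Continuity argument from \<open>t\<close> downwards: at the largest value where h1 < h2
  fails the speeds agree, \<open>inv\<close> orders the radii there, and
  \<open>h_less_at_left\<close> contradicts the equality. Each region of values below only has to
  supply its own \<open>inv\<close>.\<close>

lemma h_less_propagates:
  assumes B: "branch a t r1 h1" "branch a t r2 h2"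
    and c: "continuous_on {a..t} r1" "continuous_on {a..t} r2"
      "continuous_on {a..t} h1" "continuous_on {a..t} h2"
    and top: "h1 t < h2 t"
    and inv: "\<And>s. a \<le> s \<Longrightarrow> s < t \<Longrightarrow> h1 s = h2 s \<Longrightarrow> (\<And>x. s < x \<Longrightarrow> x \<le> t \<Longrightarrow> h1 x < h2 x) \<Longrightarrow> r1 s \<le> r2 s"
    and s: "a \<le> s" "s \<le> t"
  shows "h1 s < h2 s"
proof (rule ccontr)
  assume n: "\<not> h1 s < h2 s"
  define A where "A = {x\<in>{a..t}. h2 x - h1 x \<le> 0}"
  have "closed A" unfolding A_def
    by (rule continuous_on_closed_Collect_le)
       (auto intro!: continuous_intros c)
  moreover have "bounded A" by (rule bounded_subset[of "{a..t}"]) (auto simp: A_def)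
  ultimately have cA: "compact A" by (simp add: compact_eq_bounded_closed)
  have "s \<in> A" using n s unfolding A_def by auto
  then obtain x where x: "x \<in> A" "\<And>y. y \<in> A \<Longrightarrow> y \<le> x"
    using compact_attains_sup[OF cA] by auto
  have xt: "x < t" using x(1) top unfolding A_def by (cases "x = t") auto
  have ax: "a \<le> x" using x(1) unfolding A_def by auto
  have gt: "h1 y < h2 y" if "x < y" "y \<le> t" for y
    using x(2)[of y] that ax unfolding A_def by force
  have sub: "{x..t} \<subseteq> {a..t}" using ax by auto
  have "\<exists>y\<ge>x. y \<le> t \<and> h2 y - h1 y = 0"
    by (rule IVT') (use x(1) top xt in \<open>auto simp: A_def intro!: continuous_intros continuous_on_subset[OF c(3) sub] continuous_on_subset[OF c(4) sub]\<close>)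
  then obtain y where y: "x \<le> y" "y \<le> t" "h2 y = h1 y" by auto
  then have eq: "h1 x = h2 x" using gt[of y] by (cases "y = x") auto
  have "(h1 x)\<^sup>2 < (h2 x)\<^sup>2"
    using h_less_at_left[OF xt branch_subset[OF B(1) ax order_refl] branch_subset[OF B(2) ax order_refl]
        continuous_on_subset[OF c(1) sub] continuous_on_subset[OF c(2) sub]
        continuous_on_subset[OF c(3) sub] continuous_on_subset[OF c(4) sub]]
      gt inv[OF ax xt eq gt] by simp
  then show False using eq by simp
qed

section \<open>Flux and Pohozaev quantity for values above \<beta>\<close>

definition flux :: "(real \<Rightarrow> real) \<Rightarrow> (real \<Rightarrow> real) \<Rightarrow> real \<Rightarrow> real" where
  "flux r h s = r s ^ (n - 1) * h s"

definition pohozaev :: "(real \<Rightarrow> real) \<Rightarrow> (real \<Rightarrow> real) \<Rightarrow> real \<Rightarrow> real" where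
  "pohozaev r h s = r s ^ (n - 1) * (r s * ((h s)\<^sup>2 + 2 * F s) / 2 - real n * h s * (F s / f s))"

lemma real_n_minus_1: "real (n - 1) = real n - 1" "real (n - Suc 0) = real n - 1"
  using n_ge_2 by auto

lemma flux_pos: "branch a c r h \<Longrightarrow> a < s \<Longrightarrow> s < c \<Longrightarrow> 0 < flux r h s"
  unfolding flux_def using branchD by simp

lemma flux_deriv:
  assumes "branch a c r h" "a < s" "s < c"
  shows "(flux r h has_real_derivative - flux r h s * f s / (h s)\<^sup>2) (at s)"
proof -
  note b = branchD[OF assms]
  show ?thesis
    unfolding flux_def[abs_def]
    by (rule DERIV_cong[OF DERIV_mult'[OF DERIV_power_div[OF b(3), of "n - 1"] b(4)]])
      (use b(1,2) in \<open>simp_all add: real_n_minus_1 field_simps power2_eq_square\<close>)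
qed

lemma flux_ratio_deriv:
  assumes "branch a c r1 h1" "branch a c r2 h2" "a < s" "s < c"
  shows "((\<lambda>s. flux r2 h2 s / flux r1 h1 s) has_real_derivative
    flux r2 h2 s / flux r1 h1 s * f s * (1 / (h1 s)\<^sup>2 - 1 / (h2 s)\<^sup>2)) (at s)"
proof -
  have p: "flux r1 h1 s > 0" "h1 s > 0" "h2 s > 0"
    using flux_pos branchD assms by blast+
  show ?thesis
    by (rule DERIV_cong[OF DERIV_divide[OF flux_deriv[OF assms(2-4)] flux_deriv[OF assms(1,3,4)]]])
      (use p in \<open>simp_all add: field_simps power2_eq_square\<close>)
qed

text \<open>\<open>\<sigma>\<close> carries the sign of \<open>f\<close>: it is taken as 1 above
  \<beta> and as -1 below -\<beta>, where the ratio varies in the opposite direction.\<close>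

lemma flux_ratio_mono:
  assumes B: "branch a c r1 h1" "branch a c r2 h2"
    and xy: "a < x" "x \<le> y" "y < c"
    and lt: "\<And>s. x < s \<Longrightarrow> s < y \<Longrightarrow> h1 s \<le> h2 s"
    and fn: "\<And>s. x < s \<Longrightarrow> s < y \<Longrightarrow> 0 \<le> \<sigma> * f s"
  shows "\<sigma> * (flux r2 h2 x / flux r1 h1 x) \<le> \<sigma> * (flux r2 h2 y / flux r1 h1 y)"
proof (rule DERIV_nonneg_imp_increasing_open[OF xy(2)])
  fix s assume s: "x < s" "s < y"
  then have as: "a < s" "s < c" using xy by auto
  have p: "flux r1 h1 s > 0" "flux r2 h2 s > 0" "h1 s > 0" "h2 s > 0"
    using flux_pos branchD as B by blast+
  have h: "0 \<le> 1 / (h1 s)\<^sup>2 - 1 / (h2 s)\<^sup>2"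
    using p lt[OF s] by (auto intro!: divide_left_mono power_mono)
  have "0 \<le> (flux r2 h2 s / flux r1 h1 s) * (\<sigma> * f s) * (1 / (h1 s)\<^sup>2 - 1 / (h2 s)\<^sup>2)"
    by (rule mult_nonneg_nonneg[OF mult_nonneg_nonneg[OF _ fn[OF s]] h]) (use p in simp)
  moreover have "((\<lambda>s. \<sigma> * (flux r2 h2 s / flux r1 h1 s)) has_real_derivative
       \<sigma> * (flux r2 h2 s / flux r1 h1 s * f s * (1 / (h1 s)\<^sup>2 - 1 / (h2 s)\<^sup>2))) (at s)"
    by (rule DERIV_cmult[OF flux_ratio_deriv[OF B as]])
  ultimately show "\<exists>d. ((\<lambda>s. \<sigma> * (flux r2 h2 s / flux r1 h1 s)) has_real_derivative d) (at s) \<and> 0 \<le> d"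
    by (auto intro!: exI simp only: mult.assoc mult.left_commute[of \<sigma>])
next
  have "isCont (\<lambda>s. \<sigma> * (flux r2 h2 s / flux r1 h1 s)) s" if "s \<in> {x..y}" for s
    using that xy by (intro continuous_intros DERIV_isCont[OF flux_ratio_deriv[OF B], simplified]) auto
  then show "continuous_on {x..y} (\<lambda>s. \<sigma> * (flux r2 h2 s / flux r1 h1 s))"
    by (rule continuous_at_imp_continuous_on[rule_format])
qed

text \<open>Only the derivative \<open>k\<close> of F/f survives. The factor n k - (n-2)/2 is
  nonnegative exactly when k \<ge> (n-2)/(2n), which is the origin of that constant.\<close>

lemma pohozaev_deriv:
  assumes B: "branch a c r h" "a < s" "s < c"
    and q: "((\<lambda>t. F t / f t) has_real_derivative k) (at s)" and f0: "f s \<noteq> 0"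
  shows "(pohozaev r h has_real_derivative - flux r h s * (real n * k - (real n - 2) / 2)) (at s)"
proof -
  note b = branchD[OF B]
  define E' where "E' = 2 * (real n - 1) * h s / r s"
  have E: "((\<lambda>s. (h s)\<^sup>2 + 2 * F s) has_real_derivative E') (at s)"
    unfolding E'_def
    by (rule DERIV_cong[OF DERIV_add[OF DERIV_power[OF b(4), of 2] DERIV_cmult[OF F_deriv, of 2]]])
      (use b(1,2) in \<open>simp add: field_simps\<close>)
  define q where "q = F s / f s"
  have F: "F s = q * f s" unfolding q_def using f0 by simp
  define Q where "Q = r s ^ (n - 1)"
  define A where "A = r s * ((h s)\<^sup>2 + 2 * F s) / 2 - real n * h s * q"
  define A' where "A' = (r s * E' - 1 / h s * ((h s)\<^sup>2 + 2 * F s)) / 2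
       - (real n * h s * k + real n * ((real n - 1) / r s - f s / h s) * q)"
  have "((\<lambda>s. r s * ((h s)\<^sup>2 + 2 * F s) / 2 - real n * h s * (F s / f s)) has_real_derivative A') (at s)"
    using DERIV_diff[OF DERIV_cdivide[OF DERIV_mult'[OF b(3) E], of 2] DERIV_mult'[OF DERIV_cmult[OF b(4), of "real n"] q]]
    unfolding A'_def q_def by simp
  from DERIV_mult'[OF DERIV_power_div[OF b(3), of "n - 1"] this]
  have "(pohozaev r h has_real_derivative Q * A' + real (n - 1) * Q / r s * (- 1 / h s) * A) (at s)"
    using b(1) unfolding pohozaev_def[abs_def] Q_def A_def q_def by simp
  moreover have "Q * A' + real (n - 1) * Q / r s * (- 1 / h s) * A
     = - (Q * h s) * (real n * k - (real n - 2) / 2)"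
    using b(1,2) unfolding A'_def A_def E'_def F real_n_minus_1(1)
    by (simp add: field_simps power2_eq_square)
  ultimately show ?thesis unfolding flux_def Q_def by simp
qed

lemma pohozaev_cont:
  assumes "continuous_on S r" "continuous_on S h" "\<And>s. s \<in> S \<Longrightarrow> f s \<noteq> 0"
  shows "continuous_on S (pohozaev r h)"
  unfolding pohozaev_def[abs_def] using assms by (auto intro!: continuous_intros F_cont f_cont_on)

lemma G_nonneg: "\<beta> < s \<Longrightarrow> 0 \<le> real n * K s - (real n - 2) / 2"
  using frac_ge[of s] n_ge_2 by (simp add: field_simps)

text \<open>\<open>\<kappa>\<close> freezes the flux ratio at the lower end \<open>s\<close>. The
  ratio is nondecreasing in the value where f > 0, so flux2 - \<kappa> flux1 \<ge> 0 to the right of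
  \<open>s\<close>, and this difference is the weight in the derivative of P2 - \<kappa> P1.\<close>

lemma pohozaev_compare:
  assumes B: "branch l a r1 h1" "branch l a r2 h2" and l: "l < s" "\<beta> \<le> s" "s < a"
    and c: "continuous_on {s..a} r1" "continuous_on {s..a} r2"
      "continuous_on {s..a} h1" "continuous_on {s..a} h2"
    and lt: "\<And>x. s < x \<Longrightarrow> x < a \<Longrightarrow> h1 x < h2 x"
    and kap: "\<kappa> = flux r2 h2 s / flux r1 h1 s"
  shows "pohozaev r2 h2 a - \<kappa> * pohozaev r1 h1 a \<le> pohozaev r2 h2 s - \<kappa> * pohozaev r1 h1 s"
proof (rule DERIV_nonpos_imp_decreasing_open[where f = "\<lambda>s. pohozaev r2 h2 s - \<kappa> * pohozaev r1 h1 s"])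
  show "s \<le> a" using l by simp
  have "f x \<noteq> 0" if "x \<in> {s..a}" for x using f_pos[of x] b_less l that by auto
  then show "continuous_on {s..a} (\<lambda>s. pohozaev r2 h2 s - \<kappa> * pohozaev r1 h1 s)"
    using c by (auto intro!: continuous_intros pohozaev_cont)
  fix x assume x: "s < x" "x < a"
  then have lx: "l < x" "\<beta> < x" using l by auto
  have f0: "f x \<noteq> 0" using f_pos[of x] b_less lx by auto
  define G where "G = real n * K x - (real n - 2) / 2"
  have G: "0 \<le> G" unfolding G_def by (rule G_nonneg[OF lx(2)])
  have "\<kappa> \<le> flux r2 h2 x / flux r1 h1 x"
  proof -
    have "1 * (flux r2 h2 s / flux r1 h1 s) \<le> 1 * (flux r2 h2 x / flux r1 h1 x)"
    proof (rule flux_ratio_mono[OF B l(1) less_imp_le[OF x(1)] x(2)])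
      fix y assume y: "s < y" "y < x"
      show "h1 y \<le> h2 y" using lt[of y] y x by simp
      show "0 \<le> 1 * f y" using f_pos[of y] y l b_less by simp
    qed
    then show ?thesis unfolding kap by simp
  qed
  then have "\<kappa> * flux r1 h1 x \<le> flux r2 h2 x"
    using flux_pos[OF B(1) lx(1) x(2)] by (simp add: field_simps)
  from mult_right_mono[OF this G]
  have "- flux r2 h2 x * G - \<kappa> * (- flux r1 h1 x * G) \<le> 0"
    by (simp add: algebra_simps)
  moreover have "((\<lambda>s. pohozaev r2 h2 s - \<kappa> * pohozaev r1 h1 s) has_real_derivative
      - flux r2 h2 x * G - \<kappa> * (- flux r1 h1 x * G)) (at x)"
    unfolding G_def
    by (intro DERIV_diff DERIV_cmult pohozaev_deriv[OF B(1) lx(1) x(2)] pohozaev_deriv[OF B(2) lx(1) x(2)] frac_deriv lx f0)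
  ultimately show "\<exists>y. ((\<lambda>s. pohozaev r2 h2 s - \<kappa> * pohozaev r1 h1 s) has_real_derivative y) (at x) \<and> y \<le> 0"
    by blast
qed

text \<open>At a first crossing with \<open>r2 < r1\<close>
  one would have \<open>P2 - \<kappa> P1 < 0\<close> for \<open>\<kappa> = (r2 / r1)\<^bsup>n-1\<^esup> < 1\<close>, contradicting the monotonicity of
  \<open>P2 - \<kappa> P1\<close>.\<close>

lemma descend_from_top:
  assumes B: "branch l a r1 h1" "branch l a r2 h2" and l: "l < \<beta>" "\<beta> < a"
    and c: "continuous_on {\<beta>..a} r1" "continuous_on {\<beta>..a} r2"
      "continuous_on {\<beta>..a} h1" "continuous_on {\<beta>..a} h2"
    and top: "h1 a < h2 a" and P: "0 \<le> pohozaev r1 h1 a" "pohozaev r1 h1 a \<le> pohozaev r2 h2 a"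
  shows "\<And>s. \<beta> \<le> s \<Longrightarrow> s \<le> a \<Longrightarrow> h1 s < h2 s"
    and "flux r2 h2 \<beta> \<le> flux r1 h1 \<beta> \<or> pohozaev r1 h1 a = 0 \<Longrightarrow> r1 \<beta> * h1 \<beta> \<le> r2 \<beta> * h2 \<beta>"
proof -
  have c': "continuous_on {s..a} r1" "continuous_on {s..a} r2"
    "continuous_on {s..a} h1" "continuous_on {s..a} h2" if "\<beta> \<le> s" for s
    using that c by (auto elim: continuous_on_subset)
  show *: "h1 s < h2 s" if s: "\<beta> \<le> s" "s \<le> a" for s
  proof (rule h_less_propagates[OF branch_subset[OF B(1)] branch_subset[OF B(2)] c top _ s])
    fix s assume s: "\<beta> \<le> s" "s < a" and eq: "h1 s = h2 s" and lt: "\<And>x. s < x \<Longrightarrow> x \<le> a \<Longrightarrow> h1 x < h2 x"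
    show "r1 s \<le> r2 s"
    proof (rule ccontr)
      assume "\<not> r1 s \<le> r2 s"
      then have r: "r2 s < r1 s" by simp
      have ls: "l < s" using l s by simp
      note b1 = branchD[OF B(1) ls s(2)] and b2 = branchD[OF B(2) ls s(2)]
      define \<kappa> where "\<kappa> = flux r2 h2 s / flux r1 h1 s"
      have kap: "\<kappa> * r1 s ^ (n - 1) = r2 s ^ (n - 1)"
        unfolding \<kappa>_def flux_def using b1 b2 eq by simp
      have "r2 s ^ (n - 1) < r1 s ^ (n - 1)"
        using r b2 n_ge_2 by (intro power_strict_mono) auto
      then have k1: "\<kappa> < 1" unfolding \<kappa>_def flux_def using b1 b2 eq by simp
      have "\<kappa> * pohozaev r1 h1 a \<le> pohozaev r1 h1 a"
        using mult_right_mono[of \<kappa> 1 "pohozaev r1 h1 a"] P(1) k1 by simp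
      then have "0 \<le> pohozaev r2 h2 s - \<kappa> * pohozaev r1 h1 s"
        using pohozaev_compare[OF B ls s c'[OF s(1)] lt \<kappa>_def] P(2) by force
      also have "\<kappa> * pohozaev r1 h1 s = r2 s ^ (n - 1) * (r1 s * ((h2 s)\<^sup>2 + 2 * F s) / 2 - real n * h2 s * (F s / f s))"
        unfolding pohozaev_def kap[symmetric] eq by simp
      \<comment> \<open>With equal speeds and this \<open>\<kappa>\<close> the terms in F/f cancel;
        the energy times r2 - r1 remains.\<close>
      also have "pohozaev r2 h2 s - \<dots> = r2 s ^ (n - 1) * (((h2 s)\<^sup>2 + 2 * F s) / 2) * (r2 s - r1 s)"
        unfolding pohozaev_def right_diff_distrib[symmetric] by (simp add: field_simps)
      also have "\<dots> < 0"
      proof (intro mult_pos_neg mult_pos_pos)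
        have "0 \<le> F s" using F_pos[of s] F_beta s by (cases "s = \<beta>") auto
        then show "0 < ((h2 s)\<^sup>2 + 2 * F s) / 2" using b2 by (simp add: add_pos_nonneg)
      qed (use r b2 in auto)
      finally show False by simp
    qed
  qed (use l in auto)
  \<comment> \<open>Either alternative gives \<kappa> P1(a) \<le> P1(a): the first through \<kappa>
    \<le> 1, the second because both sides are 0.\<close>
  assume or: "flux r2 h2 \<beta> \<le> flux r1 h1 \<beta> \<or> pohozaev r1 h1 a = 0"
  note b1 = branchD[OF B(1) l] and b2 = branchD[OF B(2) l]
  define \<kappa> where "\<kappa> = flux r2 h2 \<beta> / flux r1 h1 \<beta>"
  have k: "\<kappa> \<ge> 0" using flux_pos[OF B(1) l] flux_pos[OF B(2) l] unfolding \<kappa>_def by simp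
  have "pohozaev r2 h2 a - \<kappa> * pohozaev r1 h1 a \<ge> 0"
  proof (cases "pohozaev r1 h1 a = 0")
    case False
    then have "\<kappa> \<le> 1" using or flux_pos[OF B(1) l] unfolding \<kappa>_def by simp
    then have "\<kappa> * pohozaev r1 h1 a \<le> pohozaev r1 h1 a" using mult_right_mono[of \<kappa> 1 "pohozaev r1 h1 a"] P(1) by simp
    then show ?thesis using P by simp
  qed (use P in simp)
  then have "0 \<le> pohozaev r2 h2 \<beta> - \<kappa> * pohozaev r1 h1 \<beta>"
    using pohozaev_compare[OF B l(1) order_refl l(2) c _ \<kappa>_def] * by force
  \<comment> \<open>Since F vanishes at \<beta>, P is half the product of flux and r h, and
    \<open>\<kappa>\<close> exchanges flux1 for flux2. A common positive factor can then be
    cancelled.\<close>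
  also have "\<kappa> * pohozaev r1 h1 \<beta> = flux r2 h2 \<beta> * (r1 \<beta> * h1 \<beta>) / 2"
    unfolding \<kappa>_def flux_def pohozaev_def F_beta using b1 b2 by (simp add: field_simps power2_eq_square)
  also have "pohozaev r2 h2 \<beta> = flux r2 h2 \<beta> * (r2 \<beta> * h2 \<beta>) / 2"
    unfolding flux_def pohozaev_def F_beta using b1 b2 by (simp add: field_simps power2_eq_square)
  finally show "r1 \<beta> * h1 \<beta> \<le> r2 \<beta> * h2 \<beta>"
    using flux_pos[OF B(2) l] by simp
qed

text \<open>If r2 < r1, splitting off the power n-2 from the flux only helps, since r2^(n-2) \<le>
  r1^(n-2). It settles the case left open by the flux alternative in
  \<open>descend_from_top\<close>.\<close>

lemma rh_le_if_flux_le: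
  fixes r1 r2 h1 h2 :: real
  assumes "0 < r1" "0 < r2" "0 < h1" "h1 \<le> h2" "r1 ^ (n - 1) * h1 \<le> r2 ^ (n - 1) * h2"
  shows "r1 * h1 \<le> r2 * h2"
proof (cases "r1 \<le> r2")
  case True
  then show ?thesis using assms by (intro mult_mono) simp_all
next
  case False
  obtain m where m: "n - 1 = Suc m" using n_ge_2 by (cases "n - 1") auto
  have "r1 ^ m * (r1 * h1) \<le> r2 ^ m * (r2 * h2)" using assms(5) unfolding m by (simp add: mult_ac)
  also have "\<dots> \<le> r1 ^ m * (r2 * h2)" using assms False by (intro mult_right_mono power_mono) auto
  finally show ?thesis using assms by simp
qed

end

section \<open>The quantity \<open>W\<close> for values between -\<beta> and \<beta>\<close>

text \<open>These are the two terms of the derivative of \<open>W\<close>, with \<phi> = -2F. Both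
  decrease as the speed grows; this is where F \<le> 0 is used.\<close>

lemma slope_terms:
  fixes h1 h2 \<phi> :: real
  assumes "0 < h1" "h1 < h2" "0 \<le> \<phi>" "\<phi> < h1\<^sup>2"
  shows "h2 / sqrt (h2\<^sup>2 - \<phi>) \<le> h1 / sqrt (h1\<^sup>2 - \<phi>)"
    and "\<phi> / (h2 * sqrt (h2\<^sup>2 - \<phi>)) \<le> \<phi> / (h1 * sqrt (h1\<^sup>2 - \<phi>))"
    and "0 < \<phi> \<Longrightarrow> \<phi> / (h2 * sqrt (h2\<^sup>2 - \<phi>)) < \<phi> / (h1 * sqrt (h1\<^sup>2 - \<phi>))"
proof -
  have sq: "h1\<^sup>2 < h2\<^sup>2" using assms by (intro power_strict_mono) auto
  have p: "0 < sqrt (h1\<^sup>2 - \<phi>)" "0 < sqrt (h2\<^sup>2 - \<phi>)" using sq assms by auto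
  have lt: "h1 * sqrt (h1\<^sup>2 - \<phi>) < h2 * sqrt (h2\<^sup>2 - \<phi>)"
    using p assms sq by (intro mult_strict_mono) auto
  have "(h2 * sqrt (h1\<^sup>2 - \<phi>))\<^sup>2 \<le> (h1 * sqrt (h2\<^sup>2 - \<phi>))\<^sup>2"
    using sq assms mult_right_mono[of "h1\<^sup>2" "h2\<^sup>2" \<phi>] by (simp add: power_mult_distrib algebra_simps)
  then have "h2 * sqrt (h1\<^sup>2 - \<phi>) \<le> h1 * sqrt (h2\<^sup>2 - \<phi>)"
    by (rule power2_le_imp_le) (use p assms in simp)
  then show "h2 / sqrt (h2\<^sup>2 - \<phi>) \<le> h1 / sqrt (h1\<^sup>2 - \<phi>)"
    using p by (simp add: field_simps)
  have q: "0 < h2 * sqrt (h2\<^sup>2 - \<phi>) * (h1 * sqrt (h1\<^sup>2 - \<phi>))"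
    by (intro mult_pos_pos p) (use assms in auto)
  show "\<phi> / (h2 * sqrt (h2\<^sup>2 - \<phi>)) \<le> \<phi> / (h1 * sqrt (h1\<^sup>2 - \<phi>))"
    by (rule divide_left_mono[OF less_imp_le[OF lt]]) (use assms q in simp_all)
  show "\<phi> / (h2 * sqrt (h2\<^sup>2 - \<phi>)) < \<phi> / (h1 * sqrt (h1\<^sup>2 - \<phi>))" if "0 < \<phi>"
    by (rule divide_strict_left_mono[OF lt]) (use that q in simp_all)
qed

context radial_nonlinearity
begin

definition energy :: "(real \<Rightarrow> real) \<Rightarrow> real \<Rightarrow> real" where
  "energy h s = (h s)\<^sup>2 + 2 * F s"

definition W :: "(real \<Rightarrow> real) \<Rightarrow> (real \<Rightarrow> real) \<Rightarrow> real \<Rightarrow> real" where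
  "W r h s = r s * sqrt (energy h s)"

lemma energy_less: "0 < h1 s \<Longrightarrow> h1 s < h2 s \<Longrightarrow> energy h1 s < energy h2 s"
  unfolding energy_def by (simp add: power_strict_mono)

lemma energy_deriv:
  assumes "branch a c r h" "a < s" "s < c"
  shows "(energy h has_real_derivative 2 * (real n - 1) * h s / r s) (at s)"
proof -
  note b = branchD[OF assms]
  show ?thesis unfolding energy_def[abs_def]
    by (rule DERIV_cong[OF DERIV_add[OF DERIV_power[OF b(4), of 2] DERIV_cmult[OF F_deriv, of 2]]])
      (use b(1,2) in \<open>simp add: field_simps\<close>)
qed

text \<open>The energy contributes (n-1) h / sqrt E and r' contributes -(sqrt E)/h; splitting the
  latter by E = h^2 + 2F leaves the two terms of \<open>slope_terms\<close>.\<close>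

lemma W_deriv:
  assumes B: "branch a c r h" "a < s" "s < c" and E: "0 < energy h s"
  shows "(W r h has_real_derivative
    (real n - 2) * (h s / sqrt (energy h s)) + (- 2 * F s) / (h s * sqrt (energy h s))) (at s)"
proof -
  note b = branchD[OF B]
  define e where "e = sqrt (energy h s)"
  have e: "0 < e" "e * e = h s * h s + 2 * F s"
    using E unfolding e_def by (auto simp: energy_def power2_eq_square)
  have "((\<lambda>s. sqrt (energy h s)) has_real_derivative inverse e / 2 * (2 * (real n - 1) * h s / r s)) (at s)"
    unfolding e_def by (rule DERIV_chain2[OF DERIV_real_sqrt[OF E] energy_deriv[OF B]])
  from DERIV_mult'[OF b(3) this]
  have d: "(W r h has_real_derivative r s * (inverse e / 2 * (2 * (real n - 1) * h s / r s)) + - 1 / h s * e) (at s)"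
    unfolding W_def[abs_def] e_def .
  have "- 1 / h s * e = - (e * e) / (h s * e)" using e(1) b(2) by simp
  also have "\<dots> = - (h s * h s) / (h s * e) + (- 2 * F s) / (h s * e)"
    unfolding e(2) add_divide_distrib[symmetric] by simp
  also have "\<dots> = - (h s / e) + (- 2 * F s) / (h s * e)"
    using b(2) by simp
  finally have eq: "- 1 / h s * e = - (h s / e) + (- 2 * F s) / (h s * e)" .
  have "r s * (inverse e / 2 * (2 * (real n - 1) * h s / r s)) = (real n - 1) * (h s / e)"
    using b(1) e(1) by (simp add: field_simps)
  then have "r s * (inverse e / 2 * (2 * (real n - 1) * h s / r s)) + - 1 / h s * e
     = (real n - 1) * (h s / e) + (- (h s / e) + (- 2 * F s) / (h s * e))"
    unfolding eq by (simp only:)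
  also have "\<dots> = (real n - 2) * (h s / e) + (- 2 * F s) / (h s * e)"
    by (simp add: algebra_simps diff_divide_distrib)
  finally show ?thesis using d unfolding e_def by simp
qed

lemma W_cont:
  assumes "continuous_on S r" "continuous_on S h"
  shows "continuous_on S (W r h)"
  unfolding W_def[abs_def] energy_def[abs_def] using assms by (auto intro!: continuous_intros F_cont)

lemma W_diff_deriv:
  assumes B: "branch a c r1 h1" "branch a c r2 h2" "a < s" "s < c"
    and E: "0 < energy h1 s" and lt: "h1 s < h2 s" and F: "F s \<le> 0"
  shows "\<exists>d. ((\<lambda>s. W r2 h2 s - W r1 h1 s) has_real_derivative d) (at s) \<and> d \<le> 0 \<and> (F s < 0 \<longrightarrow> d < 0)"
proof -
  have h1: "0 < h1 s" using branchD B by blast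
  have "(h1 s)\<^sup>2 < (h2 s)\<^sup>2" using lt h1 by (intro power_strict_mono) auto
  then have E2: "0 < energy h2 s" using E unfolding energy_def by simp
  have eq: "energy h1 s = (h1 s)\<^sup>2 - (- 2 * F s)" "energy h2 s = (h2 s)\<^sup>2 - (- 2 * F s)"
    unfolding energy_def by auto
  have phi: "0 \<le> - 2 * F s" "- 2 * F s < (h1 s)\<^sup>2" using F E unfolding energy_def by auto
  define d where "d = (real n - 2) * (h2 s / sqrt (energy h2 s)) + (- 2 * F s) / (h2 s * sqrt (energy h2 s))
     - ((real n - 2) * (h1 s / sqrt (energy h1 s)) + (- 2 * F s) / (h1 s * sqrt (energy h1 s)))"
  have der: "((\<lambda>s. W r2 h2 s - W r1 h1 s) has_real_derivative d) (at s)"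
    unfolding d_def by (rule DERIV_diff[OF W_deriv[OF B(2-4) E2] W_deriv[OF B(1,3,4) E]])
  note sl = slope_terms[OF h1 lt phi, folded eq]
  have m: "(real n - 2) * (h2 s / sqrt (energy h2 s)) \<le> (real n - 2) * (h1 s / sqrt (energy h1 s))"
    using sl(1) n_ge_2 by (intro mult_left_mono) auto
  have "d \<le> 0" "F s < 0 \<Longrightarrow> d < 0"
    unfolding d_def using m sl(2,3) by linarith+
  with der show ?thesis by blast
qed

text \<open>The strict version holds on parts of [b, \<beta>], where F < 0 in the interior. It
  yields the positive gap on which the final contradiction rests.\<close>

lemma W_diff_antimono:
  assumes B: "branch a c r1 h1" "branch a c r2 h2" and xy: "a < x" "y < c" "- \<beta> \<le> x" "y \<le> \<beta>"
    and E: "\<And>s. x \<le> s \<Longrightarrow> s \<le> y \<Longrightarrow> 0 < energy h1 s"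
    and lt: "\<And>s. x < s \<Longrightarrow> s < y \<Longrightarrow> h1 s < h2 s"
  shows "x \<le> y \<Longrightarrow> W r2 h2 y - W r1 h1 y \<le> W r2 h2 x - W r1 h1 x"
    and "b \<le> x \<Longrightarrow> x < y \<Longrightarrow> W r2 h2 y - W r1 h1 y < W r2 h2 x - W r1 h1 x"
proof -
  have "{x..y} \<subseteq> {a<..<c}" using xy by auto
  note cc = branch_cont[OF B(1) this] branch_cont[OF B(2) this]
  have cont: "continuous_on {x..y} (\<lambda>s. W r2 h2 s - W r1 h1 s)"
    by (intro continuous_on_diff W_cont cc)
  have F: "F s \<le> 0" if "x < s" "s < y" for s using that xy by (intro F_nonpos) auto
  show "W r2 h2 y - W r1 h1 y \<le> W r2 h2 x - W r1 h1 x" if "x \<le> y"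
  proof (rule DERIV_nonpos_imp_decreasing_open[where f = "\<lambda>s. W r2 h2 s - W r1 h1 s", OF that _ cont])
    fix s assume s: "x < s" "s < y"
    show "\<exists>d. ((\<lambda>s. W r2 h2 s - W r1 h1 s) has_real_derivative d) (at s) \<and> d \<le> 0"
      using W_diff_deriv[OF B, of s] s xy E lt F by fastforce
  qed
  show "W r2 h2 y - W r1 h1 y < W r2 h2 x - W r1 h1 x" if "b \<le> x" "x < y"
  proof (rule DERIV_neg_imp_decreasing_open[where f = "\<lambda>s. W r2 h2 s - W r1 h1 s", OF that(2) _ cont])
    fix s assume s: "x < s" "s < y"
    have "F s < 0" using F_neg s that xy by auto
    then show "\<exists>d. ((\<lambda>s. W r2 h2 s - W r1 h1 s) has_real_derivative d) (at s) \<and> d < 0"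
      using W_diff_deriv[OF B, of s] s xy E lt F by fastforce
  qed
qed

text \<open>W1 \<le> W2 is inherited from \<beta>, where W = r h. At a crossing the energies
  coincide, so it says r1 \<le> r2.\<close>

lemma core_less:
  assumes B: "branch l c r1 h1" "branch l c r2 h2" and x: "l < x" "\<beta> < c" "- \<beta> \<le> x"
    and E: "\<And>s. x \<le> s \<Longrightarrow> s \<le> \<beta> \<Longrightarrow> 0 < energy h1 s"
    and h: "h1 \<beta> < h2 \<beta>" and rh: "r1 \<beta> * h1 \<beta> \<le> r2 \<beta> * h2 \<beta>"
    and s: "x \<le> s" "s \<le> \<beta>"
  shows "h1 s < h2 s" "W r1 h1 s \<le> W r2 h2 s"
proof -
  have "{x..\<beta>} \<subseteq> {l<..<c}" using x by auto
  note cc = branch_cont[OF B(1) this] branch_cont[OF B(2) this]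
  have lb: "l < \<beta>" using x s by simp
  have W\<beta>: "W r1 h1 \<beta> \<le> W r2 h2 \<beta>"
    unfolding W_def energy_def using rh F_beta branchD(2)[OF B(1) lb x(2)] branchD(2)[OF B(2) lb x(2)] by simp
  have W: "W r1 h1 s \<le> W r2 h2 s" if s: "x \<le> s" "s \<le> \<beta>" and lt: "\<And>y. s < y \<Longrightarrow> y \<le> \<beta> \<Longrightarrow> h1 y < h2 y" for s
    using W_diff_antimono(1)[OF B, of s \<beta>] s x E lt W\<beta> by fastforce
  have h_less: "h1 s < h2 s" if s: "x \<le> s" "s \<le> \<beta>" for s
  proof (rule h_less_propagates[OF branch_subset[OF B(1)] branch_subset[OF B(2)] cc(1,3,2,4) h _ s])
    fix s assume s: "x \<le> s" "s < \<beta>" and eq: "h1 s = h2 s" and lt: "\<And>y. s < y \<Longrightarrow> y \<le> \<beta> \<Longrightarrow> h1 y < h2 y"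
    have "W r1 h1 s \<le> W r2 h2 s" using W s lt by simp
    then show "r1 s \<le> r2 s" using E[of s] s eq unfolding W_def energy_def by simp
  qed (use x in auto)
  then show "h1 s < h2 s" "W r1 h1 s \<le> W r2 h2 s" using s W by auto
qed

text \<open>The flux ratio changes direction with the sign of \<open>f\<close>, so r^(2n-2) E is
  transported instead. It equals the squared flux at \<beta> and -\<beta>, and its logarithmic
  derivative 2(n-1)(-2F)/(r h E) does not contain \<open>f\<close>. The denominator is W times h
  sqrt E, both ordered by hypothesis.\<close>

lemma flux_le_across_core:
  assumes B: "branch l c r1 h1" "branch l c r2 h2" and x: "l < - \<beta>" "\<beta> < c"
    and E: "\<And>s. - \<beta> \<le> s \<Longrightarrow> s \<le> \<beta> \<Longrightarrow> 0 < energy h1 s"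
    and h: "\<And>s. - \<beta> \<le> s \<Longrightarrow> s \<le> \<beta> \<Longrightarrow> h1 s < h2 s"
    and W: "\<And>s. - \<beta> \<le> s \<Longrightarrow> s \<le> \<beta> \<Longrightarrow> W r1 h1 s \<le> W r2 h2 s"
    and fl: "flux r1 h1 \<beta> \<le> flux r2 h2 \<beta>"
  shows "flux r1 h1 (- \<beta>) \<le> flux r2 h2 (- \<beta>)"
proof -
  define M where "M = (\<lambda>r h s. r s ^ (2 * (n - 1)) * energy h s)"
  have rn: "real (2 * (n - 1)) = 2 * (real n - 1)" using n_ge_2 by auto
  have E2: "0 < energy h2 s" if "- \<beta> \<le> s" "s \<le> \<beta>" for s
  proof -
    have "l < s" "s < c" using that x by auto
    then show ?thesis using energy_less[of h1 s h2, OF branchD(2)[OF B(1)] h[OF that]] E[OF that] by simp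
  qed
  have Mpos: "0 < M r h s" if "branch l c r h" "0 < energy h s" "l < s" "s < c" for r h s
    using branchD(1)[OF that(1,3,4)] that(2) unfolding M_def by simp
  have Md: "((\<lambda>s. ln (M r h s)) has_real_derivative 2 * (real n - 1) * ((- 2 * F s) / (r s * (h s * energy h s)))) (at s)"
    if br: "branch l c r h" and e: "0 < energy h s" and s: "l < s" "s < c" for r h s
  proof -
    note b = branchD[OF br s]
    define e where "e = energy h s"
    have e: "0 < e" "h s * h s = e - 2 * F s" using e unfolding e_def energy_def by (auto simp: power2_eq_square)
    define Q where "Q = r s ^ (2 * (n - 1))"
    have Q: "Q > 0" using b unfolding Q_def by simp
    have "(M r h has_real_derivative Q * (2 * (real n - 1) * h s / r s) + 2 * (real n - 1) * Q / r s * (- 1 / h s) * e) (at s)"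
      using DERIV_mult'[OF DERIV_power_div[OF b(3), of "2 * (n - 1)"] energy_deriv[OF br s]] b(1)
      unfolding M_def Q_def e_def rn by simp
    from DERIV_chain2[OF DERIV_ln[OF Mpos[OF br that(2) s]] this]
    have "((\<lambda>s. ln (M r h s)) has_real_derivative inverse (Q * e) * (Q * (2 * (real n - 1) * h s / r s) + 2 * (real n - 1) * Q / r s * (- 1 / h s) * e)) (at s)"
      unfolding M_def Q_def e_def .
    moreover have "inverse (Q * e) * (Q * (2 * (real n - 1) * h s / r s) + 2 * (real n - 1) * Q / r s * (- 1 / h s) * e)
      = 2 * (real n - 1) * ((h s * h s - e) / (r s * (h s * e)))"
      using Q e(1) b(1,2) by (simp add: field_simps)
    ultimately show ?thesis unfolding e(2) e_def by simp
  qed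
  have "ln (M r2 h2 \<beta>) - ln (M r1 h1 \<beta>) \<le> ln (M r2 h2 (- \<beta>)) - ln (M r1 h1 (- \<beta>))"
  proof (rule DERIV_nonpos_imp_nonincreasing[where f = "\<lambda>s. ln (M r2 h2 s) - ln (M r1 h1 s)"])
    show "- \<beta> \<le> \<beta>" using beta_pos by simp
    fix s assume s: "- \<beta> \<le> s" "s \<le> \<beta>"
    then have ls: "l < s" "s < c" using x by auto
    note b1 = branchD[OF B(1) ls] and b2 = branchD[OF B(2) ls]
    have phi: "0 \<le> - 2 * F s" using F_nonpos[of s] s by auto
    have e12: "energy h1 s \<le> energy h2 s" using energy_less[of h1 s h2, OF b1(2) h[OF s]] by simp
    have "(r1 s * sqrt (energy h1 s)) * (h1 s * sqrt (energy h1 s)) \<le> (r2 s * sqrt (energy h2 s)) * (h2 s * sqrt (energy h2 s))"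
      by (rule mult_mono[OF W[OF s, unfolded W_def] mult_mono])
        (use h[OF s] b1(1,2) b2(1,2) e12 E[OF s] E2[OF s] in auto)
    then have "r1 s * (h1 s * energy h1 s) \<le> r2 s * (h2 s * energy h2 s)"
      using E[OF s] E2[OF s] by (simp add: mult_ac)
    then have "(- 2 * F s) / (r2 s * (h2 s * energy h2 s)) \<le> (- 2 * F s) / (r1 s * (h1 s * energy h1 s))"
      using b1 b2 E[OF s] E2[OF s] phi by (intro divide_left_mono) auto
    then have "2 * (real n - 1) * ((- 2 * F s) / (r2 s * (h2 s * energy h2 s))) - 2 * (real n - 1) * ((- 2 * F s) / (r1 s * (h1 s * energy h1 s))) \<le> 0"
      unfolding diff_le_0_iff_le using n_ge_2 by (intro mult_left_mono) auto
    with DERIV_diff[OF Md[OF B(2) E2[OF s] ls] Md[OF B(1) E[OF s] ls]]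
    show "\<exists>d. ((\<lambda>s. ln (M r2 h2 s) - ln (M r1 h1 s)) has_real_derivative d) (at s) \<and> d \<le> 0" by blast
  qed
  moreover have lb: "l < \<beta>" "- \<beta> < c" using x beta_pos by auto
  have fM: "M r h s = (flux r h s)\<^sup>2" if "F s = 0" for r h s
    unfolding M_def flux_def energy_def that by (simp add: power_mult_distrib power_mult[symmetric] mult.commute)
  have F0: "F (- \<beta>) = 0" using F_beta F_even by simp
  have "ln (M r1 h1 \<beta>) \<le> ln (M r2 h2 \<beta>)"
    using fl flux_pos[OF B(1) lb(1) x(2)] by (simp add: fM F_beta)
  ultimately have "ln (M r1 h1 (- \<beta>)) \<le> ln (M r2 h2 (- \<beta>))" by simp
  then have "M r1 h1 (- \<beta>) \<le> M r2 h2 (- \<beta>)"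
    using Mpos[OF B(1) E x(1) lb(2)] Mpos[OF B(2) E2 x(1) lb(2)] beta_pos by simp
  then show ?thesis
    unfolding fM[OF F0] using flux_pos[OF B(2) x(1) lb(2)] by (auto intro: power2_le_imp_le)
qed

text \<open>W2 = r2 sqrt E2 stays above a positive constant while E2 tends to 0, so r2 would be
  unbounded near s = 0. The same lower bound for W2 keeps r2 bounded.\<close>

lemma core_left_contradiction:
  assumes B: "branch 0 c r1 h1" "branch 0 c r2 h2" and c: "\<beta> < c"
    and E: "\<And>s. 0 < s \<Longrightarrow> s \<le> \<beta> \<Longrightarrow> 0 < energy h1 s"
    and h: "h1 \<beta> < h2 \<beta>" and rh: "r1 \<beta> * h1 \<beta> \<le> r2 \<beta> * h2 \<beta>"
    and lim: "((\<lambda>s. energy h2 s) \<longlongrightarrow> 0) (at_right 0)"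
  shows False
proof -
  have core: "h1 s < h2 s" "W r1 h1 s \<le> W r2 h2 s" if "0 < s" "s \<le> \<beta>" for s
    using core_less[OF B that(1) c _ E h rh order_refl that(2)] that beta_pos by auto
  \<comment> \<open>Positive: W2 - W1 is nonnegative at \<beta> and strictly larger at
    \<open>b\<close>.\<close>
  define w where "w = W r2 h2 b - W r1 h1 b"
  have "W r2 h2 \<beta> - W r1 h1 \<beta> < w" unfolding w_def
    by (rule W_diff_antimono(2)[OF B b_pos c _ order_refl])
      (use core E b_pos b_less in auto)
  then have w: "w > 0" using core(2)[of \<beta>] beta_pos by simp
  have E2: "0 < energy h2 s" if "0 < s" "s \<le> \<beta>" for s
  proof -
    have "s < c" using that c by auto
    then show ?thesis using energy_less[of h1 s h2, OF branchD(2)[OF B(1) that(1)] core(1)[OF that]] E[OF that] by simp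
  qed
  have Ww: "w \<le> W r2 h2 s" if "0 < s" "s \<le> b" for s
  proof -
    have "w \<le> W r2 h2 s - W r1 h1 s" unfolding w_def
      by (rule W_diff_antimono(1)[OF B that(1) _ _ _ _ _ that(2)])
        (use that core E b_pos b_less c in auto)
    moreover have "0 \<le> W r1 h1 s"
      unfolding W_def using E[of s] branchD(1)[OF B(1), of s] that b_less c by simp
    ultimately show ?thesis by simp
  qed
  \<comment> \<open>As F \<le> 0, r2 h2 \<ge> W2 \<ge> w, hence (ln r2)' = -1/(r2 h2) \<ge> -1/w.
    Integrating over a length of at most \<open>b\<close> bounds r2 by \<open>R\<close>.\<close>
  define R where "R = r2 b * exp (b / w)"
  have bc: "b < c" using b_less c by simp
  have Rpos: "R > 0" unfolding R_def using branchD(1)[OF B(2) b_pos bc] by simp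
  have rR: "r2 s \<le> R" if s: "0 < s" "s \<le> b" for s
  proof -
    have "ln (r2 s) + s / w \<le> ln (r2 b) + b / w"
    proof (rule DERIV_nonneg_imp_nondecreasing[where f = "\<lambda>s. ln (r2 s) + s / w", OF s(2)])
      fix x assume x: "s \<le> x" "x \<le> b"
      then have xc: "0 < x" "x < c" "x \<le> \<beta>" using s b_less c by auto
      note b2 = branchD[OF B(2) xc(1,2)]
      have "sqrt (energy h2 x) \<le> h2 x"
        using b2(2) F_nonpos[of x] xc unfolding energy_def by (intro real_le_lsqrt) auto
      then have "w \<le> r2 x * h2 x"
        using Ww[OF xc(1) x(2)] b2(1) mult_left_mono unfolding W_def by (meson less_imp_le order_trans)
      then have "1 / (r2 x * h2 x) \<le> 1 / w" using w by (intro divide_left_mono) auto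
      then have "0 \<le> 1 / r2 x * (- 1 / h2 x) + 1 / w" by simp
      moreover have "((\<lambda>s. ln (r2 s) + s / w) has_real_derivative 1 / r2 x * (- 1 / h2 x) + 1 / w) (at x)"
        using DERIV_add[OF DERIV_chain2[OF DERIV_ln_divide[OF b2(1)] b2(3)] DERIV_cdivide[OF DERIV_ident, of w]] by simp
      ultimately show "\<exists>y. ((\<lambda>s. ln (r2 s) + s / w) has_real_derivative y) (at x) \<and> 0 \<le> y" by blast
    qed
    moreover have "0 < s / w" using s w by simp
    ultimately have "ln (r2 s) \<le> ln (r2 b) + b / w" by linarith
    also have "\<dots> = ln R" unfolding R_def using branchD(1)[OF B(2) b_pos bc] by (simp add: ln_mult)
    finally show ?thesis using Rpos branchD(1)[OF B(2) s(1)] s bc by simp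
  qed
  have "eventually (\<lambda>s. energy h2 s < (w / R)\<^sup>2) (at_right 0)"
    using lim w Rpos by (intro order_tendstoD(2)[OF lim]) auto
  then have "eventually (\<lambda>s. energy h2 s < (w / R)\<^sup>2 \<and> 0 < s \<and> s < b) (at_right 0)"
    using b_pos by (intro eventually_conj) (auto simp: eventually_at_right_less intro!: eventually_at_right_real[of 0 b, THEN eventually_mono])
  then obtain s where s: "energy h2 s < (w / R)\<^sup>2" "0 < s" "s < b"
    using eventually_happens' trivial_limit_at_right_real by blast
  have e: "0 < energy h2 s" using E2 s b_less by simp
  have "sqrt (energy h2 s) < w / R" using s(1) w Rpos by (intro real_less_lsqrt) auto
  then have "R * sqrt (energy h2 s) < w" using Rpos by (simp add: field_simps)
  moreover have "w \<le> R * sqrt (energy h2 s)"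
    using order_trans[OF Ww[of s, unfolded W_def] mult_right_mono[OF rR[of s]]] s e by simp
  ultimately show False by simp
qed

section \<open>Values below -\<beta>\<close>

text \<open>F/f is odd, so its derivative is even and the bound on \<open>K\<close> also serves
  below -\<beta>. This one-solution version carries P over the values that only the second solution
  attains.\<close>

lemma pohozaev_antimono:
  assumes B: "branch l c r h" "l \<le> x" "x \<le> y" "y \<le> c"
    and cc: "continuous_on {x..y} r" "continuous_on {x..y} h"
    and side: "\<beta> \<le> x \<or> y \<le> - \<beta>"
  shows "pohozaev r h y \<le> pohozaev r h x"
proof (rule DERIV_nonpos_imp_decreasing_open[where f = "pohozaev r h", OF B(3)])
  have f0: "f s \<noteq> 0" if "x \<le> s" "s \<le> y" for s
    using f_pos[of s] f_neg[of s] that side b_less by auto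
  then show "continuous_on {x..y} (pohozaev r h)" using cc by (intro pohozaev_cont) auto
  fix s assume s: "x < s" "s < y"
  have "\<exists>k. ((\<lambda>t. F t / f t) has_real_derivative k) (at s) \<and> 0 \<le> real n * k - (real n - 2) / 2"
    using frac_deriv[of s] frac_deriv_neg[of s] G_nonneg[of s] G_nonneg[of "- s"] s side by force
  then obtain k where k: "((\<lambda>t. F t / f t) has_real_derivative k) (at s)" "0 \<le> real n * k - (real n - 2) / 2" by blast
  have ls: "l < s" "s < c" using s B by auto
  have "- flux r h s * (real n * k - (real n - 2) / 2) \<le> 0"
    using flux_pos[OF B(1) ls] k(2) by (simp add: mult_nonneg_nonneg)
  then show "\<exists>d. (pohozaev r h has_real_derivative d) (at s) \<and> d \<le> 0"
    using pohozaev_deriv[OF B(1) ls k(1) f0] s by auto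
qed

text \<open>The lower bounds \<open>-U1\<close>, \<open>-U2\<close> enter
  through \<open>m = min U1 U2\<close>, hence the assumption that one of the speeds vanishes at \<open>-m\<close>.\<close>

lemma bottom_less:
  assumes B: "branch (- m) c r1 h1" "branch (- m) c r2 h2" and c: "- \<beta> < c" "\<beta> < m"
    and cc: "continuous_on {-m..-\<beta>} r1" "continuous_on {-m..-\<beta>} r2"
      "continuous_on {-m..-\<beta>} h1" "continuous_on {-m..-\<beta>} h2"
    and h: "h1 (- \<beta>) < h2 (- \<beta>)" and fl: "flux r1 h1 (- \<beta>) \<le> flux r2 h2 (- \<beta>)"
    and rh: "r1 (- \<beta>) * h1 (- \<beta>) \<le> r2 (- \<beta>) * h2 (- \<beta>)"
    and z: "h1 (- m) = 0 \<or> h2 (- m) = 0" and r: "0 \<le> r1 (- m)" "0 \<le> r2 (- m)"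
  shows "h1 (- m) < h2 (- m)" "pohozaev r1 h1 (- m) \<le> pohozaev r2 h2 (- m)"
proof -
  have lb: "- m < - \<beta>" using c by simp
  \<comment> \<open>Here f < 0, so the ratio flux2/flux1 does not drop as x decreases from -\<beta>,
    where it is at least 1.\<close>
  have ratio: "flux r1 h1 x \<le> flux r2 h2 x"
    if x: "- m < x" "x \<le> - \<beta>" and lt: "\<And>y. x < y \<Longrightarrow> y \<le> - \<beta> \<Longrightarrow> h1 y < h2 y" for x
  proof -
    have "- 1 * (flux r2 h2 x / flux r1 h1 x) \<le> - 1 * (flux r2 h2 (- \<beta>) / flux r1 h1 (- \<beta>))"
    proof (rule flux_ratio_mono[OF B x c(1)])
      fix y assume y: "x < y" "y < - \<beta>"
      show "h1 y \<le> h2 y" using lt[of y] y by simp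
      show "0 \<le> - 1 * f y" using f_neg[of y] y b_less by simp
    qed
    moreover have "1 \<le> flux r2 h2 (- \<beta>) / flux r1 h1 (- \<beta>)"
      using fl flux_pos[OF B(1) lb c(1)] by simp
    ultimately have "1 \<le> flux r2 h2 x / flux r1 h1 x" by simp
    then show ?thesis using flux_pos[OF B(1) x(1)] x c by (simp add: le_divide_eq_1)
  qed
  have F0: "F (- \<beta>) = 0" using F_beta F_even by simp
  have P\<beta>: "pohozaev r1 h1 (- \<beta>) \<le> pohozaev r2 h2 (- \<beta>)"
  proof -
    \<comment> \<open>F vanishes at -\<beta>, so P is half the product of the two quantities whose
      order is assumed.\<close>
    have "flux r1 h1 (- \<beta>) * (r1 (- \<beta>) * h1 (- \<beta>)) \<le> flux r2 h2 (- \<beta>) * (r2 (- \<beta>) * h2 (- \<beta>))"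
      by (rule mult_mono[OF fl rh])
        (use flux_pos[OF B(2) lb c(1)] branchD(1,2)[OF B(1) lb c(1)] in auto)
    then show ?thesis unfolding pohozaev_def flux_def F0 by (simp add: power2_eq_square mult_ac)
  qed
  have P: "pohozaev r1 h1 x \<le> pohozaev r2 h2 x"
    if x: "- m \<le> x" "x \<le> - \<beta>" and lt: "\<And>y. x < y \<Longrightarrow> y \<le> - \<beta> \<Longrightarrow> h1 y < h2 y" for x
  proof -
    have "pohozaev r2 h2 (- \<beta>) - pohozaev r1 h1 (- \<beta>) \<le> pohozaev r2 h2 x - pohozaev r1 h1 x"
    proof (rule DERIV_nonpos_imp_decreasing_open[where f = "\<lambda>s. pohozaev r2 h2 s - pohozaev r1 h1 s", OF x(2)])
      have sub: "{x..- \<beta>} \<subseteq> {- m..- \<beta>}" using x by auto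
      have f0: "f s \<noteq> 0" if "s \<in> {x..- \<beta>}" for s using f_neg[of s] that b_less by auto
      show "continuous_on {x..- \<beta>} (\<lambda>s. pohozaev r2 h2 s - pohozaev r1 h1 s)"
        by (intro continuous_on_diff pohozaev_cont f0 cc[THEN continuous_on_subset, OF sub])
      fix y assume y: "x < y" "y < - \<beta>"
      then have my: "- m < y" "y < c" using x c by auto
      have fy: "f y \<noteq> 0" using f0 y by simp
      define G where "G = real n * K (- y) - (real n - 2) / 2"
      have G: "0 \<le> G" unfolding G_def using G_nonneg[of "- y"] y by simp
      have "flux r1 h1 y \<le> flux r2 h2 y" using ratio[of y] my y lt by simp
      from mult_right_mono[OF this G]
      have "- flux r2 h2 y * G - - flux r1 h1 y * G \<le> 0" by simp
      moreover have "((\<lambda>s. pohozaev r2 h2 s - pohozaev r1 h1 s) has_real_derivative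
          - flux r2 h2 y * G - - flux r1 h1 y * G) (at y)"
        unfolding G_def
        by (intro DERIV_diff pohozaev_deriv[OF B(1) my] pohozaev_deriv[OF B(2) my] frac_deriv_neg fy y)
      ultimately show "\<exists>d. ((\<lambda>s. pohozaev r2 h2 s - pohozaev r1 h1 s) has_real_derivative d) (at y) \<and> d \<le> 0"
        by blast
    qed
    then show ?thesis using P\<beta> by simp
  qed
  have less: "h1 x < h2 x" if x: "- m \<le> x" "x \<le> - \<beta>" for x
  proof (rule h_less_propagates[OF branch_subset[OF B(1)] branch_subset[OF B(2)] cc h _ x])
    fix s assume s: "- m \<le> s" "s < - \<beta>" and eq: "h1 s = h2 s" and lt: "\<And>y. s < y \<Longrightarrow> y \<le> - \<beta> \<Longrightarrow> h1 y < h2 y"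
    show "r1 s \<le> r2 s"
    \<comment> \<open>In the interior, equal positive speeds turn the order of the fluxes into that
      of the radii. At \<open>- m\<close> both speeds are 0 and the fluxes say nothing; there P =
      r^n F with F > 0 decides.\<close>
    proof (cases "s = - m")
      case False
      then have s': "- m < s" "s < c" using s c by auto
      have "r1 s ^ (n - 1) \<le> r2 s ^ (n - 1)"
        using ratio[OF s'(1) less_imp_le[OF s(2)] lt] branchD(2)[OF B(1) s'] unfolding flux_def eq
        by simp
      then show ?thesis
        by (rule power_mono_iff[THEN iffD1, rotated 3])
          (use branchD(1)[OF B(1) s'] branchD(1)[OF B(2) s'] n_ge_2 in auto)
    next
      case True
      then have h0: "h1 s = 0" "h2 s = 0" using z eq by auto
      have "0 < F s" using F_pos[of "- s"] F_even s by simp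
      moreover have "pohozaev r1 h1 s \<le> pohozaev r2 h2 s" using P s lt by simp
      ultimately have "r1 s ^ (n - 1) * r1 s \<le> r2 s ^ (n - 1) * r2 s"
        unfolding pohozaev_def h0 by (simp add: mult.assoc[symmetric])
      then have "r1 s ^ n \<le> r2 s ^ n"
        using n_ge_2 by (cases n) (auto simp: mult.commute)
      then show ?thesis
        by (rule power_mono_iff[THEN iffD1, rotated 3]) (use r True n_ge_2 in auto)
    qed
  qed (use c in auto)
  show "h1 (- m) < h2 (- m)" using less c by simp
  show "pohozaev r1 h1 (- m) \<le> pohozaev r2 h2 (- m)" using P[of "- m"] less c by simp
qed

text \<open>The data of a solution with one sign change: \<open>\<alpha> = u 0\<close>, \<open>-U\<close> is the minimum of \<open>u\<close>, the first
  branch describes the descent from \<open>\<alpha>\<close> to \<open>-U\<close>, and the second one describes the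
  descent of \<open>-u\<close> from \<open>U\<close> to \<open>0\<close>.\<close>

definition profile where
  "profile \<alpha> U rA hA rB hB \<longleftrightarrow> \<beta> < \<alpha> \<and> \<beta> < U \<and>
     branch (- U) \<alpha> rA hA \<and> continuous_on {- U..\<alpha>} rA \<and> continuous_on {- U..\<alpha>} hA \<and>
     hA (- U) = 0 \<and> hA \<alpha> = 0 \<and> rA \<alpha> = 0 \<and> 0 < rA (- U) \<and>
     (\<forall>s. \<bar>s\<bar> \<le> \<beta> \<longrightarrow> 0 < energy hA s) \<and>
     branch 0 U rB hB \<and> (\<forall>x>0. continuous_on {x..U} rB \<and> continuous_on {x..U} hB) \<and>
     hB U = 0 \<and> rB U = rA (- U) \<and>
     (\<forall>s. 0 < s \<longrightarrow> s \<le> \<beta> \<longrightarrow> 0 < energy hB s) \<and> (energy hB \<longlongrightarrow> 0) (at_right 0)"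

section \<open>Comparison of two profiles\<close>

text \<open>P vanishes at radius 0. So P1 = 0 at \<alpha>1, while P2, which is 0 at \<alpha>2 and
  nonincreasing in the value, is nonnegative at \<alpha>1. The second alternative of
  \<open>descend_from_top\<close> applies.\<close>

lemma top_less:
  assumes p1: "profile \<alpha>1 U1 rA1 hA1 rB1 hB1" and p2: "profile \<alpha>2 U2 rA2 hA2 rB2 hB2"
    and lt: "\<alpha>1 < \<alpha>2"
  shows "\<beta> \<le> s \<Longrightarrow> s \<le> \<alpha>1 \<Longrightarrow> hA1 s < hA2 s" and "rA1 \<beta> * hA1 \<beta> \<le> rA2 \<beta> * hA2 \<beta>"
proof -
  define m where "m = min U1 U2"
  have m: "\<beta> < m" "- U1 \<le> - m" "- U2 \<le> - m" using p1 p2 unfolding profile_def m_def by auto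
  have a: "\<beta> < \<alpha>1" "rA1 \<alpha>1 = 0" "hA1 \<alpha>1 = 0" "rA2 \<alpha>2 = 0" "hA2 \<alpha>2 = 0"
    using p1 p2 unfolding profile_def by auto
  have B1: "branch (- U1) \<alpha>1 rA1 hA1" and B2: "branch (- U2) \<alpha>2 rA2 hA2"
    using p1 p2 unfolding profile_def by auto
  have B: "branch (- m) \<alpha>1 rA1 hA1" "branch (- m) \<alpha>1 rA2 hA2"
    using branch_subset[OF B1 m(2)] branch_subset[OF B2 m(3)] lt by auto
  have C: "continuous_on S rA1" "continuous_on S hA1" if "S \<subseteq> {- U1..\<alpha>1}" for S
    using p1 that unfolding profile_def by (auto intro: continuous_on_subset)
  have D: "continuous_on S rA2" "continuous_on S hA2" if "S \<subseteq> {- U2..\<alpha>2}" for S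
    using p2 that unfolding profile_def by (auto intro: continuous_on_subset)
  have l: "- m < \<beta>" using m beta_pos by simp
  have top: "hA1 \<alpha>1 < hA2 \<alpha>1" using branchD(2)[OF B2, of \<alpha>1] a lt l m beta_pos by simp
  have P1: "pohozaev rA1 hA1 \<alpha>1 = 0" unfolding pohozaev_def a using n_ge_2 by simp
  have "pohozaev rA2 hA2 \<alpha>2 = 0" unfolding pohozaev_def a using n_ge_2 by simp
  moreover have "pohozaev rA2 hA2 \<alpha>2 \<le> pohozaev rA2 hA2 \<alpha>1"
    by (rule pohozaev_antimono[OF B2]) (use D a lt m beta_pos in auto)
  ultimately have P2: "pohozaev rA1 hA1 \<alpha>1 \<le> pohozaev rA2 hA2 \<alpha>1" using P1 by simp
  have c: "{\<beta>..\<alpha>1} \<subseteq> {- U1..\<alpha>1}" "{\<beta>..\<alpha>1} \<subseteq> {- U2..\<alpha>2}" using m l lt by auto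
  note dd = descend_from_top[OF B l a(1) C(1)[OF c(1)] D(1)[OF c(2)] C(2)[OF c(1)] D(2)[OF c(2)] top _ P2]
  show "\<beta> \<le> s \<Longrightarrow> s \<le> \<alpha>1 \<Longrightarrow> hA1 s < hA2 s" using dd(1) P1 by simp
  show "rA1 \<beta> * hA1 \<beta> \<le> rA2 \<beta> * hA2 \<beta>" using dd(2) P1 by simp
qed

lemma no_two_profiles:
  assumes p1: "profile \<alpha>1 U1 rA1 hA1 rB1 hB1" and p2: "profile \<alpha>2 U2 rA2 hA2 rB2 hB2"
    and lt: "\<alpha>1 < \<alpha>2" and fl: "flux rA1 hA1 \<beta> \<le> flux rA2 hA2 \<beta>"
  shows False
proof -
  \<comment> \<open>The first branches can be compared only down to the level that both
    reach.\<close>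
  define m where "m = min U1 U2"
  have m: "\<beta> < m" "- U1 \<le> - m" "- U2 \<le> - m" using p1 p2 unfolding profile_def m_def by auto
  have a: "\<beta> < \<alpha>1" "hA1 (- U1) = 0" "hA2 (- U2) = 0" "0 < rA1 (- U1)" "0 < rA2 (- U2)"
    "rB1 U1 = rA1 (- U1)" "rB2 U2 = rA2 (- U2)" "hB1 U1 = 0" "hB2 U2 = 0" "\<beta> < U1" "\<beta> < U2"
    using p1 p2 unfolding profile_def by auto
  have B1: "branch (- U1) \<alpha>1 rA1 hA1" and B2: "branch (- U2) \<alpha>2 rA2 hA2"
    and B1': "branch 0 U1 rB1 hB1" and B2': "branch 0 U2 rB2 hB2"
    using p1 p2 unfolding profile_def by auto
  have B: "branch (- m) \<alpha>1 rA1 hA1" "branch (- m) \<alpha>1 rA2 hA2"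
    using branch_subset[OF B1 m(2)] branch_subset[OF B2 m(3)] lt by auto
  have C: "continuous_on S rA1" "continuous_on S hA1" if "S \<subseteq> {- U1..\<alpha>1}" for S
    using p1 that unfolding profile_def by (auto intro: continuous_on_subset)
  have D: "continuous_on S rA2" "continuous_on S hA2" if "S \<subseteq> {- U2..\<alpha>2}" for S
    using p2 that unfolding profile_def by (auto intro: continuous_on_subset)
  have l: "- m < - \<beta>" "- m < \<beta>" using m beta_pos by auto
  note t = top_less[OF p1 p2 lt]
  have E: "0 < energy hA1 s" if "- \<beta> \<le> s" "s \<le> \<beta>" for s
    using p1 that unfolding profile_def by auto
  have core: "hA1 s < hA2 s" "W rA1 hA1 s \<le> W rA2 hA2 s" if "- \<beta> \<le> s" "s \<le> \<beta>" for s
    using core_less[OF B l(1) a(1) order_refl E t(1)[OF order_refl] t(2) that] a by auto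
  have fl': "flux rA1 hA1 (- \<beta>) \<le> flux rA2 hA2 (- \<beta>)"
    by (rule flux_le_across_core[OF B l(1) a(1) E core fl])
  have b\<beta>: "- \<beta> \<le> \<beta>" "- \<beta> < \<alpha>1" using beta_pos a by auto
  have rh': "rA1 (- \<beta>) * hA1 (- \<beta>) \<le> rA2 (- \<beta>) * hA2 (- \<beta>)"
    using core(2)[OF order_refl b\<beta>(1)] branchD(2)[OF B(1) l(1) b\<beta>(2)] branchD(2)[OF B(2) l(1) b\<beta>(2)]
    unfolding W_def energy_def F_even F_beta by simp
  have rpos: "0 \<le> rA1 (- m)" "0 \<le> rA2 (- m)"
  proof -
    have "0 < rA1 (- m)" if "m \<noteq> U1" using branchD(1)[OF B1, of "- m"] that m(2) l b\<beta> by simp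
    then show "0 \<le> rA1 (- m)" using a by (cases "m = U1") auto
    have "0 < rA2 (- m)" if "m \<noteq> U2" using branchD(1)[OF B2, of "- m"] that m(3) l b\<beta> lt by simp
    then show "0 \<le> rA2 (- m)" using a by (cases "m = U2") auto
  qed
  have z: "hA1 (- m) = 0 \<or> hA2 (- m) = 0" unfolding m_def using a by (auto simp: min_def)
  have c: "{- m..- \<beta>} \<subseteq> {- U1..\<alpha>1}" "{- m..- \<beta>} \<subseteq> {- U2..\<alpha>2}" using m b\<beta> lt by auto
  note bot = bottom_less[OF B b\<beta>(2) m(1) C(1)[OF c(1)] D(1)[OF c(2)] C(2)[OF c(1)] D(2)[OF c(2)]
      core(1)[OF order_refl b\<beta>(1)] fl' rh' z rpos]
  \<comment> \<open>Otherwise h2 vanishes at the common level -U2, and \<open>bottom_less\<close>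
    would make h1 negative there.\<close>
  have U: "U1 < U2"
  proof (rule ccontr)
    assume "\<not> U1 < U2"
    then have mU: "m = U2" "U2 \<le> U1" unfolding m_def by auto
    then have "hA1 (- U2) < 0" using bot(1) a by simp
    moreover have "0 \<le> hA1 (- U2)"
      using branchD(2)[OF B1, of "- U2"] a mU l b\<beta> by (cases "U1 = U2") auto
    ultimately show False by simp
  qed
  then have mU: "m = U1" unfolding m_def by simp
  have Peq: "pohozaev rA hA (- U) = pohozaev rB hB U"
    if "rB U = rA (- U)" "hB U = 0" "hA (- U) = 0" for rA hA rB hB U
    unfolding pohozaev_def that F_even by simp
  \<comment> \<open>At a minimum the speed is 0, so P is the same seen from either branch. The chain
    follows the second solution from -U1 down to its minimum and back up to the level of U1.\<close>
  have "pohozaev rB1 hB1 U1 = pohozaev rA1 hA1 (- U1)" by (rule Peq[symmetric]) (use a in auto)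
  also have "\<dots> \<le> pohozaev rA2 hA2 (- U1)" using bot(2) mU by simp
  also have "\<dots> \<le> pohozaev rA2 hA2 (- U2)"
    by (rule pohozaev_antimono[OF B2]) (use D a U b\<beta> lt in auto)
  also have "\<dots> = pohozaev rB2 hB2 U2" by (rule Peq) (use a in auto)
  also have "\<dots> \<le> pohozaev rB2 hB2 U1"
    by (rule pohozaev_antimono[OF B2']) (use p2 a U beta_pos in \<open>auto simp: profile_def\<close>)
  finally have P: "pohozaev rB1 hB1 U1 \<le> pohozaev rB2 hB2 U1" .
  have P0: "0 \<le> pohozaev rB1 hB1 U1"
    unfolding pohozaev_def using a F_pos[of U1] by simp
  have B': "branch 0 U1 rB1 hB1" "branch 0 U1 rB2 hB2"
    using B1' branch_subset[OF B2', of 0 U1] U by auto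
  have c': "continuous_on {\<beta>..U1} rB1" "continuous_on {\<beta>..U1} hB1"
     "continuous_on {\<beta>..U1} rB2" "continuous_on {\<beta>..U1} hB2"
    using p1 p2 U beta_pos unfolding profile_def by (auto intro: continuous_on_subset)
  have top: "hB1 U1 < hB2 U1" using branchD(2)[OF B2', of U1] U a beta_pos by simp
  note dd = descend_from_top[OF B' beta_pos a(10) c'(1,3,2,4) top P0 P]
  have bU: "\<beta> \<le> U1" using a by simp
  have hb: "hB1 \<beta> < hB2 \<beta>" by (rule dd(1)[OF order_refl bU])
  have rb: "rB1 \<beta> * hB1 \<beta> \<le> rB2 \<beta> * hB2 \<beta>"
  \<comment> \<open>The order of the fluxes is unknown here, but each of the two orders gives r1 h1
    \<le> r2 h2.\<close>
  proof (cases "flux rB2 hB2 \<beta> \<le> flux rB1 hB1 \<beta>")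
    case True
    then show ?thesis using dd(2) by blast
  next
    case False
    then show ?thesis unfolding flux_def
      using rh_le_if_flux_le[of "rB1 \<beta>" "rB2 \<beta>" "hB1 \<beta>" "hB2 \<beta>"] hb
        branchD(1,2)[OF B'(1) beta_pos a(10)] branchD(1,2)[OF B'(2) beta_pos a(10)] by simp
  qed
  show False
    by (rule core_left_contradiction[OF B' a(10) _ hb rb]) (use p1 p2 in \<open>auto simp: profile_def\<close>)
qed

end

subsection \<open>Comparison of fluxes under hypothesis (B)\<close>

text \<open>The derivative is controlled only in the open interval, since it vanishes at critical
  points of a solution. Hence the inverse is continuous up to the ends but differentiable only
  inside.\<close>

lemma inverse_of_decreasing:
  fixes g :: "real \<Rightarrow> real"
  assumes ab: "a < b" and c: "continuous_on {a..b} g"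
    and d: "\<And>x. a < x \<Longrightarrow> x < b \<Longrightarrow> (g has_real_derivative g' x) (at x)"
    and neg: "\<And>x. a < x \<Longrightarrow> x < b \<Longrightarrow> g' x < 0"
  obtains k where "\<And>x. a \<le> x \<Longrightarrow> x \<le> b \<Longrightarrow> k (g x) = x"
    "\<And>y. g b \<le> y \<Longrightarrow> y \<le> g a \<Longrightarrow> a \<le> k y \<and> k y \<le> b \<and> g (k y) = y"
    "continuous_on {g b..g a} k"
    "\<And>y. g b < y \<Longrightarrow> y < g a \<Longrightarrow> a < k y \<and> k y < b \<and> (k has_real_derivative 1 / g' (k y)) (at y)"
proof -
  have dec: "g y < g x" if "a \<le> x" "x < y" "y \<le> b" for x y
  proof (rule DERIV_neg_imp_decreasing_open[OF that(2)])
    show "continuous_on {x..y} g" using c that by (auto elim: continuous_on_subset)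
    fix z assume "x < z" "z < y"
    then show "\<exists>d. (g has_real_derivative d) (at z) \<and> d < 0" using d[of z] neg[of z] that by auto
  qed
  have inj: "inj_on g {a..b}"
    by (rule linorder_inj_onI') (use dec in force)
  define k where "k = the_inv_into {a..b} g"
  have k1: "k (g x) = x" if "a \<le> x" "x \<le> b" for x
    unfolding k_def using that by (simp add: the_inv_into_f_f[OF inj])
  have k2: "a \<le> k y \<and> k y \<le> b \<and> g (k y) = y" if y: "g b \<le> y" "y \<le> g a" for y
  proof -
    obtain x where "a \<le> x" "x \<le> b" "g x = y" using IVT2'[of g b y a] y ab c by auto
    then show ?thesis using k1 by auto
  qed
  have im: "g ` {a..b} = {g b..g a}"
  proof (intro equalityI subsetI)
    fix y assume "y \<in> g ` {a..b}"
    then obtain x where x: "y = g x" "a \<le> x" "x \<le> b" by auto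
    then show "y \<in> {g b..g a}" using dec[of a x] dec[of x b] by (cases "x = a"; cases "x = b") auto
  next
    fix y assume "y \<in> {g b..g a}"
    then show "y \<in> g ` {a..b}" using k2[of y] by (auto intro!: image_eqI[of _ _ "k y"])
  qed
  have kc: "continuous_on {g b..g a} k"
    unfolding k_def im[symmetric] by (rule continuous_on_inv_into[OF c _ inj]) simp
  have k3: "a < k y \<and> k y < b \<and> (k has_real_derivative 1 / g' (k y)) (at y)"
    if y: "g b < y" "y < g a" for y
  proof -
    have ky: "a \<le> k y" "k y \<le> b" "g (k y) = y" using k2[of y] y by auto
    have in': "a < k y" "k y < b" using ky y by (metis less_irrefl order_le_less)+
    have "isCont k y" using kc y by (intro continuous_on_interior[OF kc]) auto
    then have "(k has_real_derivative inverse (g' (k y))) (at y)"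
      using y k2 in' neg[OF in'] by (intro DERIV_inverse_function[where f = g, OF d _ y]) auto
    then show ?thesis using in' by (simp add: inverse_eq_divide)
  qed
  show thesis by (rule that[OF k1 k2 kc k3])
qed

text \<open>Otherwise take the last point with Y \<le> Y(a). There Y is negative, so Y cannot rise
  just to the right of it, and a later such point exists.\<close>

lemma le_of_nonpos_deriv_while_neg:
  fixes Y :: "real \<Rightarrow> real"
  assumes d: "\<And>x. a \<le> x \<Longrightarrow> x \<le> b \<Longrightarrow> (Y has_real_derivative Y' x) (at x)"
    and neg: "\<And>x. a \<le> x \<Longrightarrow> x \<le> b \<Longrightarrow> Y x < 0 \<Longrightarrow> Y' x \<le> 0"
    and ab: "a \<le> b" and a: "Y a < 0"
  shows "Y b \<le> Y a"
proof (rule ccontr)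
  assume nb: "\<not> Y b \<le> Y a"
  have cont: "continuous_on {a..b} Y"
    using d by (auto intro!: continuous_at_imp_continuous_on DERIV_isCont)
  define A where "A = {x\<in>{a..b}. Y x \<le> Y a}"
  have "closed A" unfolding A_def by (intro continuous_on_closed_Collect_le cont) auto
  moreover have "bounded A" by (rule bounded_subset[of "{a..b}"]) (auto simp: A_def)
  ultimately have cA: "compact A" by (simp add: compact_eq_bounded_closed)
  have "a \<in> A" using ab unfolding A_def by auto
  then obtain t where t: "t \<in> A" "\<And>y. y \<in> A \<Longrightarrow> y \<le> t" using compact_attains_sup[OF cA] by auto
  have t': "a \<le> t" "t < b" "Y t < 0" using t(1) nb a unfolding A_def by (auto simp: less_le)
  have "isCont Y t" using d[of t] t' by (auto intro: DERIV_isCont)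
  then have "eventually (\<lambda>x. Y x < 0) (at_right t)"
    using t'(3) by (auto simp: isCont_def intro!: order_tendstoD(2) filterlim_at_split[THEN iffD1, THEN conjunct2])
  then obtain q where q: "t < q" "\<And>x. t < x \<Longrightarrow> x < q \<Longrightarrow> Y x < 0"
    by (auto simp: eventually_at_right_field)
  define m where "m = min b ((t + q) / 2)"
  have m: "t < m" "m \<le> b" "m < q" using q t' unfolding m_def by (auto simp: min_def)
  have "Y m \<le> Y t"
  proof (rule DERIV_nonpos_imp_nonincreasing[where f = Y])
    fix x assume x: "t \<le> x" "x \<le> m"
    then have ax: "a \<le> x" "x \<le> b" using t' m by auto
    have "Y x < 0" using q(2)[of x] x m t' by (cases "x = t") auto
    then show "\<exists>y. (Y has_real_derivative y) (at x) \<and> y \<le> 0" using d[OF ax] neg[OF ax] by blast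
  qed (use m in simp)
  then have "m \<in> A" using t(1) m t' unfolding A_def by auto
  then show False using t(2)[of m] m by simp
qed

context radial_nonlinearity
begin

text \<open>The logarithmic derivative of the flux with respect to \<theta> depends on (\<rho>,
  \<eta>) alone, which makes two solutions comparable at equal \<eta>. The condition P \<ge> 0 reads
  \<rho>(1 + \<eta>^2) \<ge> n \<eta>; having n instead of n-1 leaves the margin that makes \<theta>
  strictly decreasing.\<close>

lemma theta_deriv:
  fixes r h :: "real \<Rightarrow> real" and s :: real
  defines "S \<equiv> \<lambda>s. sqrt (2 * F s)"
  defines "\<theta> \<equiv> \<lambda>s. h s / (h s + S s)"
    and "\<rho> \<equiv> r s * f s / S s" and "\<eta> \<equiv> h s / S s"
  assumes B: "branch a c r h" "a < s" "s < c" and s: "\<beta> < s" and P: "0 \<le> pohozaev r h s"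
  shows "\<exists>T<0. (\<theta> has_real_derivative T) (at s) \<and> 0 < \<rho> * (1 + \<eta>\<^sup>2) - (real n - 1) * \<eta> \<and>
    - f s / (h s)\<^sup>2 = T * (\<rho> * (1 + \<eta>)\<^sup>2 / (\<eta> * (\<rho> * (1 + \<eta>\<^sup>2) - (real n - 1) * \<eta>)))"
proof -
  note b = branchD[OF B]
  have F: "0 < F s" by (rule F_pos[OF s])
  have fs: "0 < f s" using f_pos s b_less by simp
  define t where "t = S s"
  have t: "0 < t" "t * t = 2 * F s" unfolding t_def S_def using F by auto
  have hs: "h s = \<eta> * t" unfolding \<eta>_def t_def[symmetric] using t by simp
  have eta: "0 < \<eta>" unfolding \<eta>_def t_def[symmetric] using t b by simp
  have fr: "f s = \<rho> * t / r s" unfolding \<rho>_def t_def[symmetric] using t b by simp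
  have rho: "0 < \<rho>" unfolding \<rho>_def t_def[symmetric] using t b fs by simp
  define D where "D = \<rho> * (1 + \<eta>\<^sup>2) - (real n - 1) * \<eta>"
  have "0 \<le> r s * ((h s)\<^sup>2 + 2 * F s) / 2 - real n * h s * (F s / f s)"
  proof (rule ccontr)
    assume "\<not> ?thesis"
    then have "pohozaev r h s < 0"
      unfolding pohozaev_def not_le by (rule mult_pos_neg[OF zero_less_power[OF b(1)]])
    then show False using P by simp
  qed
  then have "0 \<le> f s * (r s * ((h s)\<^sup>2 + 2 * F s) / 2 - real n * h s * (F s / f s))"
    using fs by simp
  also have "\<dots> = f s * r s * ((h s)\<^sup>2 + t * t) / 2 - real n * h s * (t * t) / 2"
    unfolding t(2) using fs by (simp add: field_simps)
  also have "\<dots> = (t * t * t / 2) * (\<rho> * (1 + \<eta>\<^sup>2) - real n * \<eta>)"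
    unfolding hs fr using b(1) by (simp add: field_simps power2_eq_square)
  finally have "t * t * t / 2 * 0 \<le> t * t * t / 2 * (\<rho> * (1 + \<eta>\<^sup>2) - real n * \<eta>)"
    by (simp only: mult_zero_right)
  moreover have "0 < t * t * t / 2" using t(1) by simp
  ultimately have "0 \<le> \<rho> * (1 + \<eta>\<^sup>2) - real n * \<eta>" by (rule mult_left_le_imp_le)
  then have D: "0 < D" unfolding D_def using eta by (simp add: algebra_simps)
  define T where "T = - D / (r s * \<eta> * t * (1 + \<eta>)\<^sup>2)"
  have T: "T < 0" unfolding T_def using D b(1) eta t(1) by (simp add: divide_neg_pos)
  have Sd: "(S has_real_derivative f s / t) (at s)"
  proof -
    have F2: "0 < 2 * F s" using F by simp
    have "(S has_real_derivative inverse t / 2 * (2 * f s)) (at s)"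
      unfolding S_def t_def by (rule DERIV_chain2[OF DERIV_real_sqrt[OF F2] DERIV_cmult[OF F_deriv, of 2]])
    moreover have "inverse t / 2 * (2 * f s) = f s / t" using t(1) by (simp add: field_simps)
    ultimately show ?thesis by simp
  qed
  have nz: "h s + S s \<noteq> 0" using b(2) t(1) unfolding t_def by linarith
  have "(\<theta> has_real_derivative (((real n - 1) / r s - f s / h s) * (h s + t) - h s * (((real n - 1) / r s - f s / h s) + f s / t)) / ((h s + t) * (h s + t))) (at s)"
    using DERIV_divide[OF b(4) DERIV_add[OF b(4) Sd] nz] unfolding \<theta>_def t_def .
  moreover have "(((real n - 1) / r s - f s / h s) * (h s + t) - h s * (((real n - 1) / r s - f s / h s) + f s / t)) / ((h s + t) * (h s + t)) = T"
  proof -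
    have alg: "A * (x + y) - x * (A + B) = A * y - x * B" for A B x y :: real
      by (simp add: algebra_simps)
    have "((real n - 1) / r s - f s / h s) * (h s + t) - h s * (((real n - 1) / r s - f s / h s) + f s / t)
       = ((real n - 1) / r s - f s / h s) * t - h s * (f s / t)" by (rule alg)
    also have "\<dots> = - D * t / (r s * \<eta>)"
      unfolding D_def hs fr using eta t(1) b(1) by (simp add: field_simps power2_eq_square)
    finally have 1: "((real n - 1) / r s - f s / h s) * (h s + t) - h s * (((real n - 1) / r s - f s / h s) + f s / t) = - D * t / (r s * \<eta>)" .
    have 2: "(h s + t) * (h s + t) = t * t * (1 + \<eta>)\<^sup>2" unfolding hs by (simp add: algebra_simps power2_eq_square)
    show ?thesis unfolding 1 2 T_def using t(1) by simp
  qed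
  moreover have "- f s / (h s)\<^sup>2 = T * (\<rho> * (1 + \<eta>)\<^sup>2 / (\<eta> * D))"
    unfolding T_def hs fr using D eta t(1) b(1) by (simp add: power2_eq_square)
  ultimately show ?thesis using T D unfolding D_def by auto
qed

text \<open>The fluxes are compared at equal values of \<open>\<theta> = h / (h + \<surd>(2F))\<close>, which decreases from
  \<open>1\<close> at \<open>\<beta>\<close> to \<open>0\<close> at the top. With \<open>X = \<theta>2\<^sup>-\<^sup>1 \<circ> \<theta>1\<close> the logarithm of
  \<open>flux2 (X s) / flux1 s\<close> is nonincreasing in \<open>s\<close> wherever it is negative, and its limit at the top is
  nonnegative.\<close>

lemma flux_le_at_beta:
  fixes S :: "real \<Rightarrow> real"
  assumes B: "branch l \<alpha>1 r1 h1" "branch l \<alpha>2 r2 h2" and l: "l < \<beta>" "\<beta> < \<alpha>1" "\<alpha>1 < \<alpha>2"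
    and c: "continuous_on {\<beta>..\<alpha>1} r1" "continuous_on {\<beta>..\<alpha>1} h1"
      "continuous_on {\<beta>..\<alpha>2} r2" "continuous_on {\<beta>..\<alpha>2} h2"
    and top: "h1 \<alpha>1 = 0" "h2 \<alpha>2 = 0" "r1 \<alpha>1 = 0" "r2 \<alpha>2 = 0"
    and lt: "\<And>s. \<beta> \<le> s \<Longrightarrow> s \<le> \<alpha>1 \<Longrightarrow> h1 s < h2 s"
    and lim: "((\<lambda>s. h1 s / r1 s) \<longlongrightarrow> f \<alpha>1 / real n) (at_left \<alpha>1)"
      "((\<lambda>s. h2 s / r2 s) \<longlongrightarrow> f \<alpha>2 / real n) (at_left \<alpha>2)"
    and S_def: "S = (\<lambda>s. sqrt (2 * F s))"
    and J: "\<And>s t. \<beta> < s \<Longrightarrow> s \<le> t \<Longrightarrow> S s ^ n / f s ^ (n - 1) \<le> S t ^ n / f t ^ (n - 1)"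
  shows "flux r1 h1 \<beta> \<le> flux r2 h2 \<beta>"
proof -
  have \<beta>2: "\<beta> < \<alpha>2" using l by simp
  have Spos: "0 < S s" if "\<beta> < s" for s unfolding S_def using F_pos[OF that] by simp
  have S\<beta>: "S \<beta> = 0" unfolding S_def F_beta by simp
  have fpos: "0 < f s" if "\<beta> \<le> s" for s using f_pos[of s] that b_less by simp
  have Sc: "continuous_on A S" for A unfolding S_def by (intro continuous_intros F_cont)
  \<comment> \<open>\<eta> = h/S has the same level sets but blows up at \<beta>, where S = 0;
    \<theta> = \<eta>/(1 + \<eta>) is continuous up to both ends.\<close>
  define \<theta> where "\<theta> = (\<lambda>h s. h s / (h s + S s))"
  define \<rho> where "\<rho> = (\<lambda>r s. r s * f s / S s)"
  define \<eta> where "\<eta> = (\<lambda>h s. h s / S s)"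
  define \<Lambda> where "\<Lambda> = (\<lambda>\<rho> \<eta>. \<rho> * (1 + \<eta>\<^sup>2) - (real n - 1) * \<eta>)"
  have branch_facts: "\<exists>T. \<forall>s. \<beta> < s \<longrightarrow> s < \<alpha> \<longrightarrow> T s < 0 \<and> (\<theta> h has_real_derivative T s) (at s) \<and>
       0 < \<Lambda> (\<rho> r s) (\<eta> h s) \<and>
       - f s / (h s)\<^sup>2 = T s * (\<rho> r s * (1 + \<eta> h s)\<^sup>2 / (\<eta> h s * \<Lambda> (\<rho> r s) (\<eta> h s)))"
    if br: "branch l \<alpha> r h" and \<alpha>: "\<beta> < \<alpha>" and cc: "continuous_on {\<beta>..\<alpha>} r" "continuous_on {\<beta>..\<alpha>} h"
      and r0: "r \<alpha> = 0" for \<alpha> r h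
  proof -
    have "\<exists>T<0. (\<theta> h has_real_derivative T) (at s) \<and> 0 < \<Lambda> (\<rho> r s) (\<eta> h s) \<and>
       - f s / (h s)\<^sup>2 = T * (\<rho> r s * (1 + \<eta> h s)\<^sup>2 / (\<eta> h s * \<Lambda> (\<rho> r s) (\<eta> h s)))"
      if s: "\<beta> < s" "s < \<alpha>" for s
    proof -
      have sub: "{s..\<alpha>} \<subseteq> {\<beta>..\<alpha>}" using s by auto
      have "pohozaev r h \<alpha> \<le> pohozaev r h s"
        by (rule pohozaev_antimono[OF br _ _ order_refl])
          (use s l cc[THEN continuous_on_subset, OF sub] in auto)
      moreover have "pohozaev r h \<alpha> = 0" unfolding pohozaev_def r0 using n_ge_2 by simp
      ultimately have P: "0 \<le> pohozaev r h s" by simp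
      have ls: "l < s" using s l by simp
      show ?thesis unfolding \<theta>_def \<rho>_def \<eta>_def \<Lambda>_def S_def
        by (rule theta_deriv[OF br ls s(2) s(1) P])
    qed
    then show ?thesis by meson
  qed
  obtain T1 where T1: "\<And>s. \<beta> < s \<Longrightarrow> s < \<alpha>1 \<Longrightarrow> T1 s < 0 \<and> (\<theta> h1 has_real_derivative T1 s) (at s) \<and>
       0 < \<Lambda> (\<rho> r1 s) (\<eta> h1 s) \<and>
       - f s / (h1 s)\<^sup>2 = T1 s * (\<rho> r1 s * (1 + \<eta> h1 s)\<^sup>2 / (\<eta> h1 s * \<Lambda> (\<rho> r1 s) (\<eta> h1 s)))"
    using branch_facts[OF B(1) l(2) c(1,2) top(3)] by blast
  obtain T2 where T2: "\<And>s. \<beta> < s \<Longrightarrow> s < \<alpha>2 \<Longrightarrow> T2 s < 0 \<and> (\<theta> h2 has_real_derivative T2 s) (at s) \<and>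
       0 < \<Lambda> (\<rho> r2 s) (\<eta> h2 s) \<and>
       - f s / (h2 s)\<^sup>2 = T2 s * (\<rho> r2 s * (1 + \<eta> h2 s)\<^sup>2 / (\<eta> h2 s * \<Lambda> (\<rho> r2 s) (\<eta> h2 s)))"
    using branch_facts[OF B(2) \<beta>2 c(3,4) top(4)] by blast
  have hpos1: "0 < h1 s" "0 < r1 s" if "\<beta> \<le> s" "s < \<alpha>1" for s
    using branchD(1,2)[OF B(1), of s] that l by auto
  have hpos2: "0 < h2 s" "0 < r2 s" if "\<beta> \<le> s" "s < \<alpha>2" for s
    using branchD(1,2)[OF B(2), of s] that l by auto
  have hS1: "0 < h1 s + S s" if "\<beta> \<le> s" "s \<le> \<alpha>1" for s
    using hpos1[of s] Spos[of s] that S\<beta> top l by (cases "s = \<beta>"; cases "s = \<alpha>1") (auto intro: add_pos_pos)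
  have hS2: "0 < h2 s + S s" if "\<beta> \<le> s" "s \<le> \<alpha>2" for s
    using hpos2[of s] Spos[of s] that S\<beta> top \<beta>2 by (cases "s = \<beta>"; cases "s = \<alpha>2") (auto intro: add_pos_pos)
  have \<theta>c1: "continuous_on {\<beta>..\<alpha>1} (\<theta> h1)" unfolding \<theta>_def
    using hS1 by (intro continuous_intros c Sc) (auto simp: less_imp_neq[symmetric])
  have \<theta>c2: "continuous_on {\<beta>..\<alpha>2} (\<theta> h2)" unfolding \<theta>_def
    using hS2 by (intro continuous_intros c Sc) (auto simp: less_imp_neq[symmetric])
  have \<theta>ends: "\<theta> h1 \<alpha>1 = 0" "\<theta> h2 \<alpha>2 = 0" "\<theta> h1 \<beta> = 1" "\<theta> h2 \<beta> = 1"
    unfolding \<theta>_def top S\<beta> using hpos1[of \<beta>] hpos2[of \<beta>] l \<beta>2 by auto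
  obtain k where k: "\<And>x. \<beta> \<le> x \<Longrightarrow> x \<le> \<alpha>2 \<Longrightarrow> k (\<theta> h2 x) = x"
    "\<And>y. 0 \<le> y \<Longrightarrow> y \<le> 1 \<Longrightarrow> \<beta> \<le> k y \<and> k y \<le> \<alpha>2 \<and> \<theta> h2 (k y) = y"
    "continuous_on {0..1} k"
    "\<And>y. 0 < y \<Longrightarrow> y < 1 \<Longrightarrow> \<beta> < k y \<and> k y < \<alpha>2 \<and> (k has_real_derivative 1 / T2 (k y)) (at y)"
    by (rule inverse_of_decreasing[OF \<beta>2 \<theta>c2, of T2, unfolded \<theta>ends]) (use T2 in auto)
  define X where "X = (\<lambda>s. k (\<theta> h1 s))"
  have \<theta>in: "0 < \<theta> h1 s \<and> \<theta> h1 s < 1" if "\<beta> < s" "s < \<alpha>1" for s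
    unfolding \<theta>_def using hpos1[of s] Spos[of s] that by (simp add: add_pos_pos)
  have \<theta>in': "0 \<le> \<theta> h1 s \<and> \<theta> h1 s \<le> 1" if "\<beta> \<le> s" "s \<le> \<alpha>1" for s
    using \<theta>in[of s] \<theta>ends that by (cases "s = \<beta>"; cases "s = \<alpha>1") auto
  have Xc: "continuous_on {\<beta>..\<alpha>1} X" unfolding X_def
    by (rule continuous_on_compose2[OF k(3) \<theta>c1]) (use \<theta>in' in auto)
  have Xends: "X \<beta> = \<beta>" "X \<alpha>1 = \<alpha>2" unfolding X_def \<theta>ends using k(1)[of \<beta>] k(1)[of \<alpha>2] \<theta>ends \<beta>2 by auto
  have X: "\<beta> < X s" "X s < \<alpha>2" "\<theta> h2 (X s) = \<theta> h1 s"
    "(X has_real_derivative T1 s / T2 (X s)) (at s)" if s: "\<beta> < s" "s < \<alpha>1" for s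
  proof -
    show "\<beta> < X s" "X s < \<alpha>2" "\<theta> h2 (X s) = \<theta> h1 s"
      unfolding X_def using \<theta>in[OF s] k(2)[of "\<theta> h1 s"] k(4)[of "\<theta> h1 s"] by auto
    show "(X has_real_derivative T1 s / T2 (X s)) (at s)"
      unfolding X_def using DERIV_chain2[of k _ "\<theta> h1", OF _ T1[OF s, THEN conjunct2, THEN conjunct1]] k(4)[of "\<theta> h1 s"] \<theta>in[OF s] by fastforce
  qed
  have \<eta>eq: "\<eta> h2 (X s) = \<eta> h1 s" if s: "\<beta> < s" "s < \<alpha>1" for s
  proof -
    have p: "0 < h1 s" "0 < S s" "0 < h2 (X s)" "0 < S (X s)"
      using hpos1[of s] hpos2[of "X s"] Spos[of s] Spos[of "X s"] X[OF s] s by auto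
    have "h2 (X s) * (h1 s + S s) = h1 s * (h2 (X s) + S (X s))"
      using X(3)[OF s] p unfolding \<theta>_def by (simp add: frac_eq_eq add_pos_pos less_imp_neq[symmetric])
    then show ?thesis unfolding \<eta>_def using p by (simp add: frac_eq_eq algebra_simps)
  qed
  \<comment> \<open>h1 < h2 gives \<theta>1(s) < \<theta>2(s), and \<theta>2 decreases, so it takes
    the value \<theta>1(s) only further up.\<close>
  have Xge: "s \<le> X s" if s: "\<beta> < s" "s < \<alpha>1" for s
  proof (rule ccontr)
    assume "\<not> s \<le> X s"
    then have Xs: "X s < s" by simp
    have "\<theta> h2 s < \<theta> h2 (X s)"
    proof (rule DERIV_neg_imp_decreasing[OF Xs])
      fix x assume "X s \<le> x" "x \<le> s"
      then show "\<exists>y. (\<theta> h2 has_real_derivative y) (at x) \<and> y < 0"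
        using T2[of x] X(1)[OF s] s l by auto
    qed
    moreover have "\<theta> h1 s < \<theta> h2 s" unfolding \<theta>_def
      using lt[of s] Spos[of s] hpos1[of s] s by (simp add: frac_less_eq divide_less_eq less_divide_eq add_pos_pos field_simps)
    ultimately show False using X(3)[OF s] by simp
  qed
  define Y where "Y = (\<lambda>s. ln (flux r2 h2 (X s)) - ln (flux r1 h1 s))"
  define Y' where "Y' = (\<lambda>s. - f (X s) / (h2 (X s))\<^sup>2 * (T1 s / T2 (X s)) - (- f s / (h1 s)\<^sup>2))"
  have fp: "0 < flux r1 h1 s" "0 < flux r2 h2 (X s)" if s: "\<beta> < s" "s < \<alpha>1" for s
    using flux_pos[OF B(1), of s] flux_pos[OF B(2), of "X s"] X[OF s] s l by auto
  have Yd: "(Y has_real_derivative Y' s) (at s)" if s: "\<beta> < s" "s < \<alpha>1" for s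
  proof -
    have ls: "l < s" "l < X s" using s l X[OF s] by auto
    have 1: "((\<lambda>s. ln (flux r1 h1 s)) has_real_derivative inverse (flux r1 h1 s) * (- flux r1 h1 s * f s / (h1 s)\<^sup>2)) (at s)"
      by (rule DERIV_chain2[OF DERIV_ln[OF fp(1)[OF s]] flux_deriv[OF B(1) ls(1) s(2)]])
    have 2: "((\<lambda>s. ln (flux r2 h2 s)) has_real_derivative inverse (flux r2 h2 (X s)) * (- flux r2 h2 (X s) * f (X s) / (h2 (X s))\<^sup>2)) (at (X s))"
      by (rule DERIV_chain2[OF DERIV_ln[OF fp(2)[OF s]] flux_deriv[OF B(2) ls(2) X(2)[OF s]]])
    have i: "inverse q * (- q * x / y) = - x / y" if "0 < q" for q x y :: real
      using that by (simp add: field_simps)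
    show ?thesis unfolding Y_def Y'_def
      by (rule DERIV_cong[OF DERIV_diff[OF DERIV_chain2[OF 2 X(4)[OF s]] 1]])
        (simp only: i[OF fp(1)[OF s]] i[OF fp(2)[OF s]])
  qed
  have Yn: "Y' s \<le> 0" if s: "\<beta> < s" "s < \<alpha>1" and neg: "Y s < 0" for s
  proof -
    define e where "e = \<eta> h1 s"
    define p1 where "p1 = \<rho> r1 s"
    define p2 where "p2 = \<rho> r2 (X s)"
    have pos: "0 < h1 s" "0 < S s" "0 < h2 (X s)" "0 < S (X s)" "0 < r1 s" "0 < r2 (X s)" "0 < f s" "0 < f (X s)"
      using hpos1[of s] hpos2[of "X s"] Spos[of s] Spos[of "X s"] X[OF s] s fpos by auto
    have ep: "0 < e" "0 < p1" "0 < p2" unfolding e_def \<eta>_def p1_def p2_def \<rho>_def using pos by auto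
    have L: "0 < \<Lambda> p1 e" "0 < \<Lambda> p2 e"
      using T1[OF s] T2[OF X(1,2)[OF s]] \<eta>eq[OF s] unfolding e_def p1_def p2_def by auto
    \<comment> \<open>The flux is \<rho>^(n-1) \<eta> S^n / f^(n-1). At equal \<eta>, a smaller
      second flux together with \<open>J\<close> and s \<le> X s forces \<rho>2 < \<rho>1.\<close>
    have pow: "\<rho> r s ^ (n - 1) * (S s ^ n / f s ^ (n - 1)) * \<eta> h s = flux r h s"
      if "0 < S s" "0 < f s" for r h s
    proof -
      have "S s ^ n = S s ^ (n - 1) * S s" using n_ge_2 by (cases n) auto
      then show ?thesis unfolding \<rho>_def \<eta>_def flux_def using that by (simp add: power_mult_distrib power_divide)
    qed
    have "flux r2 h2 (X s) < flux r1 h1 s" using neg fp[OF s] unfolding Y_def by simp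
    then have "p2 ^ (n - 1) * (S (X s) ^ n / f (X s) ^ (n - 1)) * e < p1 ^ (n - 1) * (S s ^ n / f s ^ (n - 1)) * e"
      unfolding e_def p1_def p2_def using pow[of s r1 h1] pow[of "X s" r2 h2] pos \<eta>eq[OF s] by simp
    then have "p2 ^ (n - 1) * (S (X s) ^ n / f (X s) ^ (n - 1)) < p1 ^ (n - 1) * (S s ^ n / f s ^ (n - 1))"
      by (simp only: mult_less_cancel_right_pos[OF ep(1)])
    moreover have "p2 ^ (n - 1) * (S s ^ n / f s ^ (n - 1)) \<le> p2 ^ (n - 1) * (S (X s) ^ n / f (X s) ^ (n - 1))"
      using J[OF s(1) Xge[OF s]] ep by (intro mult_left_mono) auto
    ultimately have "p2 ^ (n - 1) * (S s ^ n / f s ^ (n - 1)) < p1 ^ (n - 1) * (S s ^ n / f s ^ (n - 1))" by linarith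
    moreover have "0 < S s ^ n / f s ^ (n - 1)" using pos by simp
    ultimately have "p2 ^ (n - 1) < p1 ^ (n - 1)" by (simp only: mult_less_cancel_right_pos)
    then have p: "p2 \<le> p1" using ep power_less_imp_less_base[of p2 "n - 1" p1] by auto
    \<comment> \<open>\<rho>/\<Lambda> is nonincreasing in \<rho> because \<Lambda> is a multiple of
      \<rho> minus a positive constant.\<close>
    have "p1 / \<Lambda> p1 e \<le> p2 / \<Lambda> p2 e"
    proof -
      have "(real n - 1) * e * p2 \<le> (real n - 1) * e * p1" using p ep n_ge_2 by (intro mult_left_mono) auto
      then have "p1 * \<Lambda> p2 e \<le> p2 * \<Lambda> p1 e" unfolding \<Lambda>_def by (simp add: algebra_simps)
      then show ?thesis using L by (simp add: frac_le_eq divide_le_eq le_divide_eq field_simps)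
    qed
    then have "((1 + e)\<^sup>2 / e) * (p1 / \<Lambda> p1 e) \<le> ((1 + e)\<^sup>2 / e) * (p2 / \<Lambda> p2 e)"
      using ep by (intro mult_left_mono) auto
    then have cmp: "p1 * (1 + e)\<^sup>2 / (e * \<Lambda> p1 e) \<le> p2 * (1 + e)\<^sup>2 / (e * \<Lambda> p2 e)"
      by (simp add: mult_ac)
    have t: "T1 s < 0" "T2 (X s) < 0" using T1[OF s] T2[OF X(1,2)[OF s]] by auto
    have 1: "- f s / (h1 s)\<^sup>2 = T1 s * (p1 * (1 + e)\<^sup>2 / (e * \<Lambda> p1 e))"
      using T1[OF s] unfolding e_def p1_def by blast
    have 2: "- f (X s) / (h2 (X s))\<^sup>2 = T2 (X s) * (p2 * (1 + e)\<^sup>2 / (e * \<Lambda> p2 e))"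
      using T2[OF X(1,2)[OF s]] \<eta>eq[OF s] unfolding e_def p2_def by simp
    have "Y' s = T1 s * (p2 * (1 + e)\<^sup>2 / (e * \<Lambda> p2 e)) - T1 s * (p1 * (1 + e)\<^sup>2 / (e * \<Lambda> p1 e))"
      unfolding Y'_def 1 2 using t(2) by simp
    also have "\<dots> \<le> 0" using mult_left_mono_neg[OF cmp less_imp_le[OF t(1)]] by simp
    finally show ?thesis .
  qed
  have "0 \<le> Y s0" if s0: "\<beta> < s0" "s0 < \<alpha>1" for s0
  proof (rule ccontr)
    assume "\<not> 0 \<le> Y s0"
    then have neg: "Y s0 < 0" by simp
    define G where "G = (\<lambda>s. S s ^ n / (h1 s / r1 s) ^ (n - 1))"
    define G2 where "G2 = (\<lambda>s. S s ^ n / (h2 s / r2 s) ^ (n - 1))"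
    \<comment> \<open>Both fluxes tend to 0 at the top. Dividing by \<eta>^n, equal for both, leaves
      a factor with a finite positive limit, as h/r tends to f(\<alpha>)/n.\<close>
    have flG: "flux r h s = \<eta> h s ^ n * (S s ^ n / (h s / r s) ^ (n - 1))"
      if "0 < S s" "0 < h s" "0 < r s" for r h s
    proof -
      have "h s ^ n = h s ^ (n - 1) * h s" using n_ge_2 by (cases n) auto
      then show ?thesis unfolding flux_def \<eta>_def using that by (simp add: power_divide)
    qed
    have ratio: "G2 (X s) / G s \<le> exp (Y s0)" if s: "s0 < s" "s < \<alpha>1" for s
    proof -
      have \<beta>s: "\<beta> < s" using s s0 by simp
      note Xs = X[OF \<beta>s s(2)]
      have pos: "0 < h1 s" "0 < S s" "0 < h2 (X s)" "0 < S (X s)" "0 < r1 s" "0 < r2 (X s)"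
        using hpos1[of s] hpos2[of "X s"] Spos[of s] Spos[of "X s"] Xs s \<beta>s by auto
      have "flux r2 h2 (X s) / flux r1 h1 s = G2 (X s) / G s"
        using flG[of s h1 r1] flG[of "X s" h2 r2] \<eta>eq[OF \<beta>s s(2)] pos unfolding G_def G2_def \<eta>_def by simp
      then have "G2 (X s) / G s = exp (Y s)"
        unfolding Y_def using fp[OF \<beta>s s(2)] by (simp add: exp_diff)
      moreover have "Y s \<le> Y s0"
        by (rule le_of_nonpos_deriv_while_neg[where Y' = Y']) (use neg Yd Yn s s0 in auto)
      ultimately show ?thesis by simp
    qed
    have "(X \<longlongrightarrow> X \<alpha>1) (at \<alpha>1 within {\<beta>..\<alpha>1})" using Xc l by (auto simp: continuous_on)
    then have Xl: "(X \<longlongrightarrow> \<alpha>2) (at_left \<alpha>1)"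
      unfolding Xends using l by (simp add: at_within_Icc_at_left)
    have ev: "eventually (\<lambda>s. s0 < s \<and> s < \<alpha>1) (at_left \<alpha>1)"
      using eventually_at_left_real[OF s0(2)] by (auto elim: eventually_mono)
    have "eventually (\<lambda>s. X s \<in> {..<\<alpha>2} \<and> X s \<noteq> \<alpha>2) (at_left \<alpha>1)"
      using ev
    proof (rule eventually_mono)
      fix s assume "s0 < s \<and> s < \<alpha>1"
      then have "X s < \<alpha>2" using X(2)[of s] s0 by simp
      then show "X s \<in> {..<\<alpha>2} \<and> X s \<noteq> \<alpha>2" by simp
    qed
    then have "filterlim X (at_left \<alpha>2) (at_left \<alpha>1)"
      unfolding filterlim_at using Xl by simp
    from filterlim_compose[OF lim(2) this]
    have "((\<lambda>s. h2 (X s) / r2 (X s)) \<longlongrightarrow> f \<alpha>2 / real n) (at_left \<alpha>1)"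
      .
    note l2h = this
    have l2S: "((\<lambda>s. S (X s)) \<longlongrightarrow> S \<alpha>2) (at_left \<alpha>1)"
      by (rule isCont_tendsto_compose[OF _ Xl]) (use Sc[of UNIV] in \<open>simp add: continuous_on_eq_continuous_at\<close>)
    have nz: "(f \<alpha>1 / real n) ^ (n - 1) \<noteq> 0" "(f \<alpha>2 / real n) ^ (n - 1) \<noteq> 0"
      using fpos[of \<alpha>1] fpos[of \<alpha>2] l n_ge_2 by auto
    have l2: "((\<lambda>s. G2 (X s)) \<longlongrightarrow> S \<alpha>2 ^ n / (f \<alpha>2 / real n) ^ (n - 1)) (at_left \<alpha>1)"
      unfolding G2_def by (rule tendsto_divide[OF tendsto_power[OF l2S] tendsto_power[OF l2h] nz(2)])
    have l1S: "(S \<longlongrightarrow> S \<alpha>1) (at_left \<alpha>1)"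
      by (rule isCont_tendsto_compose[OF _ tendsto_ident_at]) (use Sc[of UNIV] in \<open>simp add: continuous_on_eq_continuous_at\<close>)
    have l1: "(G \<longlongrightarrow> S \<alpha>1 ^ n / (f \<alpha>1 / real n) ^ (n - 1)) (at_left \<alpha>1)"
      unfolding G_def by (rule tendsto_divide[OF tendsto_power[OF l1S] tendsto_power[OF lim(1)] nz(1)])
    have p1: "0 < S \<alpha>1 ^ n / (f \<alpha>1 / real n) ^ (n - 1)" using fpos[of \<alpha>1] Spos[of \<alpha>1] l n_ge_2 by simp
    \<comment> \<open>This limit is the quotient of S^n / f^(n-1) at \<alpha>2 and \<alpha>1, hence
      at least 1 by \<open>J\<close>, whereas exp(Y s0) < 1.\<close>
    have "(S \<alpha>2 ^ n / (f \<alpha>2 / real n) ^ (n - 1)) / (S \<alpha>1 ^ n / (f \<alpha>1 / real n) ^ (n - 1)) \<le> exp (Y s0)"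
      by (rule tendsto_upperbound[OF tendsto_divide[OF l2 l1 less_imp_neq[OF p1, symmetric]]
            eventually_mono[OF ev] trivial_limit_at_left_real])
        (use ratio in auto)
    also have "\<dots> < 1" using neg by simp
    finally have "S \<alpha>2 ^ n / (f \<alpha>2 / real n) ^ (n - 1) < S \<alpha>1 ^ n / (f \<alpha>1 / real n) ^ (n - 1)"
      using p1 by (simp only: divide_less_eq_1_pos)
    then have "real n ^ (n - 1) * (S \<alpha>2 ^ n / f \<alpha>2 ^ (n - 1)) < real n ^ (n - 1) * (S \<alpha>1 ^ n / f \<alpha>1 ^ (n - 1))"
      by (simp add: power_divide mult.commute)
    moreover have "real n ^ (n - 1) * (S \<alpha>1 ^ n / f \<alpha>1 ^ (n - 1)) \<le> real n ^ (n - 1) * (S \<alpha>2 ^ n / f \<alpha>2 ^ (n - 1))"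
      by (rule mult_left_mono[OF J]) (use l in auto)
    ultimately show False by linarith
  qed
  then have le: "flux r1 h1 s \<le> flux r2 h2 (X s)" if "\<beta> < s" "s < \<alpha>1" for s
    using fp[OF that] that unfolding Y_def by (metis diff_ge_0_iff_ge ln_le_cancel_iff)
  have fc: "continuous_on A (flux r h)" if "continuous_on A r" "continuous_on A h" for A r h
    unfolding flux_def[abs_def] using that by (intro continuous_intros)
  have "continuous_on {\<beta>..\<alpha>1} (\<lambda>s. flux r2 h2 (X s) - flux r1 h1 s)"
  proof (intro continuous_on_diff continuous_on_compose2[OF fc[OF c(3,4)] Xc] fc[OF c(1,2)])
    show "X ` {\<beta>..\<alpha>1} \<subseteq> {\<beta>..\<alpha>2}" unfolding X_def using \<theta>in' k(2) by fastforce
  qed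
  then have "((\<lambda>s. flux r2 h2 (X s) - flux r1 h1 s) \<longlongrightarrow> flux r2 h2 (X \<beta>) - flux r1 h1 \<beta>) (at \<beta> within {\<beta>..\<alpha>1})"
    using l by (auto simp: continuous_on)
  then have "((\<lambda>s. flux r2 h2 (X s) - flux r1 h1 s) \<longlongrightarrow> flux r2 h2 \<beta> - flux r1 h1 \<beta>) (at_right \<beta>)"
    unfolding Xends using l by (simp add: at_within_Icc_at_right)
  moreover have "eventually (\<lambda>s. 0 \<le> flux r2 h2 (X s) - flux r1 h1 s) (at_right \<beta>)"
    using eventually_at_right_real[OF l(2)] by (rule eventually_mono) (use le in auto)
  ultimately have "0 \<le> flux r2 h2 \<beta> - flux r1 h1 \<beta>"
    by (intro tendsto_lowerbound) auto
  then show ?thesis by simp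
qed

subsection \<open>Solutions and their branches\<close>

text \<open>The second derivative is eliminated by the equation. Of the behaviour at the singular
  point r = 0 the limit of \<open>v r / r\<close> is kept, that is u''(0) = -f(u(0))/n; it governs
  the top of the first branch.\<close>

definition solution :: "(real \<Rightarrow> real) \<Rightarrow> (real \<Rightarrow> real) \<Rightarrow> bool" where
  "solution u v \<longleftrightarrow> continuous_on {0..} u \<and> continuous_on {0..} v \<and> v 0 = 0 \<and>
     (\<forall>r>0. (u has_real_derivative v r) (at r) \<and>
            (v has_real_derivative - (real n - 1) / r * v r - f (u r)) (at r)) \<and>
     ((\<lambda>r. v r / r) \<longlongrightarrow> - f (u 0) / real n) (at_right 0) \<and> (u \<longlongrightarrow> 0) at_top"

lemma solutionI:
  assumes "radial_solution n f u"
  obtains v where "solution u v"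
proof -
  obtain v w where ud: "\<And>r. 0 \<le> r \<Longrightarrow> (u has_real_derivative v r) (at r within {0..})"
    and vd: "\<And>r. 0 \<le> r \<Longrightarrow> (v has_real_derivative w r) (at r within {0..})"
    and wc: "continuous_on {0..} w"
    and eq: "\<And>r. 0 < r \<Longrightarrow> w r + (real n - 1) / r * v r + f (u r) = 0"
    and v0: "v 0 = 0" and lim: "(u \<longlongrightarrow> 0) at_top"
    using assms unfolding radial_solution_def by auto
  have uc: "continuous_on {0..} u" using ud by (auto intro!: DERIV_continuous_on)
  have vc: "continuous_on {0..} v" using vd by (auto intro!: DERIV_continuous_on)
  have w0: "w r = - (real n - 1) / r * v r - f (u r)" if "0 < r" for r using eq[OF that] that by (simp add: field_simps)
  have int: "at r within {0..} = at r" if "0 < r" for r :: real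
    using that by (intro at_within_interior) auto
  have right: "(g \<longlongrightarrow> g 0) (at_right 0)" if "continuous_on {0..} g" for g :: "real \<Rightarrow> real"
  proof (rule tendsto_within_subset)
    show "(g \<longlongrightarrow> g 0) (at 0 within {0..})" using that by (simp add: continuous_on)
  qed auto
  have q: "((\<lambda>r. v r / r) \<longlongrightarrow> w 0) (at_right 0)"
  proof -
    have "((\<lambda>r. (v r - v 0) / (r - 0)) \<longlongrightarrow> w 0) (at 0 within {0..})"
      using vd[of 0] unfolding has_field_derivative_iff by simp
    then have "((\<lambda>r. (v r - v 0) / (r - 0)) \<longlongrightarrow> w 0) (at_right 0)"
      by (rule tendsto_within_subset) auto
    then show ?thesis using v0 by simp
  qed
  have fc: "((\<lambda>r. f (u r)) \<longlongrightarrow> f (u 0)) (at_right 0)"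
    by (rule right) (rule continuous_on_compose2[OF f_cont uc, of , simplified])
  have l1: "((\<lambda>r. w r + (real n - 1) * (v r / r) + f (u r)) \<longlongrightarrow> w 0 + (real n - 1) * w 0 + f (u 0)) (at_right 0)"
    by (intro tendsto_add tendsto_mult tendsto_const right[OF wc] q fc)
  have ev: "eventually (\<lambda>r. w r + (real n - 1) * (v r / r) + f (u r) = 0) (at_right 0)"
    using eventually_at_right_less[of "0::real"] by (rule eventually_mono) (use eq in simp)
  \<comment> \<open>The equation in the limit r to 0, where v(r)/r tends to u''(0).\<close>
  have "w 0 + (real n - 1) * w 0 + f (u 0) = 0"
    by (rule tendsto_unique[OF trivial_limit_at_right_real l1 tendsto_eventually[OF ev]])
  then have "w 0 = - f (u 0) / real n" using n_ge_2 by (simp add: field_simps)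
  then have q': "((\<lambda>r. v r / r) \<longlongrightarrow> - f (u 0) / real n) (at_right 0)" using q by simp
  have "solution u v"
    unfolding solution_def
  proof (intro conjI allI impI uc vc v0 q' lim)
    fix r :: real assume r: "0 < r"
    show "(u has_real_derivative v r) (at r)" using ud[of r] r by (simp add: int)
    show "(v has_real_derivative - (real n - 1) / r * v r - f (u r)) (at r)"
      unfolding w0[OF r, symmetric] using vd[of r] r by (simp add: int)
  qed
  then show thesis by (rule that)
qed

lemma solution_minus:
  assumes "solution u v"
  shows "solution (\<lambda>r. - u r) (\<lambda>r. - v r)"
proof -
  have d: "((\<lambda>r. - v r) has_real_derivative - (real n - 1) / r * - v r - f (- u r)) (at r)"
    if "(v has_real_derivative - (real n - 1) / r * v r - f (u r)) (at r)" for r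
    by (rule DERIV_cong[OF DERIV_minus[OF that]]) (simp add: f_odd)
  have "((\<lambda>r. - (v r / r)) \<longlongrightarrow> - (- f (u 0) / real n)) (at_right 0)"
    using assms unfolding solution_def by (intro tendsto_minus) auto
  moreover have "((\<lambda>r. - u r) \<longlongrightarrow> - 0) at_top"
    using assms unfolding solution_def by (intro tendsto_minus) auto
  ultimately show ?thesis
    using assms d unfolding solution_def by (auto intro!: continuous_intros DERIV_minus simp: f_odd)
qed

text \<open>The quantity \<open>energy\<close> read along the radius, where the friction term
  (n-1)u'/r dissipates it.\<close>

definition H :: "(real \<Rightarrow> real) \<Rightarrow> (real \<Rightarrow> real) \<Rightarrow> real \<Rightarrow> real" where
  "H u v r = (v r)\<^sup>2 + 2 * F (u r)"

lemma solutionD: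
  assumes "solution u v"
  shows "S \<subseteq> {0..} \<Longrightarrow> continuous_on S u" "S \<subseteq> {0..} \<Longrightarrow> continuous_on S v" "v 0 = 0"
    "0 < r \<Longrightarrow> (u has_real_derivative v r) (at r)"
    "0 < r \<Longrightarrow> (v has_real_derivative - (real n - 1) / r * v r - f (u r)) (at r)"
    "((\<lambda>r. v r / r) \<longlongrightarrow> - f (u 0) / real n) (at_right 0)" "(u \<longlongrightarrow> 0) at_top"
  using assms unfolding solution_def by (auto intro: continuous_on_subset)

lemma H_deriv:
  assumes "solution u v" "0 < r"
  shows "(H u v has_real_derivative - 2 * (real n - 1) / r * (v r)\<^sup>2) (at r)"
  unfolding H_def[abs_def]
  by (rule DERIV_cong[OF DERIV_add[OF DERIV_power[OF solutionD(5)[OF assms], of 2]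
        DERIV_cmult[OF DERIV_chain2[OF F_deriv solutionD(4)[OF assms]], of 2]]])
    (simp add: algebra_simps power2_eq_square)

lemma H_cont: "solution u v \<Longrightarrow> S \<subseteq> {0..} \<Longrightarrow> continuous_on S (H u v)"
  unfolding H_def[abs_def]
  by (intro continuous_intros solutionD(2) continuous_on_compose2[OF F_cont solutionD(1)]) auto

lemma H_antimono:
  assumes "solution u v" "0 \<le> x" "x \<le> y"
  shows "H u v y \<le> H u v x"
proof (rule DERIV_nonpos_imp_decreasing_open[where f = "H u v", OF assms(3)])
  show "continuous_on {x..y} (H u v)" using assms by (intro H_cont) auto
  fix r assume "x < r" "r < y"
  then have r: "0 < r" using assms by simp
  then have "- 2 * (real n - 1) / r * (v r)\<^sup>2 \<le> 0"
    using n_ge_2 by (intro mult_nonpos_nonneg divide_nonpos_pos) auto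
  then show "\<exists>d. (H u v has_real_derivative d) (at r) \<and> d \<le> 0" using H_deriv[OF assms(1) r] by blast
qed

lemma F_u_lim: "solution u v \<Longrightarrow> ((\<lambda>r. 2 * F (u r)) \<longlongrightarrow> 0) at_top"
proof -
  assume s: "solution u v"
  have "((\<lambda>r. F (u r)) \<longlongrightarrow> F 0) at_top"
    by (rule isCont_tendsto_compose[OF DERIV_isCont[OF F_deriv] solutionD(7)[OF s]])
  then show ?thesis using tendsto_mult[OF tendsto_const, of _ _ _ 2] F_0 by fastforce
qed

text \<open>H is nonincreasing and bounded below by 2F(u), which tends to 0.\<close>

lemma H_nonneg:
  assumes s: "solution u v" and r: "0 \<le> r"
  shows "0 \<le> H u v r"
proof (rule ccontr)
  assume n: "\<not> 0 \<le> H u v r"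
  then have "eventually (\<lambda>x. H u v r < 2 * F (u x)) at_top"
    by (intro order_tendstoD(1)[OF F_u_lim[OF s]]) simp
  then have "eventually (\<lambda>x. H u v r < 2 * F (u x) \<and> r \<le> x) at_top"
    using eventually_ge_at_top[of r] by (rule eventually_conj)
  then obtain x where x: "H u v r < 2 * F (u x)" "r \<le> x"
    using eventually_happens' trivial_limit_at_top_linorder by blast
  have "2 * F (u x) \<le> H u v x" unfolding H_def by simp
  then show False using H_antimono[OF s r x(2)] x(1) by simp
qed

text \<open>If the energy stayed above \<open>e > 0\<close>, the speed would stay away from \<open>0\<close>, which the mean value
  theorem on unit intervals excludes.\<close>

lemma H_small:
  assumes s: "solution u v" and e: "0 < e"
  obtains r where "p \<le> r" "H u v r < e"
proof -
  have "\<exists>r\<ge>max p 0. H u v r < e"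
  proof (rule ccontr)
    assume "\<not> ?thesis"
    then have ge: "e \<le> H u v r" if "max p 0 \<le> r" for r using that by force
    have 1: "eventually (\<lambda>x. 2 * F (u x) < e / 2) at_top"
      using e by (intro order_tendstoD(2)[OF F_u_lim[OF s]]) simp
    define c where "c = sqrt (e / 2)"
    have c: "0 < c" "c\<^sup>2 = e / 2" using e unfolding c_def by auto
    have 2: "eventually (\<lambda>x. \<bar>u x\<bar> < c / 2) at_top"
      using order_tendstoD(2)[OF tendsto_rabs[OF solutionD(7)[OF s]], of "c / 2"] c by simp
    obtain q where q: "\<And>x. q \<le> x \<Longrightarrow> 2 * F (u x) < e / 2 \<and> \<bar>u x\<bar> < c / 2"
      using eventually_conj[OF 1 2] unfolding eventually_at_top_linorder by blast
    define N where "N = max q (max p 1)"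
    have N: "q \<le> N" "p \<le> N" "1 \<le> N" unfolding N_def by auto
    have "\<exists>z. N < z \<and> z < N + 1 \<and> u (N + 1) - u N = (N + 1 - N) * v z"
      by (rule MVT2) (use N solutionD(4)[OF s] in auto)
    then obtain z where z: "N < z" "u (N + 1) - u N = v z" by auto
    have "e / 2 \<le> (v z)\<^sup>2" using ge[of z] q[of z] z N unfolding H_def by simp
    then have "c \<le> \<bar>v z\<bar>" unfolding c(2)[symmetric] by (metis abs_le_square_iff abs_of_pos c(1))
    then show False using z(2) q[of N] q[of "N + 1"] N by auto
  qed
  then show thesis using that by auto
qed

text \<open>H stays 0, so its dissipation vanishes, u is constant, and its limit is 0. This takes
  the place of uniqueness at u = u' = 0, which can fail for non-Lipschitz \<open>f\<close>.\<close>

lemma zero_if_H_zero: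
  assumes s: "solution u v" and r: "0 \<le> r" "H u v r = 0" "r \<le> x"
  shows "u x = 0"
proof -
  have H0: "H u v y = 0" if "r \<le> y" for y
    using H_antimono[OF s r(1) that] H_nonneg[OF s, of y] r that by simp
  have v0: "v y = 0" if "r < y" for y
  proof -
    have "(H u v has_real_derivative 0) (at y)"
      by (rule has_field_derivative_transform_within_open[of "\<lambda>_. 0" _ _ "{r<..}"]) (use that H0 in auto)
    moreover have "(H u v has_real_derivative - 2 * (real n - 1) / y * (v y)\<^sup>2) (at y)"
      by (rule H_deriv[OF s]) (use that r in simp)
    ultimately have "- 2 * (real n - 1) / y * (v y)\<^sup>2 = 0" by (rule DERIV_unique[symmetric])
    then show ?thesis using that r n_ge_2 by auto
  qed
  have const: "u y = u r" if "r \<le> y" for y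
  proof (cases "r = y")
    case False
    then have ry: "r < y" using that by simp
    show ?thesis
    proof (rule DERIV_isconst2[OF ry])
      show "continuous_on {r..y} u" by (rule solutionD(1)[OF s]) (use r in auto)
      fix x assume "r < x" "x < y"
      then show "(u has_real_derivative 0) (at x)" using solutionD(4)[OF s, of x] v0[of x] r by simp
    qed (use ry in auto)
  qed simp
  have "eventually (\<lambda>y. u y = u r) at_top"
    using eventually_ge_at_top[of r] by (rule eventually_mono) (rule const)
  then have "(u \<longlongrightarrow> u r) at_top" by (rule tendsto_eventually)
  then have "u r = 0" using solutionD(7)[OF s] by (metis tendsto_unique trivial_limit_at_top_linorder)
  then show ?thesis using const[OF r(3)] by simp
qed

text \<open>As long as the energy is positive, a critical point at a nonnegative value has value above
  \<open>\<beta>\<close>; there \<open>r\<^bsup>n-1\<^esup> u'\<close> strictly decreases.\<close>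

lemma descending:
  assumes s: "solution u v" and p: "0 \<le> p" "v p = 0" "b < u p"
    and pos: "\<And>r. p \<le> r \<Longrightarrow> r \<le> T \<Longrightarrow> 0 \<le> u r" and H: "\<And>r. p \<le> r \<Longrightarrow> r \<le> T \<Longrightarrow> 0 < H u v r"
    and r: "p < r" "r \<le> T"
  shows "v r < 0"
proof -
  define g where "g = (\<lambda>r. r ^ (n - 1) * v r)"
  have gd: "(g has_real_derivative - (r ^ (n - 1) * f (u r))) (at r)" if "0 < r" for r
    unfolding g_def
    by (rule DERIV_cong[OF DERIV_mult'[OF DERIV_power_div[OF DERIV_ident, of _ "n - 1"] solutionD(5)[OF s that]]])
      (use that in \<open>simp_all add: real_n_minus_1 field_simps\<close>)
  have gc: "continuous_on S g" if "S \<subseteq> {0..}" for S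
    unfolding g_def by (intro continuous_intros solutionD(2)[OF s that])
  have g0: "g p = 0" unfolding g_def p by simp
  have neg: "v t < 0" if t: "p < t" and ub: "\<And>x. p < x \<Longrightarrow> x < t \<Longrightarrow> b < u x" for t
  proof -
    have "g t < g p"
    proof (rule DERIV_neg_imp_decreasing_open[OF t])
      show "continuous_on {p..t} g" by (rule gc) (use p in auto)
      fix x assume x: "p < x" "x < t"
      then have "- (x ^ (n - 1) * f (u x)) < 0" using f_pos[OF ub[OF x]] p by simp
      then show "\<exists>d. (g has_real_derivative d) (at x) \<and> d < 0" using gd[of x] x p by auto
    qed
    then have "t ^ (n - 1) * v t < 0" unfolding g0 by (simp only: g_def)
    then show ?thesis using t p by (simp add: mult_less_0_iff)
  qed
  have "eventually (\<lambda>x. b < u x) (at p within {p..T})"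
  proof (rule order_tendstoD(1)[OF _ p(3)])
    have "continuous_on {p..T} u" by (rule solutionD(1)[OF s]) (use p in auto)
    then show "(u \<longlongrightarrow> u p) (at p within {p..T})" using r by (auto simp: continuous_on)
  qed
  then have "eventually (\<lambda>x. b < u x) (at_right p)" using r by (simp add: at_within_Icc_at_right)
  then obtain q where q: "p < q" "\<And>x. p < x \<Longrightarrow> x < q \<Longrightarrow> b < u x"
    by (auto simp: eventually_at_right_field)
  define d where "d = min q r"
  have d: "p < d" "d \<le> r" "d \<le> q" unfolding d_def using q r by auto
  have nd: "v x < 0" if "p < x" "x \<le> d" for x
    by (rule neg[OF that(1)]) (use that d q in auto)
  show ?thesis
  proof (rule ccontr)
    assume nr: "\<not> v r < 0"
    define A where "A = {x\<in>{d..r}. 0 \<le> v x}"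
    have "closed A" unfolding A_def
      by (intro continuous_on_closed_Collect_le continuous_on_const solutionD(2)[OF s]) (use p d in auto)
    moreover have "bounded A" by (rule bounded_subset[of "{d..r}"]) (auto simp: A_def)
    ultimately have cA: "compact A" by (simp add: compact_eq_bounded_closed)
    have "r \<in> A" using nr d unfolding A_def by auto
    then obtain t where t: "t \<in> A" "\<And>y. y \<in> A \<Longrightarrow> t \<le> y" using compact_attains_inf[OF cA] by auto
    have t': "d < t" "t \<le> r" "0 \<le> v t" using t(1) nd[of d] d unfolding A_def by (auto simp: less_le)
    have vneg: "v x < 0" if "p < x" "x < t" for x
      using nd[of x] t(2)[of x] that t' unfolding A_def by force
    have vt: "v t = 0"
    proof -
      have "\<exists>x\<ge>d. x \<le> t \<and> v x = 0"
        by (rule IVT') (use nd[of d] d t' p solutionD(2)[OF s] in auto)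
      then show ?thesis using vneg d by (metis less_irrefl order_le_less order_less_le_trans)
    qed
    have pt: "p < t" using d t' by simp
    have "0 < H u v t" using H[of t] pt t' r by simp
    then have "0 < F (u t)" unfolding H_def vt by simp
    then have "\<beta> < u t" using F_nonpos[of "u t"] pos[of t] pt t' r by force
    \<comment> \<open>As u falls up to \<open>t\<close>, all earlier values exceed \<open>b\<close>
      as well, so \<open>neg\<close> applies at \<open>t\<close>.\<close>
    have "u t \<le> u x" if x: "p < x" "x < t" for x
    proof (rule DERIV_nonpos_imp_nonincreasing[where f = u])
      fix y assume y: "x \<le> y" "y \<le> t"
      then have "0 < y" "v y \<le> 0" using x p vneg[of y] vt by (auto simp: le_less)
      then show "\<exists>d. (u has_real_derivative d) (at y) \<and> d \<le> 0" using solutionD(4)[OF s] by blast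
    qed (use x in simp)
    then have "v t < 0" using \<open>\<beta> < u t\<close> b_less by (intro neg[OF pt]) force
    then show False using vt by simp
  qed
qed

lemma segment_branch:
  assumes s: "solution u v" and pq: "0 \<le> p" "p < q" and neg: "\<And>r. p < r \<Longrightarrow> r < q \<Longrightarrow> v r < 0"
  obtains k where "\<And>x. p \<le> x \<Longrightarrow> x \<le> q \<Longrightarrow> k (u x) = x"
    "\<And>y. u q \<le> y \<Longrightarrow> y \<le> u p \<Longrightarrow> p \<le> k y \<and> k y \<le> q \<and> u (k y) = y"
    "continuous_on {u q..u p} k" "continuous_on {u q..u p} (\<lambda>y. - v (k y))"
    "branch (u q) (u p) k (\<lambda>y. - v (k y))"
proof -
  have d: "(u has_real_derivative v x) (at x)" if "p < x" "x < q" for x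
    using solutionD(4)[OF s] that pq by simp
  have c: "continuous_on {p..q} u" by (rule solutionD(1)[OF s]) (use pq in auto)
  obtain k where k: "\<And>x. p \<le> x \<Longrightarrow> x \<le> q \<Longrightarrow> k (u x) = x"
    "\<And>y. u q \<le> y \<Longrightarrow> y \<le> u p \<Longrightarrow> p \<le> k y \<and> k y \<le> q \<and> u (k y) = y"
    "continuous_on {u q..u p} k"
    "\<And>y. u q < y \<Longrightarrow> y < u p \<Longrightarrow> p < k y \<and> k y < q \<and> (k has_real_derivative 1 / v (k y)) (at y)"
    by (rule inverse_of_decreasing[OF pq(2) c d neg]) (assumption | rule that)+
  have kc: "continuous_on {u q..u p} (\<lambda>y. - v (k y))"
    by (intro continuous_on_minus continuous_on_compose2[OF solutionD(2)[OF s, of "{p..q}"] k(3)])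
      (use pq k(2) in auto)
  have "branch (u q) (u p) k (\<lambda>y. - v (k y))"
    unfolding branch_def
  proof (intro ballI conjI)
    fix y assume "y \<in> {u q<..<u p}"
    then have y: "u q < y" "y < u p" by auto
    note ky = k(4)[OF y]
    have r: "0 < k y" using ky pq by simp
    show "0 < k y" by (rule r)
    show nv: "0 < - v (k y)" using neg[of "k y"] ky by simp
    show "(k has_real_derivative - 1 / - v (k y)) (at y)" using ky by simp
    have uy: "u (k y) = y" using k(2)[of y] y by simp
    have "((\<lambda>y. - v (k y)) has_real_derivative - ((- (real n - 1) / k y * v (k y) - f (u (k y))) * (1 / v (k y)))) (at y)"
      by (rule DERIV_minus[OF DERIV_chain2[OF solutionD(5)[OF s r] ky[THEN conjunct2, THEN conjunct2]]])
    moreover have "- ((- (real n - 1) / k y * v (k y) - f (u (k y))) * (1 / v (k y))) = (real n - 1) / k y - f y / - v (k y)"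
      unfolding uy using nv r by (simp add: field_simps)
    ultimately show "((\<lambda>y. - v (k y)) has_real_derivative (real n - 1) / k y - f y / - v (k y)) (at y)" by simp
  qed
  then show thesis using that k kc by blast
qed

lemma H_pos:
  assumes "solution u v" "0 \<le> r" "r \<le> x" "u x \<noteq> 0"
  shows "0 < H u v r"
  using H_nonneg[OF assms(1,2)] zero_if_H_zero[OF assms(1,2) _ assms(3)] assms(4)
  by (cases "H u v r = 0") auto

section \<open>Shape of a solution with one sign change\<close>

text \<open>\<open>z\<close> is the first zero and \<open>R\<close> the first critical point after
  it. Beyond \<open>R\<close> a positive value would be a second sign change; hence a zero there is
  a local maximum, with u' = 0 and zero energy.\<close>

lemma solution_structure:
  assumes s: "solution u v" and u0: "0 < u 0" and osc: "one_sign_change_on {0<..} u"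
  obtains z R where "0 < z" "z < R" "\<And>r. 0 \<le> r \<Longrightarrow> r < z \<Longrightarrow> 0 < u r" "u z = 0"
    "\<beta> < u 0" "\<beta> < - u R" "v R = 0" "\<And>r. 0 < r \<Longrightarrow> r < R \<Longrightarrow> v r < 0"
    "\<And>r. z < r \<Longrightarrow> r \<le> R \<Longrightarrow> u r < 0" "\<And>r. R \<le> r \<Longrightarrow> u r \<le> 0"
    "\<And>r. R \<le> r \<Longrightarrow> u r = 0 \<Longrightarrow> H u v r = 0"
    "\<And>r. R < r \<Longrightarrow> u r < 0 \<Longrightarrow> 0 < v r"
proof -
  obtain y where y: "0 < y" "u y < 0"
    using osc unfolding one_sign_change_on_def by (auto simp: mult_less_0_iff)
  have "0 < H u v 0" by (rule H_pos[OF s, of _ y]) (use y in auto)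
  then have F0: "0 < F (u 0)" unfolding H_def solutionD(3)[OF s] by simp
  then have \<beta>0: "\<beta> < u 0" using F_nonpos[of "u 0"] u0 by force
  have first_zero: "\<exists>z. 0 < z \<and> z \<le> y \<and> u z = 0 \<and> (\<forall>r. 0 \<le> r \<and> r < z \<longrightarrow> 0 < u r)"
  proof -
    define A where "A = {r\<in>{0..y}. u r \<le> 0}"
    have "closed A" unfolding A_def
      by (intro continuous_on_closed_Collect_le continuous_on_const solutionD(1)[OF s]) auto
    moreover have "bounded A" by (rule bounded_subset[of "{0..y}"]) (auto simp: A_def)
    ultimately have cA: "compact A" by (simp add: compact_eq_bounded_closed)
    have "y \<in> A" using y unfolding A_def by auto
    then obtain z where z: "z \<in> A" "\<And>x. x \<in> A \<Longrightarrow> z \<le> x" using compact_attains_inf[OF cA] by auto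
    have z': "0 < z" "z \<le> y" "u z \<le> 0" using z(1) u0 unfolding A_def by (auto simp: less_le)
    have pos: "0 < u r" if "0 \<le> r" "r < z" for r using z(2)[of r] that z' unfolding A_def by force
    have "\<exists>x\<ge>0. x \<le> z \<and> u x = 0"
      by (rule IVT2') (use z' u0 solutionD(1)[OF s] in auto)
    then obtain x where x: "0 \<le> x" "x \<le> z" "u x = 0" by blast
    then have "x = z" using pos[of x] by (cases "x = z") auto
    then show ?thesis using x z' pos by auto
  qed
  then obtain z where z: "0 < z" "z \<le> y" "u z = 0" "\<And>r. 0 \<le> r \<Longrightarrow> r < z \<Longrightarrow> 0 < u r" by blast
  have vz: "v r < 0" if r: "0 < r" "r \<le> z" for r
  proof (rule descending[OF s order_refl solutionD(3)[OF s] _ _ _ r])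
    show "b < u 0" using \<beta>0 b_less by simp
    fix x assume x: "0 \<le> x" "x \<le> z"
    show "0 \<le> u x" using z(3) z(4)[of x] x by (cases "x = z") auto
    show "0 < H u v x" by (rule H_pos[OF s, of _ y]) (use x z y in auto)
  qed
  have strict: "u y < u x" if "0 \<le> x" "x < y" "\<And>r. x < r \<Longrightarrow> r < y \<Longrightarrow> v r < 0" for x y
  proof (rule DERIV_neg_imp_decreasing_open[OF that(2)])
    show "continuous_on {x..y} u" by (rule solutionD(1)[OF s]) (use that in auto)
    fix r assume "x < r" "r < y"
    then show "\<exists>d. (u has_real_derivative d) (at r) \<and> d < 0"
      using that(3)[of r] solutionD(4)[OF s, of r] that(1) by auto
  qed
  have "\<exists>r1\<ge>z. 0 \<le> v r1"
  proof (rule ccontr)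
    assume "\<not> ?thesis"
    then have neg: "v r < 0" if "z \<le> r" for r using that by force
    have u1: "u (z + 1) < 0" using strict[of z "z + 1"] z neg by simp
    have "eventually (\<lambda>r. u (z + 1) < u r) at_top"
      by (rule order_tendstoD(1)[OF solutionD(7)[OF s] u1])
    then have "eventually (\<lambda>r. u (z + 1) < u r \<and> z + 1 < r) at_top"
      using eventually_gt_at_top by (rule eventually_conj)
    then obtain r where r: "u (z + 1) < u r" "z + 1 < r"
      using eventually_happens' trivial_limit_at_top_linorder by blast
    then show False using strict[of "z + 1" r] z neg by force
  qed
  then obtain r1 where r1: "z \<le> r1" "0 \<le> v r1" by blast
  have "\<exists>R>z. v R = 0 \<and> (\<forall>r. z \<le> r \<and> r < R \<longrightarrow> v r < 0)"
  proof -
    define A where "A = {r\<in>{z..r1}. 0 \<le> v r}"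
    have "closed A" unfolding A_def
      by (intro continuous_on_closed_Collect_le continuous_on_const solutionD(2)[OF s]) (use z in auto)
    moreover have "bounded A" by (rule bounded_subset[of "{z..r1}"]) (auto simp: A_def)
    ultimately have cA: "compact A" by (simp add: compact_eq_bounded_closed)
    have "r1 \<in> A" using r1 unfolding A_def by auto
    then obtain R where R: "R \<in> A" "\<And>x. x \<in> A \<Longrightarrow> R \<le> x" using compact_attains_inf[OF cA] by auto
    have R': "z < R" "R \<le> r1" "0 \<le> v R" using R(1) vz[of z] z unfolding A_def by (auto simp: less_le)
    have neg: "v r < 0" if "z \<le> r" "r < R" for r using R(2)[of r] that R' unfolding A_def by force
    have "\<exists>x\<ge>z. x \<le> R \<and> v x = 0"
      by (rule IVT') (use R' vz[of z] z solutionD(2)[OF s] in auto)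
    then obtain x where x: "z \<le> x" "x \<le> R" "v x = 0" by blast
    then have "x = R" using neg[of x] by (cases "x = R") auto
    then show ?thesis using x R' neg by auto
  qed
  then obtain R where R: "z < R" "v R = 0" "\<And>r. z \<le> r \<Longrightarrow> r < R \<Longrightarrow> v r < 0" by blast
  have vneg: "v r < 0" if "0 < r" "r < R" for r using vz[of r] R(3)[of r] that by (cases "r \<le> z") auto
  have uneg: "u r < 0" if "z < r" "r \<le> R" for r
    using strict[of z r] z R(3) that by force
  have "0 < H u v R" by (rule H_pos[OF s, of _ R]) (use uneg[of R] R z in auto)
  then have "0 < F (u R)" unfolding H_def R by simp
  then have \<beta>R: "\<beta> < - u R" using F_nonpos[of "u R"] uneg[of R] R by force
  have nonpos: "u r \<le> 0" if r: "R \<le> r" for r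
  proof (rule ccontr)
    assume "\<not> u r \<le> 0"
    then have ur: "0 < u r" by simp
    have "R < r" using r ur uneg[of R] R by (cases "r = R") auto
    moreover have "u (z / 2) * u R < 0" "u R * u r < 0"
      using z(4)[of "z / 2"] z(1) uneg[of R] R ur by (auto simp: mult_less_0_iff)
    ultimately have "\<exists>x\<in>{0<..}. \<exists>y\<in>{0<..}. \<exists>z\<in>{0<..}. x < y \<and> y < z \<and> u x * u y < 0 \<and> u y * u z < 0"
      using z(1) R(1) by (intro bexI[of _ "z / 2"] bexI[of _ R] bexI[of _ r]) auto
    then show False using osc unfolding one_sign_change_on_def by blast
  qed
  have Hz: "H u v r = 0" if r: "R \<le> r" "u r = 0" for r
  proof -
    have rR: "R < r" using r uneg[of R] R by (cases "r = R") auto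
    have "v r = 0"
      by (rule DERIV_local_max[OF solutionD(4)[OF s, of r], of "r - R"])
        (use rR R z r nonpos in \<open>auto simp: abs_less_iff\<close>)
    then show ?thesis unfolding H_def r(2) F_0 by simp
  qed
  have vpos: "0 < v r" if r: "R < r" "u r < 0" for r
  proof -
    have "- v r < 0"
    proof (rule descending[OF solution_minus[OF s], of R r])
      show "- v R = 0" "b < - u R" using R \<beta>R b_less by auto
      fix x assume x: "R \<le> x" "x \<le> r"
      show "0 \<le> - u x" using nonpos[OF x(1)] by simp
      show "0 < H (\<lambda>r. - u r) (\<lambda>r. - v r) x"
        using H_pos[OF s _ x(2)] x R z r unfolding H_def F_even by simp
    qed (use r R z in auto)
    then show ?thesis by simp
  qed
  show thesis
    by (rule that[OF z(1) R(1) z(4) z(3) \<beta>0 \<beta>R R(2) vneg uneg nonpos Hz vpos])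
qed

lemma branch_cong:
  assumes B: "branch a c r h" and eq: "\<And>s. a < s \<Longrightarrow> s < c \<Longrightarrow> r' s = r s \<and> h' s = h s"
  shows "branch a c r' h'"
  unfolding branch_def
proof (intro ballI conjI)
  fix s assume "s \<in> {a<..<c}"
  then have s: "a < s" "s < c" by auto
  note b = branchD[OF B s] and e = eq[OF s]
  show "0 < r' s" "0 < h' s" using b e by auto
  show "(r' has_real_derivative - 1 / h' s) (at s)"
    by (rule has_field_derivative_transform_within_open[of r _ _ "{a<..<c}"]) (use b e s eq in auto)
  show "(h' has_real_derivative (real n - 1) / r' s - f s / h' s) (at s)"
    by (rule has_field_derivative_transform_within_open[of h _ _ "{a<..<c}"]) (use b e s eq in auto)
qed

text \<open>The ascent may end at a finite radius or last forever, so no single segment need cover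
  it. \<open>rB\<close> is chosen globally, is unambiguous for values in (0, U], and inherits its
  properties from the segments [R, q] with u(q) < 0.\<close>

lemma second_branch:
  assumes s: "solution u v" and R: "0 < R" "v R = 0" "\<beta> < - u R"
    and nonpos: "\<And>r. R \<le> r \<Longrightarrow> u r \<le> 0"
    and Hz: "\<And>r. R \<le> r \<Longrightarrow> u r = 0 \<Longrightarrow> H u v r = 0"
    and vpos: "\<And>r. R < r \<Longrightarrow> u r < 0 \<Longrightarrow> 0 < v r"
  obtains rB hB where "branch 0 (- u R) rB hB" "\<And>x. 0 < x \<Longrightarrow> continuous_on {x..- u R} rB"
    "\<And>x. 0 < x \<Longrightarrow> continuous_on {x..- u R} hB" "hB (- u R) = 0" "rB (- u R) = R"
    "\<And>s. 0 < s \<Longrightarrow> s \<le> - u R \<Longrightarrow> 0 < energy hB s" "(energy hB \<longlongrightarrow> 0) (at_right 0)"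
proof -
  define U where "U = - u R"
  have U: "0 < U" "\<beta> < U" using R beta_pos unfolding U_def by auto
  have neg: "u x < 0" if "R \<le> x" "x \<le> y" "u y < 0" for x y
  proof (rule ccontr)
    assume "\<not> u x < 0"
    then have "u x = 0" using nonpos[OF that(1)] by simp
    then have "u y = 0" using zero_if_H_zero[OF s _ Hz[OF that(1)] that(2)] that R by simp
    then show False using that by simp
  qed
  have incr: "u x < u y" if "R \<le> x" "x < y" "u y < 0" for x y
  proof (rule DERIV_pos_imp_increasing_open[OF that(2)])
    show "continuous_on {x..y} u" by (rule solutionD(1)[OF s]) (use that R in auto)
    fix r assume r: "x < r" "r < y"
    then have "0 < v r" using vpos[of r] neg[of r y] that by auto
    then show "\<exists>d. (u has_real_derivative d) (at r) \<and> 0 < d"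
      using solutionD(4)[OF s, of r] r that R by auto
  qed
  have inj: "x = y" if "R \<le> x" "R \<le> y" "u x = u y" "u x < 0" for x y
    using incr[of x y] incr[of y x] that by (cases x y rule: linorder_cases) auto
  define rB where "rB = (\<lambda>t. SOME r. R \<le> r \<and> - u r = t)"
  define hB where "hB = (\<lambda>t. v (rB t))"
  have rB_eq: "rB t = r" if "R \<le> r" "- u r = t" "0 < t" for r t
  proof -
    have "R \<le> rB t \<and> - u (rB t) = t" unfolding rB_def by (rule someI[of _ r]) (use that in auto)
    then show ?thesis using inj[of "rB t" r] that by auto
  qed
  have seg: "branch (- u q) U rB hB \<and> continuous_on {- u q..U} rB \<and> continuous_on {- u q..U} hB"
    if q: "R < q" "u q < 0" for q
  proof -
    have "\<exists>k. (\<forall>y. - u q \<le> y \<longrightarrow> y \<le> - u R \<longrightarrow> R \<le> k y \<and> k y \<le> q \<and> - u (k y) = y) \<and>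
      continuous_on {- u q..- u R} k \<and> continuous_on {- u q..- u R} (\<lambda>y. - (- v (k y))) \<and>
      branch (- u q) (- u R) k (\<lambda>y. - (- v (k y)))"
    proof (rule segment_branch[OF solution_minus[OF s], of R q])
      fix k
      assume "\<And>y. - u q \<le> y \<Longrightarrow> y \<le> - u R \<Longrightarrow> R \<le> k y \<and> k y \<le> q \<and> - u (k y) = y"
        "continuous_on {- u q..- u R} k" "continuous_on {- u q..- u R} (\<lambda>y. - (- v (k y)))"
        "branch (- u q) (- u R) k (\<lambda>y. - (- v (k y)))"
      then show "\<exists>k. (\<forall>y. - u q \<le> y \<longrightarrow> y \<le> - u R \<longrightarrow> R \<le> k y \<and> k y \<le> q \<and> - u (k y) = y) \<and>
        continuous_on {- u q..- u R} k \<and> continuous_on {- u q..- u R} (\<lambda>y. - (- v (k y))) \<and>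
        branch (- u q) (- u R) k (\<lambda>y. - (- v (k y)))" by blast
    next
      fix r assume "R < r" "r < q"
      then show "- v r < 0" using vpos[of r] neg[of r q] q by auto
    qed (use R q in auto)
    then obtain k where k: "\<And>y. - u q \<le> y \<Longrightarrow> y \<le> U \<Longrightarrow> R \<le> k y \<and> k y \<le> q \<and> - u (k y) = y"
      "continuous_on {- u q..U} k" "continuous_on {- u q..U} (\<lambda>y. v (k y))"
      "branch (- u q) U k (\<lambda>y. v (k y))"
      unfolding U_def by auto
    have eq: "rB y = k y" "hB y = v (k y)" if "- u q \<le> y" "y \<le> U" for y
      using rB_eq[of "k y" y] k(1)[OF that] that q unfolding hB_def by auto
    have "branch (- u q) U rB hB" by (rule branch_cong[OF k(4)]) (use eq in auto)
    moreover have "continuous_on {- u q..U} rB"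
      by (rule continuous_on_eq[OF k(2)]) (use eq in auto)
    moreover have "continuous_on {- u q..U} hB"
      by (rule continuous_on_eq[OF k(3)]) (use eq in auto)
    ultimately show ?thesis by blast
  qed
  have attained: "\<exists>q>R. - u q = t" if t: "0 < t" "t < U" for t
  proof -
    have "eventually (\<lambda>r. - t < u r) at_top"
      by (rule order_tendstoD(1)[OF solutionD(7)[OF s]]) (use t in simp)
    then have "eventually (\<lambda>r. - t < u r \<and> R < r) at_top"
      using eventually_gt_at_top by (rule eventually_conj)
    then obtain r where r: "- t < u r" "R < r"
      using eventually_happens' trivial_limit_at_top_linorder by blast
    have "\<exists>x\<ge>R. x \<le> r \<and> u x = - t"
      by (rule IVT') (use r t R U_def solutionD(1)[OF s] in auto)
    then obtain x where x: "R \<le> x" "u x = - t" by blast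
    then show ?thesis using t U_def by (intro exI[of _ x]) (auto simp: less_le)
  qed
  have cover: "\<exists>q>R. u q < 0 \<and> - u q < t" if t: "0 < t" "t \<le> U" for t
    using attained[of "t / 2"] t by force
  have BB: "branch 0 U rB hB"
    unfolding branch_def
  proof
    fix t assume "t \<in> {0<..<U}"
    then have t: "0 < t" "t < U" by auto
    obtain q where q: "R < q" "u q < 0" "- u q < t" using cover[of t] t by auto
    have "branch (- u q) U rB hB" using seg[OF q(1,2)] by blast
    then show "0 < rB t \<and> 0 < hB t \<and> (rB has_real_derivative - 1 / hB t) (at t) \<and>
        (hB has_real_derivative (real n - 1) / rB t - f t / hB t) (at t)"
      using q t unfolding branch_def by auto
  qed
  have cc: "continuous_on {x..U} rB" "continuous_on {x..U} hB" if x: "0 < x" for x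
  proof -
    have "continuous_on {x..U} rB \<and> continuous_on {x..U} hB"
    proof (cases "x \<le> U")
      case True
      obtain q where q: "R < q" "u q < 0" "- u q < x" using cover[OF x True] by auto
      show ?thesis using seg[OF q(1,2)] q(3) by (auto elim!: continuous_on_subset)
    qed auto
    then show "continuous_on {x..U} rB" "continuous_on {x..U} hB" by auto
  qed
  have rBU: "rB U = R" using rB_eq[of R U] U unfolding U_def by auto
  have hBU: "hB U = 0" unfolding hB_def rBU R by simp
  have rBt: "R \<le> rB t" "- u (rB t) = t" if t: "0 < t" "t \<le> U" for t
  proof -
    have "\<exists>q\<ge>R. - u q = t"
    proof (cases "t = U")
      case True
      then show ?thesis unfolding U_def by auto
    next
      case False
      then show ?thesis using attained[of t] t less_imp_le by fastforce
    qed
    then obtain q where q: "R \<le> q" "- u q = t" by blast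
    then show "R \<le> rB t" "- u (rB t) = t" using rB_eq[of q t] t by auto
  qed
  have EH: "energy hB t = H u v (rB t)" if t: "0 < t" "t \<le> U" for t
    using rBt[OF t] F_even[of "u (rB t)"] unfolding energy_def H_def hB_def by simp
  have Epos: "0 < energy hB t" if t: "0 < t" "t \<le> U" for t
    unfolding EH[OF t] by (rule H_pos[OF s _ order_refl]) (use rBt[OF t] R t in auto)
  have "(energy hB \<longlongrightarrow> 0) (at_right 0)"
  proof (rule order_tendstoI)
    fix e :: real assume "e < 0"
    show "eventually (\<lambda>t. e < energy hB t) (at_right 0)"
      using eventually_at_right_real[OF U(1)]
    proof (rule eventually_mono)
      fix t assume "t \<in> {0<..<U}"
      then show "e < energy hB t" using Epos[of t] \<open>e < 0\<close> by simp
    qed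
  next
    fix e :: real assume e: "0 < e"
    have HR: "0 < H u v R" using H_pos[OF s _ order_refl, of R] R U unfolding U_def by auto
    \<comment> \<open>Below H(R), so the level \<open>d\<close> is attained at some x \<ge> R;
      positive, so u(x) < 0. Values smaller than -u(x) are then taken only beyond x, where the
      energy is at most \<open>d\<close>.\<close>
    define d where "d = min e (H u v R) / 2"
    have d: "0 < d" "d < e" "d < H u v R" unfolding d_def using e HR by (auto simp: min_def)
    obtain r0 where r0: "R \<le> r0" "H u v r0 < d" using H_small[OF s d(1), of R] by blast
    have "\<exists>x\<ge>R. x \<le> r0 \<and> H u v x = d"
      by (rule IVT2') (use r0 d R H_cont[OF s] in auto)
    then obtain x where x: "R \<le> x" "H u v x = d" by blast
    have ux: "u x < 0" using Hz[OF x(1)] nonpos[OF x(1)] x(2) d(1) by force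
    show "eventually (\<lambda>t. energy hB t < e) (at_right 0)"
    proof (rule eventually_mono)
      show "eventually (\<lambda>t. t \<in> {0<..<min U (- u x)}) (at_right 0)"
        by (rule eventually_at_right_real) (use U ux in auto)
      fix t assume "t \<in> {0<..<min U (- u x)}"
      then have t: "0 < t" "t < U" "t < - u x" by auto
      have rt: "R \<le> rB t" "- u (rB t) = t" using rBt[of t] t by auto
      have "x \<le> rB t"
      proof (rule ccontr)
        assume "\<not> x \<le> rB t"
        then show False using incr[of "rB t" x] rt ux t by simp
      qed
      then have "H u v (rB t) \<le> d" using H_antimono[OF s, of x "rB t"] x R by simp
      then show "energy hB t < e" using EH[of t] t d by simp
    qed
  qed
  then show thesis using that[of rB hB] BB cc hBU rBU Epos unfolding U_def by blast
qed

text \<open>\<open>profile\<close> forgets the solution. This predicate keeps what Sturm comparison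
  and the uniqueness proof need: the zero, the minimum point, the behaviour beyond it, and
  \<open>rA\<close> as inverse of \<open>u\<close> on [0, R].\<close>

definition linked where
  "linked u v z R rA hA \<longleftrightarrow> 0 < z \<and> z < R \<and> u z = 0 \<and> (\<forall>r. 0 \<le> r \<and> r < z \<longrightarrow> 0 < u r) \<and>
     (\<forall>r. z < r \<and> r \<le> R \<longrightarrow> u r < 0) \<and> (\<forall>r. 0 < r \<and> r < R \<longrightarrow> v r < 0) \<and>
     (\<forall>r\<ge>R. u r \<le> 0) \<and> (\<forall>r\<ge>R. u r = 0 \<longrightarrow> H u v r = 0) \<and>
     (\<forall>r. 0 \<le> r \<and> r \<le> R \<longrightarrow> rA (u r) = r) \<and>
     (\<forall>s. u R \<le> s \<and> s \<le> u 0 \<longrightarrow> 0 \<le> rA s \<and> rA s \<le> R \<and> u (rA s) = s) \<and>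
     hA = (\<lambda>s. - v (rA s)) \<and>
     ((\<lambda>s. hA s / rA s) \<longlongrightarrow> f (u 0) / real n) (at_left (u 0))"

lemma solution_profile:
  assumes s: "solution u v" and u0: "0 < u 0" and osc: "one_sign_change_on {0<..} u"
  obtains z R rA hA rB hB where "profile (u 0) (- u R) rA hA rB hB" "linked u v z R rA hA"
proof -
  obtain z R where zR: "0 < z" "z < R" "\<And>r. 0 \<le> r \<Longrightarrow> r < z \<Longrightarrow> 0 < u r" "u z = 0"
    "\<beta> < u 0" "\<beta> < - u R" "v R = 0" "\<And>r. 0 < r \<Longrightarrow> r < R \<Longrightarrow> v r < 0"
    "\<And>r. z < r \<Longrightarrow> r \<le> R \<Longrightarrow> u r < 0" "\<And>r. R \<le> r \<Longrightarrow> u r \<le> 0"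
    "\<And>r. R \<le> r \<Longrightarrow> u r = 0 \<Longrightarrow> H u v r = 0" "\<And>r. R < r \<Longrightarrow> u r < 0 \<Longrightarrow> 0 < v r"
    by (rule solution_structure[OF s u0 osc]) (assumption | rule that)+
  have R: "0 < R" using zR by simp
  obtain rB hB where B: "branch 0 (- u R) rB hB" "\<And>x. 0 < x \<Longrightarrow> continuous_on {x..- u R} rB"
    "\<And>x. 0 < x \<Longrightarrow> continuous_on {x..- u R} hB" "hB (- u R) = 0" "rB (- u R) = R"
    "\<And>s. 0 < s \<Longrightarrow> s \<le> - u R \<Longrightarrow> 0 < energy hB s" "(energy hB \<longlongrightarrow> 0) (at_right 0)"
    by (rule second_branch[OF s R zR(7,6,10-12)]) (assumption | rule that)+
  obtain k where k: "\<And>x. 0 \<le> x \<Longrightarrow> x \<le> R \<Longrightarrow> k (u x) = x"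
    "\<And>y. u R \<le> y \<Longrightarrow> y \<le> u 0 \<Longrightarrow> 0 \<le> k y \<and> k y \<le> R \<and> u (k y) = y"
    "continuous_on {u R..u 0} k" "continuous_on {u R..u 0} (\<lambda>y. - v (k y))"
    "branch (u R) (u 0) k (\<lambda>y. - v (k y))"
    by (rule segment_branch[OF s order_refl R zR(8)]) (assumption | rule that)+
  have kends: "k (u R) = R" "k (u 0) = 0" using k(1)[of R] k(1)[of 0] R by auto
  have E: "0 < energy (\<lambda>y. - v (k y)) y" if "\<bar>y\<bar> \<le> \<beta>" for y
  proof -
    have y: "u R \<le> y" "y \<le> u 0" using that zR by auto
    have "0 < H u v (k y)" by (rule H_pos[OF s, of _ R]) (use k(2)[OF y] zR(9)[of R] zR(2) in auto)
    then show ?thesis unfolding H_def energy_def using k(2)[OF y] by simp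
  qed
  have prof: "profile (u 0) (- u R) k (\<lambda>y. - v (k y)) rB hB"
    unfolding profile_def using zR k(3-5) B kends E R solutionD(3)[OF s] by auto
  have lim: "((\<lambda>y. - v (k y) / k y) \<longlongrightarrow> f (u 0) / real n) (at_left (u 0))"
  proof -
    have lt: "u R < u 0" using zR beta_pos by linarith
    have "(k \<longlongrightarrow> k (u 0)) (at (u 0) within {u R..u 0})"
      using k(3) lt by (auto simp: continuous_on)
    then have kl: "(k \<longlongrightarrow> 0) (at_left (u 0))"
      unfolding kends using lt by (simp add: at_within_Icc_at_left)
    have "eventually (\<lambda>y. k y \<in> {0<..} \<and> k y \<noteq> 0) (at_left (u 0))"
      using eventually_at_left_real[OF lt]
    proof (rule eventually_mono)
      fix y assume "y \<in> {u R<..<u 0}"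
      then have "0 < k y" using branchD(1)[OF k(5), of y] by simp
      then show "k y \<in> {0<..} \<and> k y \<noteq> 0" by simp
    qed
    then have "filterlim k (at_right 0) (at_left (u 0))" unfolding filterlim_at using kl by simp
    from filterlim_compose[OF solutionD(6)[OF s] this]
    have "((\<lambda>y. v (k y) / k y) \<longlongrightarrow> - f (u 0) / real n) (at_left (u 0))" .
    then have "((\<lambda>y. - (v (k y) / k y)) \<longlongrightarrow> - (- f (u 0) / real n)) (at_left (u 0))"
      by (rule tendsto_minus)
    then show ?thesis by simp
  qed
  have "linked u v z R k (\<lambda>y. - v (k y))"
    unfolding linked_def using zR k(1,2) lim by auto
  then show thesis using that prof by blast
qed

subsection \<open>Comparison under hypothesis (A) and uniqueness\<close>

text \<open>Sturm comparison of \<open>u1 - \<beta>\<close> and \<open>u2 - \<beta>\<close>: their quotient is monotone as long as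
  \<open>u2 \<ge> u1 > \<beta>\<close>.\<close>

lemma sturm:
  assumes s1: "solution u1 v1" and s2: "solution u2 v2" and lt: "u1 0 < u2 0"
    and conc: "\<And>s t. \<beta> < s \<Longrightarrow> s \<le> t \<Longrightarrow> f t / (t - \<beta>) \<le> f s / (s - \<beta>)"
    and p: "0 \<le> p" and above: "\<And>r. 0 \<le> r \<Longrightarrow> r \<le> p \<Longrightarrow> \<beta> < u1 r"
  shows "u1 p < u2 p"
proof (rule ccontr)
  assume np: "\<not> u1 p < u2 p"
  define A where "A = {r\<in>{0..p}. u2 r \<le> u1 r}"
  have "closed A" unfolding A_def
    by (intro continuous_on_closed_Collect_le solutionD(1)[OF s1] solutionD(1)[OF s2]) auto
  moreover have "bounded A" by (rule bounded_subset[of "{0..p}"]) (auto simp: A_def)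
  ultimately have cA: "compact A" by (simp add: compact_eq_bounded_closed)
  have "p \<in> A" using np p unfolding A_def by auto
  then obtain t where t: "t \<in> A" "\<And>x. x \<in> A \<Longrightarrow> t \<le> x" using compact_attains_inf[OF cA] by auto
  have t': "0 < t" "t \<le> p" "u2 t \<le> u1 t" using t(1) lt unfolding A_def by (auto simp: less_le)
  have gt: "u1 r < u2 r" if "0 \<le> r" "r < t" for r using t(2)[of r] that t' unfolding A_def by force
  have ab: "\<beta> < u1 r" if "0 \<le> r" "r \<le> t" for r using above[of r] that t' by simp
  have c: "continuous_on {0..x} u1" "continuous_on {0..x} v1" "continuous_on {0..x} u2" "continuous_on {0..x} v2" for x
    by (auto intro!: solutionD(1,2)[OF s1] solutionD(1,2)[OF s2])
  \<comment> \<open>The weighted Wronskian of u1 - \<beta> and u2 - \<beta>. Its derivative has the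
    sign given by \<open>conc\<close>, and it is the numerator, up to r^(n-1), of the derivative of
    their quotient, which starts above 1 and so cannot reach 1.\<close>
  define G where "G = (\<lambda>r. r ^ (n - 1) * (v2 r * (u1 r - \<beta>) - v1 r * (u2 r - \<beta>)))"
  have G0: "0 \<le> G x" if x: "0 \<le> x" "x < t" for x
  proof -
    have "G 0 \<le> G x"
    proof (rule DERIV_nonneg_imp_increasing_open[OF x(1)])
      show "continuous_on {0..x} G" unfolding G_def by (intro continuous_intros c)
      fix r assume r: "0 < r" "r < x"
      have d1: "(v1 has_real_derivative - (real n - 1) / r * v1 r - f (u1 r)) (at r)"
        and d2: "(v2 has_real_derivative - (real n - 1) / r * v2 r - f (u2 r)) (at r)"
        and e1: "((\<lambda>r. u1 r - \<beta>) has_real_derivative v1 r - 0) (at r)"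
        and e2: "((\<lambda>r. u2 r - \<beta>) has_real_derivative v2 r - 0) (at r)"
        by (rule solutionD(5)[OF s1 r(1)] solutionD(5)[OF s2 r(1)]
            DERIV_diff[OF solutionD(4)[OF s1 r(1)] DERIV_const] DERIV_diff[OF solutionD(4)[OF s2 r(1)] DERIV_const])+
      have "(G has_real_derivative r ^ (n - 1) * (f (u1 r) * (u2 r - \<beta>) - f (u2 r) * (u1 r - \<beta>))) (at r)"
        unfolding G_def
        by (rule DERIV_cong[OF DERIV_mult'[OF DERIV_power_div[OF DERIV_ident, of _ "n - 1"]
              DERIV_diff[OF DERIV_mult'[OF d2 e1] DERIV_mult'[OF d1 e2]]]])
          (use r in \<open>simp_all add: real_n_minus_1 field_simps\<close>)
      moreover have "0 \<le> r ^ (n - 1) * (f (u1 r) * (u2 r - \<beta>) - f (u2 r) * (u1 r - \<beta>))"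
      proof -
        have u: "\<beta> < u1 r" "u1 r < u2 r" using ab[of r] gt[of r] r x by auto
        have "f (u2 r) / (u2 r - \<beta>) \<le> f (u1 r) / (u1 r - \<beta>)" using conc u by simp
        then have "f (u2 r) * (u1 r - \<beta>) \<le> f (u1 r) * (u2 r - \<beta>)"
          using u by (simp add: frac_le_eq divide_le_eq le_divide_eq split: if_splits)
        then show ?thesis using r by simp
      qed
      ultimately show "\<exists>d. (G has_real_derivative d) (at r) \<and> 0 \<le> d" by blast
    qed
    moreover have "G 0 = 0" unfolding G_def solutionD(3)[OF s1] solutionD(3)[OF s2] by simp
    ultimately show ?thesis by simp
  qed
  have "(u2 0 - \<beta>) / (u1 0 - \<beta>) \<le> (u2 t - \<beta>) / (u1 t - \<beta>)"
  proof (rule DERIV_nonneg_imp_increasing_open[where f = "\<lambda>r. (u2 r - \<beta>) / (u1 r - \<beta>)"])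
    show "0 \<le> t" using t' by simp
    have nz: "u1 r - \<beta> \<noteq> 0" if "r \<in> {0..t}" for r using ab[of r] that by simp
    then show "continuous_on {0..t} (\<lambda>r. (u2 r - \<beta>) / (u1 r - \<beta>))" by (intro continuous_intros c) auto
    fix r assume r: "0 < r" "r < t"
    have e1: "((\<lambda>r. u1 r - \<beta>) has_real_derivative v1 r - 0) (at r)"
        and e2: "((\<lambda>r. u2 r - \<beta>) has_real_derivative v2 r - 0) (at r)"
      by (rule DERIV_diff[OF solutionD(4)[OF s1 r(1)] DERIV_const] DERIV_diff[OF solutionD(4)[OF s2 r(1)] DERIV_const])+
    have nz': "u1 r - \<beta> \<noteq> 0" using nz r by simp
    have "r ^ (n - 1) * 0 \<le> r ^ (n - 1) * (v2 r * (u1 r - \<beta>) - v1 r * (u2 r - \<beta>))"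
      using G0[OF less_imp_le[OF r(1)] r(2)] unfolding G_def by (simp only: mult_zero_right)
    then have "0 \<le> v2 r * (u1 r - \<beta>) - v1 r * (u2 r - \<beta>)"
      by (rule mult_left_le_imp_le) (use r in simp)
    then have "0 \<le> ((v2 r - 0) * (u1 r - \<beta>) - (u2 r - \<beta>) * (v1 r - 0)) / ((u1 r - \<beta>) * (u1 r - \<beta>))"
      by (intro divide_nonneg_nonneg) (simp_all add: mult.commute)
    then show "\<exists>d. ((\<lambda>r. (u2 r - \<beta>) / (u1 r - \<beta>)) has_real_derivative d) (at r) \<and> 0 \<le> d"
      using DERIV_divide[OF e2 e1 nz'] by blast
  qed
  moreover have "1 < (u2 0 - \<beta>) / (u1 0 - \<beta>)" using ab[of 0] lt t' by (simp add: less_divide_eq_1_pos)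
  moreover have "(u2 t - \<beta>) / (u1 t - \<beta>) \<le> 1" using ab[of t] t' by (simp add: divide_le_eq_1_pos)
  ultimately show False by simp
qed

lemma linked_facts:
  assumes "linked u v z R rA hA"
  shows "0 < z" "z < R" "u z = 0" "\<And>r. 0 \<le> r \<Longrightarrow> r < z \<Longrightarrow> 0 < u r"
    "\<And>r. z < r \<Longrightarrow> r \<le> R \<Longrightarrow> u r < 0" "\<And>r. 0 < r \<Longrightarrow> r < R \<Longrightarrow> v r < 0"
    "\<And>r. R \<le> r \<Longrightarrow> u r \<le> 0" "\<And>r. R \<le> r \<Longrightarrow> u r = 0 \<Longrightarrow> H u v r = 0"
    "\<And>r. 0 \<le> r \<Longrightarrow> r \<le> R \<Longrightarrow> rA (u r) = r"
    "\<And>s. u R \<le> s \<Longrightarrow> s \<le> u 0 \<Longrightarrow> 0 \<le> rA s \<and> rA s \<le> R \<and> u (rA s) = s"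
    "\<And>s. hA s = - v (rA s)"
    "((\<lambda>s. hA s / rA s) \<longlongrightarrow> f (u 0) / real n) (at_left (u 0))"
  using assms unfolding linked_def by auto

lemma linked_strict:
  assumes s: "solution u v" and l: "linked u v z R rA hA" and xy: "0 \<le> x" "x < y" "y \<le> R"
  shows "u y < u x"
proof (rule DERIV_neg_imp_decreasing_open[OF xy(2)])
  show "continuous_on {x..y} u" by (rule solutionD(1)[OF s]) (use xy in auto)
  fix r assume "x < r" "r < y"
  then show "\<exists>d. (u has_real_derivative d) (at r) \<and> d < 0"
    using linked_facts(6)[OF l, of r] solutionD(4)[OF s, of r] xy by auto
qed

text \<open>If u2 reached \<beta> at a smaller radius than u1, then u1 would exceed u2 = \<beta>
  there, against \<open>sturm\<close>. So r1 \<le> r2 at \<beta>, and the speeds are already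
  ordered.\<close>

lemma flux_le_sturm:
  assumes s1: "solution u1 v1" and s2: "solution u2 v2" and lt: "u1 0 < u2 0"
    and l1: "linked u1 v1 z1 R1 r1 h1" and l2: "linked u2 v2 z2 R2 r2 h2"
    and conc: "\<And>s t. \<beta> < s \<Longrightarrow> s \<le> t \<Longrightarrow> f t / (t - \<beta>) \<le> f s / (s - \<beta>)"
    and \<beta>: "u1 R1 < \<beta>" "\<beta> < u1 0" "u2 R2 < \<beta>" and h: "0 < h1 \<beta>" "h1 \<beta> < h2 \<beta>"
  shows "flux r1 h1 \<beta> \<le> flux r2 h2 \<beta>"
proof -
  have k1: "0 \<le> r1 \<beta> \<and> r1 \<beta> \<le> R1 \<and> u1 (r1 \<beta>) = \<beta>" using linked_facts(10)[OF l1, of \<beta>] \<beta> by simp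
  have k2: "0 \<le> r2 \<beta> \<and> r2 \<beta> \<le> R2 \<and> u2 (r2 \<beta>) = \<beta>" using linked_facts(10)[OF l2, of \<beta>] \<beta> lt by simp
  have "r1 \<beta> \<le> r2 \<beta>"
  proof (rule ccontr)
    assume n: "\<not> r1 \<beta> \<le> r2 \<beta>"
    have above: "\<beta> < u1 r" if "0 \<le> r" "r \<le> r2 \<beta>" for r
      using linked_strict[OF s1 l1, of r "r1 \<beta>"] k1 n that by auto
    have "u1 (r2 \<beta>) < u2 (r2 \<beta>)"
      by (rule sturm[OF s1 s2 lt conc _ above]) (use k2 in auto)
    then show False using above[of "r2 \<beta>"] k2 by simp
  qed
  then show ?thesis unfolding flux_def using k1 h by (intro mult_mono power_mono) auto
qed

section \<open>Uniqueness for equal initial heights\<close>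

text \<open>Gronwall estimate for (u1 - u2)^2 + (v1 - v2)^2. The singular friction term only
  decreases this quantity, so the estimate may start at radius 0.\<close>

lemma radial_unique:
  assumes s1: "solution u1 v1" and s2: "solution u2 v2"
    and lip: "\<And>m M. 0 < m \<Longrightarrow> \<exists>L\<ge>0. \<forall>x\<in>{m..M}. \<forall>y\<in>{m..M}. \<bar>f x - f y\<bar> \<le> L * \<bar>x - y\<bar>"
    and ab: "0 \<le> a" "a \<le> q" and eq: "u1 a = u2 a" "v1 a = v2 a"
    and pos: "\<And>r. a \<le> r \<Longrightarrow> r \<le> q \<Longrightarrow> 0 < u1 r \<and> 0 < u2 r"
  shows "u1 q = u2 q" "v1 q = v2 q"
proof -
  have c: "continuous_on {a..q} u1" "continuous_on {a..q} v1" "continuous_on {a..q} u2" "continuous_on {a..q} v2"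
    using ab by (auto intro!: solutionD(1,2)[OF s1] solutionD(1,2)[OF s2])
  have ne: "{a..q} \<noteq> {}" using ab by simp
  have cmin: "continuous_on {a..q} (\<lambda>r. min (u1 r) (u2 r))" by (intro continuous_intros c)
  have cmax: "continuous_on {a..q} (\<lambda>r. max (u1 r) (u2 r))" by (intro continuous_intros c)
  obtain x0 where x0: "x0 \<in> {a..q}" "\<And>r. r \<in> {a..q} \<Longrightarrow> min (u1 x0) (u2 x0) \<le> min (u1 r) (u2 r)"
    using continuous_attains_inf[OF compact_Icc ne cmin] by blast
  obtain x1 where x1: "\<And>r. r \<in> {a..q} \<Longrightarrow> max (u1 r) (u2 r) \<le> max (u1 x1) (u2 x1)"
    using continuous_attains_sup[OF compact_Icc ne cmax] by blast
  define m where "m = min (u1 x0) (u2 x0)"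
  define M where "M = max (u1 x1) (u2 x1)"
  have m: "0 < m" unfolding m_def using pos[of x0] x0(1) by auto
  obtain L where L: "0 \<le> L" "\<And>x y. x \<in> {m..M} \<Longrightarrow> y \<in> {m..M} \<Longrightarrow> \<bar>f x - f y\<bar> \<le> L * \<bar>x - y\<bar>"
    using lip[OF m, of M] by blast
  have inM: "u1 r \<in> {m..M}" "u2 r \<in> {m..M}" if "r \<in> {a..q}" for r
    using x0(2)[OF that] x1[OF that] unfolding m_def M_def by auto
  define Q where "Q = (\<lambda>r. (u1 r - u2 r)\<^sup>2 + (v1 r - v2 r)\<^sup>2)"
  define P where "P = (\<lambda>r. Q r * exp (- (L + 1) * r))"
  have "P q \<le> P a"
  proof (rule DERIV_nonpos_imp_decreasing_open[where f = P, OF ab(2)])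
    show "continuous_on {a..q} P" unfolding P_def Q_def by (intro continuous_intros c)
    fix r assume r: "a < r" "r < q"
    then have r0: "0 < r" using ab by simp
    define y where "y = u1 r - u2 r"
    define z where "z = v1 r - v2 r"
    define g where "g = f (u1 r) - f (u2 r)"
    have dy: "((\<lambda>r. u1 r - u2 r) has_real_derivative z) (at r)"
      unfolding z_def by (rule DERIV_diff[OF solutionD(4)[OF s1 r0] solutionD(4)[OF s2 r0]])
    have dz: "((\<lambda>r. v1 r - v2 r) has_real_derivative - (real n - 1) / r * z - g) (at r)"
      unfolding z_def g_def
      by (rule DERIV_cong[OF DERIV_diff[OF solutionD(5)[OF s1 r0] solutionD(5)[OF s2 r0]]])
        (use r0 in \<open>simp add: field_simps\<close>)
    define Q' where "Q' = 2 * y * z + 2 * z * (- (real n - 1) / r * z - g)"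
    have dQ: "(Q has_real_derivative Q') (at r)"
      unfolding Q_def
      by (rule DERIV_cong[OF DERIV_add[OF DERIV_power[OF dy, of 2] DERIV_power[OF dz, of 2]]])
        (simp add: Q'_def y_def z_def algebra_simps)
    have dE: "((\<lambda>r. exp (- (L + 1) * r)) has_real_derivative exp (- (L + 1) * r) * (- (L + 1) * 1)) (at r)"
      by (rule DERIV_chain2[OF DERIV_exp DERIV_cmult[OF DERIV_ident]])
    have dP: "(P has_real_derivative Q r * (exp (- (L + 1) * r) * (- (L + 1) * 1)) + Q' * exp (- (L + 1) * r)) (at r)"
      unfolding P_def by (rule DERIV_mult'[OF dQ dE])
    have "\<bar>g\<bar> \<le> L * \<bar>y\<bar>" unfolding g_def y_def by (rule L(2)[OF inM]) (use r in auto)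
    then have "\<bar>z\<bar> * \<bar>g\<bar> \<le> \<bar>z\<bar> * (L * \<bar>y\<bar>)" by (intro mult_left_mono) auto
    then have zg: "- (z * g) \<le> L * (\<bar>y\<bar> * \<bar>z\<bar>)"
      using abs_ge_minus_self[of "z * g"] by (simp add: abs_mult mult_ac)
    have yz: "2 * (\<bar>y\<bar> * \<bar>z\<bar>) \<le> y\<^sup>2 + z\<^sup>2"
      using sum_squares_bound[of "\<bar>y\<bar>" "\<bar>z\<bar>"] by simp
    have "2 * z * (- (real n - 1) / r * z) \<le> 0"
    proof -
      have "2 * z * (- (real n - 1) / r * z) = - (2 * ((real n - 1) / r * z\<^sup>2))"
        using r0 by (simp add: field_simps power2_eq_square)
      moreover have "0 \<le> (real n - 1) / r * z\<^sup>2" using n_ge_2 r0 by simp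
      ultimately show ?thesis by linarith
    qed
    then have "Q' \<le> 2 * (y * z) - 2 * (z * g)" unfolding Q'_def by (simp add: algebra_simps)
    also have "\<dots> \<le> 2 * (\<bar>y\<bar> * \<bar>z\<bar>) + 2 * (L * (\<bar>y\<bar> * \<bar>z\<bar>))"
      using zg abs_ge_self[of "y * z"] by (simp add: abs_mult)
    also have "\<dots> = (L + 1) * (2 * (\<bar>y\<bar> * \<bar>z\<bar>))" by (simp add: algebra_simps)
    also have "\<dots> \<le> (L + 1) * (y\<^sup>2 + z\<^sup>2)" using yz L(1) by (intro mult_left_mono) auto
    also have "\<dots> = (L + 1) * Q r" unfolding Q_def y_def z_def ..
    finally have "(Q' - (L + 1) * Q r) * exp (- (L + 1) * r) \<le> 0"
      by (intro mult_nonpos_nonneg) auto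
    then have "Q r * (exp (- (L + 1) * r) * (- (L + 1) * 1)) + Q' * exp (- (L + 1) * r) \<le> 0"
      by (simp add: algebra_simps)
    then show "\<exists>d. (P has_real_derivative d) (at r) \<and> d \<le> 0" using dP by blast
  qed
  moreover have "P a = 0" unfolding P_def Q_def eq by simp
  ultimately have "P q \<le> 0" by simp
  then have "Q q \<le> 0" unfolding P_def by (simp add: mult_le_0_iff)
  then have "(u1 q - u2 q)\<^sup>2 + (v1 q - v2 q)\<^sup>2 = 0" unfolding Q_def
    by (intro antisym) auto
  then show "u1 q = u2 q" "v1 q = v2 q" by (auto simp: sum_power2_eq_zero_iff)
qed

text \<open>In the variables \<open>(r, h)\<close> the equation is Lipschitz even where \<open>f\<close> is only continuous, so
  uniqueness persists across the zero of the solution.\<close>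

lemma branch_unique:
  assumes B: "branch l c r1 h1" "branch l c r2 h2" and x: "l < x" "x \<le> t" "t < c"
    and eq: "r1 t = r2 t" "h1 t = h2 t"
  shows "r1 x = r2 x" "h1 x = h2 x"
proof -
  have sub: "{x..t} \<subseteq> {l<..<c}" using x by auto
  note cc = branch_cont[OF B(1) sub] branch_cont[OF B(2) sub]
  have pos: "0 < r1 s" "0 < h1 s" "0 < r2 s" "0 < h2 s" if "s \<in> {x..t}" for s
    using branchD(1,2)[OF B(1), of s] branchD(1,2)[OF B(2), of s] that x by auto
  \<comment> \<open>The coefficients in the lower bound for the derivative of \<open>Q\<close>;
    their maximum is the Gronwall constant. The estimate runs towards smaller values, hence the
    factor exp(C s) with positive sign.\<close>
  define k where "k = (\<lambda>s. 1 / (h1 s * h2 s) + (real n - 1) / (r1 s * r2 s) + 2 * (\<bar>f s\<bar> / (h1 s * h2 s)))"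
  have ck: "continuous_on {x..t} k" unfolding k_def
    using pos by (intro continuous_intros cc f_cont_on) (auto simp: less_imp_neq[symmetric])
  have "{x..t} \<noteq> {}" using x by simp
  then obtain y where y: "\<And>s. s \<in> {x..t} \<Longrightarrow> k s \<le> k y"
    using continuous_attains_sup[OF compact_Icc _ ck] by blast
  define C where "C = k y"
  define Q where "Q = (\<lambda>s. (r1 s - r2 s)\<^sup>2 + (h1 s - h2 s)\<^sup>2)"
  define P where "P = (\<lambda>s. Q s * exp (C * s))"
  have "P x \<le> P t"
  proof (rule DERIV_nonneg_imp_increasing_open[where f = P, OF x(2)])
    show "continuous_on {x..t} P" unfolding P_def Q_def by (intro continuous_intros cc)
    fix s assume s: "x < s" "s < t"
    then have ls: "l < s" "s < c" "s \<in> {x..t}" using x by auto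
    note b1 = branchD[OF B(1) ls(1,2)] and b2 = branchD[OF B(2) ls(1,2)]
    define d where "d = r1 s - r2 s"
    define D where "D = h1 s - h2 s"
    define A where "A = 1 / (h1 s * h2 s)"
    define E where "E = (real n - 1) / (r1 s * r2 s)"
    have dd: "((\<lambda>s. r1 s - r2 s) has_real_derivative A * D) (at s)"
      by (rule DERIV_cong[OF DERIV_diff[OF b1(3) b2(3)]])
        (use b1 b2 in \<open>simp add: A_def D_def field_simps\<close>)
    have dD: "((\<lambda>s. h1 s - h2 s) has_real_derivative - E * d + f s * A * D) (at s)"
      by (rule DERIV_cong[OF DERIV_diff[OF b1(4) b2(4)]])
        (use b1(1,2) b2(1,2) in \<open>simp add: A_def D_def E_def d_def field_simps\<close>)
    define Q' where "Q' = 2 * d * (A * D) + 2 * D * (- E * d + f s * A * D)"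
    have dQ: "(Q has_real_derivative Q') (at s)"
      unfolding Q_def
      by (rule DERIV_cong[OF DERIV_add[OF DERIV_power[OF dd, of 2] DERIV_power[OF dD, of 2]]])
        (simp add: Q'_def d_def D_def algebra_simps)
    have dE: "((\<lambda>s. exp (C * s)) has_real_derivative exp (C * s) * (C * 1)) (at s)"
      by (rule DERIV_chain2[OF DERIV_exp DERIV_cmult[OF DERIV_ident]])
    have dP: "(P has_real_derivative Q s * (exp (C * s) * (C * 1)) + Q' * exp (C * s)) (at s)"
      unfolding P_def by (rule DERIV_mult'[OF dQ dE])
    have AE: "0 \<le> A" "0 \<le> E" unfolding A_def E_def using b1 b2 n_ge_2 by auto
    have kC: "A + E + 2 * (\<bar>f s\<bar> * A) \<le> C" using y[OF ls(3)] unfolding C_def k_def A_def E_def by simp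
    have "2 * (\<bar>d\<bar> * \<bar>D\<bar>) \<le> d\<^sup>2 + D\<^sup>2" using sum_squares_bound[of "\<bar>d\<bar>" "\<bar>D\<bar>"] by simp
    then have bd: "- (d\<^sup>2 + D\<^sup>2) \<le> 2 * (d * D)" "2 * (d * D) \<le> d\<^sup>2 + D\<^sup>2"
      using abs_ge_self[of "d * D"] abs_ge_minus_self[of "d * D"] by (auto simp: abs_mult)
    have 1: "- (A * (d\<^sup>2 + D\<^sup>2)) \<le> A * (2 * (d * D))"
      using mult_left_mono[OF bd(1) AE(1)] by (simp only: mult_minus_right)
    have 2: "E * (2 * (d * D)) \<le> E * (d\<^sup>2 + D\<^sup>2)" using mult_left_mono[OF bd(2) AE(2)] .
    have "- \<bar>f s\<bar> * (A * D\<^sup>2) \<le> f s * (A * D\<^sup>2)" using AE by (intro mult_right_mono) auto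
    moreover have "\<bar>f s\<bar> * A * D\<^sup>2 \<le> \<bar>f s\<bar> * A * (d\<^sup>2 + D\<^sup>2)" using AE by (intro mult_left_mono) auto
    ultimately have 3: "- (\<bar>f s\<bar> * A * (d\<^sup>2 + D\<^sup>2)) \<le> f s * (A * D\<^sup>2)" by (simp add: mult.assoc)
    have "Q' = A * (2 * (d * D)) - E * (2 * (d * D)) + 2 * (f s * (A * D\<^sup>2))"
      unfolding Q'_def by (simp add: algebra_simps power2_eq_square)
    then have "- ((A + E + 2 * (\<bar>f s\<bar> * A)) * (d\<^sup>2 + D\<^sup>2)) \<le> Q'"
      using 1 2 3 by (simp add: algebra_simps)
    moreover have "(A + E + 2 * (\<bar>f s\<bar> * A)) * (d\<^sup>2 + D\<^sup>2) \<le> C * (d\<^sup>2 + D\<^sup>2)"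
      using kC by (intro mult_right_mono) auto
    ultimately have "0 \<le> Q' + C * Q s" unfolding Q_def d_def D_def by linarith
    then have "0 \<le> (Q' + C * Q s) * exp (C * s)" by simp
    then have "0 \<le> Q s * (exp (C * s) * (C * 1)) + Q' * exp (C * s)" by (simp add: algebra_simps)
    then show "\<exists>d. (P has_real_derivative d) (at s) \<and> 0 \<le> d" using dP by blast
  qed
  moreover have "P t = 0" unfolding P_def Q_def eq by simp
  ultimately have "P x \<le> 0" by simp
  then have "Q x \<le> 0" unfolding P_def by (simp add: mult_le_0_iff)
  then have "(r1 x - r2 x)\<^sup>2 + (h1 x - h2 x)\<^sup>2 = 0" unfolding Q_def by (intro antisym) auto
  then show "r1 x = r2 x" "h1 x = h2 x" by (auto simp: sum_power2_eq_zero_iff)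
qed

text \<open>A zero beyond \<open>R\<close> has zero energy, after which the solution stays
  0.\<close>

lemma neg_before:
  assumes s: "solution u v" and l: "linked u v z R rA hA" and xy: "z < x" "x \<le> y" "u y < 0"
  shows "u x < 0"
proof (cases "x \<le> R")
  case False
  then have "R \<le> x" by simp
  then show ?thesis
    using linked_facts(7,8)[OF l, of x] zero_if_H_zero[OF s, of x y] xy linked_facts(1,2)[OF l]
    by (cases "u x = 0") auto
qed (use linked_facts(5)[OF l] xy in auto)

text \<open>Lipschitz uniqueness works while both solutions are negative. At a first zero of u1 the
  two would still agree by continuity, but u2 is negative there.\<close>

lemma tail_neg:
  assumes s1: "solution u1 v1" and s2: "solution u2 v2"
    and lip: "\<And>m M. 0 < m \<Longrightarrow> \<exists>L\<ge>0. \<forall>x\<in>{m..M}. \<forall>y\<in>{m..M}. \<bar>f x - f y\<bar> \<le> L * \<bar>x - y\<bar>"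
    and l1: "linked u1 v1 z1 R1 rA1 hA1" and l2: "linked u2 v2 z2 R2 rA2 hA2"
    and a: "z1 < a" "z2 < a" and eq: "u1 a = u2 a" "v1 a = v2 a" and r: "a \<le> r" "u2 r < 0"
  shows "u1 r < 0" "u1 r = u2 r"
proof -
  have a0: "0 \<le> a" using a linked_facts(1)[OF l1] by simp
  have same: "u1 x = u2 x" if x: "a \<le> x" "x \<le> r" and neg: "\<And>y. a \<le> y \<Longrightarrow> y \<le> x \<Longrightarrow> u1 y < 0" for x
  proof -
    have "- u1 x = - u2 x"
    proof (rule radial_unique(1)[OF solution_minus[OF s1] solution_minus[OF s2] lip a0 x(1)])
      fix y assume y: "a \<le> y" "y \<le> x"
      then show "0 < - u1 y \<and> 0 < - u2 y" using neg[OF y] neg_before[OF s2 l2, of y r] x r a by simp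
    qed (use eq in auto)
    then show ?thesis by simp
  qed
  have nonneg: "u1 x < 0" if x: "a \<le> x" "x \<le> r" for x
  proof (rule ccontr)
    assume "\<not> u1 x < 0"
    define A where "A = {y\<in>{a..x}. 0 \<le> u1 y}"
    have "closed A" unfolding A_def
      by (intro continuous_on_closed_Collect_le continuous_on_const solutionD(1)[OF s1]) (use a0 in auto)
    moreover have "bounded A" by (rule bounded_subset[of "{a..x}"]) (auto simp: A_def)
    ultimately have cA: "compact A" by (simp add: compact_eq_bounded_closed)
    have "x \<in> A" using \<open>\<not> u1 x < 0\<close> x unfolding A_def by auto
    then obtain t where t: "t \<in> A" "\<And>y. y \<in> A \<Longrightarrow> t \<le> y" using compact_attains_inf[OF cA] by auto
    have ua: "u1 a < 0" using eq neg_before[OF s2 l2 a(2) r] by simp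
    have t': "a < t" "t \<le> x" "0 \<le> u1 t" using t(1) ua unfolding A_def by (auto simp: less_le)
    have neg: "u1 y < 0" if "a \<le> y" "y < t" for y using t(2)[of y] that t' unfolding A_def by force
    have "u1 t - u2 t = 0"
    proof (rule continuous_constant_on_closure[of "{a..<t}" "\<lambda>y. u1 y - u2 y"])
      show "continuous_on (closure {a..<t}) (\<lambda>y. u1 y - u2 y)"
        by (intro continuous_on_diff solutionD(1)[OF s1] solutionD(1)[OF s2]) (use a0 t' in auto)
      fix y assume "y \<in> {a..<t}"
      then show "u1 y - u2 y = 0" using same[of y] neg t' x by simp
    qed (use t' in auto)
    then show False using neg_before[OF s2 l2, of t r] t' a x r by simp
  qed
  then show "u1 r < 0" "u1 r = u2 r" using same[OF r(1) order_refl] r by auto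
qed

text \<open>Three overlapping stages: \<open>radial_unique\<close> at positive values,
  \<open>branch_unique\<close> across the zero, \<open>tail_neg\<close> beyond it. The last one,
  used in both directions, also shows that the solutions vanish at the same radii of the
  tail.\<close>

lemma equal_heights_unique:
  assumes s1: "solution u1 v1" and s2: "solution u2 v2"
    and lip: "\<And>m M. 0 < m \<Longrightarrow> \<exists>L\<ge>0. \<forall>x\<in>{m..M}. \<forall>y\<in>{m..M}. \<bar>f x - f y\<bar> \<le> L * \<bar>x - y\<bar>"
    and l1: "linked u1 v1 z1 R1 rA1 hA1" and l2: "linked u2 v2 z2 R2 rA2 hA2"
    and p1: "profile (u1 0) (- u1 R1) rA1 hA1 rB1 hB1" and p2: "profile (u2 0) (- u2 R2) rA2 hA2 rB2 hB2"
    and eq: "u1 0 = u2 0" and r: "0 \<le> r"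
  shows "u1 r = u2 r"
proof -
  note f1 = linked_facts[OF l1] and f2 = linked_facts[OF l2]
  define a where "a = min z1 z2 / 2"
  have a: "0 < a" "a < z1" "a < z2" unfolding a_def using f1(1) f2(1) by (auto simp: min_def)
  have start: "u1 x = u2 x \<and> v1 x = v2 x" if x: "0 \<le> x" "x \<le> a" for x
    using radial_unique[OF s1 s2 lip order_refl x(1) eq] solutionD(3)[OF s1] solutionD(3)[OF s2] f1(4) f2(4) x a
    by auto
  have B1: "branch (u1 R1) (u1 0) rA1 hA1" and B2: "branch (u2 R2) (u1 0) rA2 hA2"
    using p1 p2 unfolding profile_def eq by auto
  define l where "l = max (u1 R1) (u2 R2)"
  have l: "u1 R1 \<le> l" "u2 R2 \<le> l" "l < 0"
    unfolding l_def using f1(5)[of R1] f2(5)[of R2] f1(2) f2(2) by auto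
  have B: "branch l (u1 0) rA1 hA1" "branch l (u1 0) rA2 hA2"
    using branch_subset[OF B1 l(1)] branch_subset[OF B2 l(2)] by auto
  define t where "t = u1 a"
  have t: "0 < t" "t < u1 0" "rA1 t = a" "rA2 t = a"
    unfolding t_def using f1(4)[of a] linked_strict[OF s1 l1, of 0 a] f1(9)[of a] f2(9)[of a] start[of a] a f1(2) f2(2) by auto
  have ht: "hA1 t = hA2 t" unfolding f1(11) f2(11) t using start[of a] a by simp
  have same: "rA1 x = rA2 x" "hA1 x = hA2 x" if "l < x" "x \<le> t" for x
    using branch_unique[OF B that t(2) _ ht] t by auto
  \<comment> \<open>\<open>l\<close> is the higher of the two minima, so l/2 is a negative value
    above both; the solutions take it at the same radius and with the same derivative.\<close>
  define c where "c = rA1 (l / 2)"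
  have c1: "0 \<le> c" "c \<le> R1" "u1 c = l / 2" using f1(10)[of "l / 2"] l t unfolding c_def by auto
  have c2: "0 \<le> c" "c \<le> R2" "u2 c = l / 2"
    using f2(10)[of "l / 2"] l t eq same(1)[of "l / 2"] unfolding c_def by auto
  have vc: "v1 c = v2 c" using same[of "l / 2"] l t unfolding f1(11) f2(11) c_def by auto
  have zc: "z1 < c" "z2 < c"
  proof -
    have "\<not> c < z1" "c \<noteq> z1" "\<not> c < z2" "c \<noteq> z2"
      using f1(3) f1(4)[of c] f2(3) f2(4)[of c] c1 c2 l by auto
    then show "z1 < c" "z2 < c" by auto
  qed
  show ?thesis
  proof (cases "r \<le> c")
    case True
    show ?thesis
    proof (cases "r \<le> a")
      case False
      have "u1 r \<le> t" unfolding t_def using linked_strict[OF s1 l1, of a r] False True c1 a by auto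
      moreover have "l < u1 r" using linked_strict[OF s1 l1, of r c] True r c1 l by (cases "r = c") auto
      ultimately have "rA2 (u1 r) = r" using same(1)[of "u1 r"] f1(9)[of r] r True c1 by simp
      moreover have "u2 R2 \<le> u1 r" "u1 r \<le> u2 0" using \<open>u1 r \<le> t\<close> \<open>l < u1 r\<close> l t eq by auto
      ultimately show ?thesis using f2(10)[of "u1 r"] by simp
    qed (use start r in auto)
  next
    case False
    then have rc: "c \<le> r" by simp
    have nonpos: "u1 r \<le> 0" "u2 r \<le> 0"
      using f1(5)[of r] f1(7)[of r] f2(5)[of r] f2(7)[of r] zc rc by force+
    show ?thesis
    proof (cases "u2 r < 0")
      case True
      then show ?thesis using tail_neg(2)[OF s1 s2 lip l1 l2 zc _ vc rc] c1 c2 by simp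
    next
      case f: False
      have "\<not> u1 r < 0"
        using tail_neg(1)[OF s2 s1 lip l2 l1 zc(2,1) _ vc[symmetric] rc] c1 c2 f by auto
      then show ?thesis using nonpos f by simp
    qed
  qed
qed

section \<open>Different initial heights are impossible\<close>

lemma heights_not_less:
  assumes s1: "solution u1 v1" and s2: "solution u2 v2"
    and l1: "linked u1 v1 z1 R1 rA1 hA1" and l2: "linked u2 v2 z2 R2 rA2 hA2"
    and p1: "profile (u1 0) (- u1 R1) rA1 hA1 rB1 hB1" and p2: "profile (u2 0) (- u2 R2) rA2 hA2 rB2 hB2"
    and alt: "(\<forall>s t. \<beta> < s \<longrightarrow> s \<le> t \<longrightarrow> f t / (t - \<beta>) \<le> f s / (s - \<beta>)) \<or>
      (\<forall>s t. \<beta> < s \<longrightarrow> s \<le> t \<longrightarrow>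
         sqrt (2 * F s) ^ n / f s ^ (n - 1) \<le> sqrt (2 * F t) ^ n / f t ^ (n - 1))"
  shows "\<not> u1 0 < u2 0"
proof
  assume lt: "u1 0 < u2 0"
  note t = top_less[OF p1 p2 lt]
  have a: "\<beta> < u1 0" "\<beta> < u2 0" "\<beta> < - u1 R1" "\<beta> < - u2 R2"
    and B: "branch (u1 R1) (u1 0) rA1 hA1" "branch (u2 R2) (u2 0) rA2 hA2"
    and C: "continuous_on {u1 R1..u1 0} rA1" "continuous_on {u1 R1..u1 0} hA1"
      "continuous_on {u2 R2..u2 0} rA2" "continuous_on {u2 R2..u2 0} hA2"
    and z: "hA1 (u1 0) = 0" "hA2 (u2 0) = 0" "rA1 (u1 0) = 0" "rA2 (u2 0) = 0"
    using p1 p2 unfolding profile_def by auto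
  have lb: "u1 R1 < \<beta>" "u2 R2 < \<beta>" using a beta_pos by auto
  define l where "l = max (u1 R1) (u2 R2)"
  have l: "u1 R1 \<le> l" "u2 R2 \<le> l" "l < \<beta>" using lb unfolding l_def by auto
  have h\<beta>: "hA1 \<beta> < hA2 \<beta>" using t(1) a by simp
  have "flux rA1 hA1 \<beta> \<le> flux rA2 hA2 \<beta>"
    using alt
  proof
    assume "\<forall>s t. \<beta> < s \<longrightarrow> s \<le> t \<longrightarrow> f t / (t - \<beta>) \<le> f s / (s - \<beta>)"
    then show ?thesis
      using branchD(2)[OF B(1) lb(1) a(1)] h\<beta> a lb by (intro flux_le_sturm[OF s1 s2 lt l1 l2]) auto
  next
    assume J: "\<forall>s t. \<beta> < s \<longrightarrow> s \<le> t \<longrightarrow>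
         sqrt (2 * F s) ^ n / f s ^ (n - 1) \<le> sqrt (2 * F t) ^ n / f t ^ (n - 1)"
    have sub: "{\<beta>..u1 0} \<subseteq> {u1 R1..u1 0}" "{\<beta>..u2 0} \<subseteq> {u2 R2..u2 0}" using lb by auto
    show ?thesis
      by (rule flux_le_at_beta[OF branch_subset[OF B(1) l(1) order_refl] branch_subset[OF B(2) l(2) order_refl]
            l(3) a(1) lt C(1,2)[THEN continuous_on_subset, OF sub(1)] C(3,4)[THEN continuous_on_subset, OF sub(2)]
            z t(1) linked_facts(12)[OF l1] linked_facts(12)[OF l2] refl])
        (use J in auto)
  qed
  then show False by (rule no_two_profiles[OF p1 p2 lt])
qed

lemma at_most_one:
  assumes u1: "radial_solution n f u1" "0 < u1 0" "one_sign_change_on {0<..} u1"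
    and u2: "radial_solution n f u2" "0 < u2 0" "one_sign_change_on {0<..} u2"
    and lip: "\<And>m M. 0 < m \<Longrightarrow> \<exists>L\<ge>0. \<forall>x\<in>{m..M}. \<forall>y\<in>{m..M}. \<bar>f x - f y\<bar> \<le> L * \<bar>x - y\<bar>"
    and alt: "(\<forall>s t. \<beta> < s \<longrightarrow> s \<le> t \<longrightarrow> f t / (t - \<beta>) \<le> f s / (s - \<beta>)) \<or>
      (\<forall>s t. \<beta> < s \<longrightarrow> s \<le> t \<longrightarrow>
         sqrt (2 * F s) ^ n / f s ^ (n - 1) \<le> sqrt (2 * F t) ^ n / f t ^ (n - 1))"
    and r: "0 \<le> r"
  shows "u1 r = u2 r"
proof -
  obtain v1 where s1: "solution u1 v1" by (rule solutionI[OF u1(1)])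
  obtain v2 where s2: "solution u2 v2" by (rule solutionI[OF u2(1)])
  obtain z1 R1 rA1 hA1 rB1 hB1 where
    p1: "profile (u1 0) (- u1 R1) rA1 hA1 rB1 hB1" and l1: "linked u1 v1 z1 R1 rA1 hA1"
    by (rule solution_profile[OF s1 u1(2,3)])
  obtain z2 R2 rA2 hA2 rB2 hB2 where
    p2: "profile (u2 0) (- u2 R2) rA2 hA2 rB2 hB2" and l2: "linked u2 v2 z2 R2 rA2 hA2"
    by (rule solution_profile[OF s2 u2(2,3)])
  have "u1 0 = u2 0"
    using heights_not_less[OF s1 s2 l1 l2 p1 p2 alt] heights_not_less[OF s2 s1 l2 l1 p2 p1 alt] by simp
  from equal_heights_unique[OF s1 s2 lip l1 l2 p1 p2 this r] show ?thesis .
qed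

end

subsection \<open>Verification of the hypotheses\<close>

lemma antideriv_DERIV:
  assumes "continuous_on UNIV f"
  shows "(antideriv f has_real_derivative f s) (at s)"
proof -
  define a where "a = min 0 s - 1"
  define c where "c = max 0 s + 1"
  have ac: "a < 0" "0 < c" "a < s" "s < c" unfolding a_def c_def by auto
  have "((\<lambda>x. LBINT t=0..x. f t) has_vector_derivative f s) (at s within {a..c})"
    using interval_integral_FTC2[of a 0 c f s] assms ac
    by (auto intro: continuous_on_subset simp: zero_ereal_def)
  then show ?thesis
    using ac unfolding antideriv_def[abs_def] has_real_derivative_iff_has_vector_derivative
    by (simp add: at_within_Icc_at)
qed

lemma antideriv_even:
  assumes c: "continuous_on UNIV f" and odd: "\<And>s. f (- s) = - f s"
  shows "antideriv f (- s) = antideriv f s"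
proof -
  have "((\<lambda>x. antideriv f (- x) - antideriv f x) has_real_derivative 0) (at x)" for x
    by (rule DERIV_cong[OF DERIV_diff[OF DERIV_chain2[OF antideriv_DERIV[OF c] DERIV_minus[OF DERIV_ident]] antideriv_DERIV[OF c]]])
      (simp add: odd)
  then have "antideriv f (- s) - antideriv f s = antideriv f (- 0) - antideriv f 0"
    by (intro DERIV_isconst_all) auto
  then show ?thesis by simp
qed

text \<open>With \<open>q = s f'(s) / f(s) > 0\<close> the function \<open>(q + 1) F(t) - t f(t)\<close> decreases on
  \<open>[\<beta>, s]\<close>.\<close>

lemma F_deriv_le:
  fixes f F f' :: "real \<Rightarrow> real" and n :: nat
  assumes n: "2 < n" and \<beta>: "0 < \<beta>" "\<beta> < s" and F\<beta>: "F \<beta> = 0" and Fs: "0 < F s"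
    and fpos: "\<And>t. \<beta> \<le> t \<Longrightarrow> 0 < f t"
    and Fd: "\<And>t. \<beta> \<le> t \<Longrightarrow> (F has_real_derivative f t) (at t)"
    and fd: "\<And>t. \<beta> \<le> t \<Longrightarrow> (f has_real_derivative f' t) (at t)"
    and anti: "antimono_on {\<beta>..} (\<lambda>t. t * f' t / f t)" and le: "\<beta> * f' \<beta> / f \<beta> \<le> real n / (real n - 2)"
  shows "(2 * real n - 2) * (F s * f' s) \<le> real n * (f s)\<^sup>2"
proof (cases "f' s \<le> 0")
  case True
  then have "(2 * real n - 2) * (F s * f' s) \<le> 0"
    using n Fs by (intro mult_nonneg_nonpos) auto
  also have "0 \<le> real n * (f s)\<^sup>2" by simp
  finally show ?thesis .
next
  case False
  define q where "q = s * f' s / f s"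
  have s0: "0 < s" using \<beta> by simp
  have fs: "0 < f s" using fpos[of s] \<beta> by simp
  have q: "0 < q" unfolding q_def using False s0 fs by simp
  have qge: "q \<le> t * f' t / f t" if "\<beta> \<le> t" "t \<le> s" for t
    unfolding q_def using anti that by (simp add: monotone_on_def)
  have "F s * (q + 1) - s * f s \<le> F \<beta> * (q + 1) - \<beta> * f \<beta>"
  proof (rule DERIV_nonpos_imp_nonincreasing[where f = "\<lambda>t. F t * (q + 1) - t * f t"])
    show "\<beta> \<le> s" using \<beta> by simp
    fix t assume t: "\<beta> \<le> t" "t \<le> s"
    have "((\<lambda>t. F t * (q + 1) - t * f t) has_real_derivative f t * (q + 1) - (t * f' t + 1 * f t)) (at t)"
      by (intro DERIV_diff DERIV_cmult_right Fd t DERIV_mult' DERIV_ident fd)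
    moreover have "q * f t \<le> t * f' t" using qge[OF t] fpos[OF t(1)] by (simp add: pos_le_divide_eq)
    then have "f t * (q + 1) - (t * f' t + 1 * f t) \<le> 0" by (simp add: algebra_simps)
    ultimately show "\<exists>d. ((\<lambda>t. F t * (q + 1) - t * f t) has_real_derivative d) (at t) \<and> d \<le> 0" by blast
  qed
  moreover have "0 < \<beta> * f \<beta>" using \<beta> fpos[of \<beta>] by simp
  ultimately have "F s * (q + 1) \<le> s * f s" unfolding F\<beta> by linarith
  then have Fq: "F s * (q + 1) * q \<le> s * f s * q" using q by (intro mult_right_mono) auto
  have qf: "q * f s = s * f' s" unfolding q_def using fs by simp
  have "q \<le> real n / (real n - 2)" using qge[of \<beta>] le \<beta> by simp
  \<comment> \<open>q/(q+1) \<le> n/(2n-2) is equivalent to q \<le> n/(n-2): this explains the bound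
    at \<beta> in (B).\<close>
  then have qn: "q * (2 * real n - 2) \<le> real n * (q + 1)" using n by (simp add: pos_le_divide_eq algebra_simps)
  have "(q + 1) * (s * ((2 * real n - 2) * (F s * f' s))) = (2 * real n - 2) * f s * (F s * (q + 1) * q)"
    using qf by (simp add: mult_ac)
  also have "\<dots> \<le> (2 * real n - 2) * f s * (s * f s * q)"
    using Fq n fs by (intro mult_left_mono) auto
  also have "\<dots> = (s * (f s)\<^sup>2) * (q * (2 * real n - 2))" by (simp add: power2_eq_square mult_ac)
  also have "\<dots> \<le> (s * (f s)\<^sup>2) * (real n * (q + 1))" using qn s0 by (intro mult_left_mono) auto
  also have "\<dots> = (q + 1) * (s * (real n * (f s)\<^sup>2))" by (simp add: mult_ac)
  finally have "s * ((2 * real n - 2) * (F s * f' s)) \<le> s * (real n * (f s)\<^sup>2)"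
    by (rule mult_left_le_imp_le) (use q in simp)
  then show ?thesis by (rule mult_left_le_imp_le) (rule s0)
qed

text \<open>The logarithmic derivative is n f/(2F) - (n-1) f'/f, which is nonnegative exactly when
  \<open>le\<close> holds.\<close>

lemma sqrt_F_power_div_mono:
  fixes f F f' :: "real \<Rightarrow> real" and n :: nat
  assumes n: "2 < n" and st: "\<beta> < s" "s \<le> t"
    and Fpos: "\<And>t. \<beta> < t \<Longrightarrow> 0 < F t" and fpos: "\<And>t. \<beta> < t \<Longrightarrow> 0 < f t"
    and Fd: "\<And>t. \<beta> < t \<Longrightarrow> (F has_real_derivative f t) (at t)"
    and fd: "\<And>t. \<beta> < t \<Longrightarrow> (f has_real_derivative f' t) (at t)"
    and le: "\<And>t. \<beta> < t \<Longrightarrow> (2 * real n - 2) * (F t * f' t) \<le> real n * (f t)\<^sup>2"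
  shows "sqrt (2 * F s) ^ n / f s ^ (n - 1) \<le> sqrt (2 * F t) ^ n / f t ^ (n - 1)"
proof -
  define L where "L = (\<lambda>s. real n / 2 * ln (2 * F s) - (real n - 1) * ln (f s))"
  have lnJ: "ln (sqrt (2 * F x) ^ n / f x ^ (n - 1)) = L x" if "\<beta> < x" for x
    using Fpos[OF that] fpos[OF that] n unfolding L_def
    by (simp add: ln_div ln_realpow ln_sqrt of_nat_diff)
  have "L s \<le> L t"
  proof (rule DERIV_nonneg_imp_nondecreasing[OF st(2)])
    fix x assume "s \<le> x" "x \<le> t"
    then have x: "\<beta> < x" using st by simp
    have F2: "0 < 2 * F x" using Fpos[OF x] by simp
    have d: "(L has_real_derivative real n / 2 * (1 / (2 * F x) * (2 * f x)) - (real n - 1) * (1 / f x * f' x)) (at x)"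
      unfolding L_def
      by (rule DERIV_diff[OF DERIV_cmult[OF DERIV_chain2[OF DERIV_ln_divide[OF F2] DERIV_cmult[OF Fd[OF x]]]]
          DERIV_cmult[OF DERIV_chain2[OF DERIV_ln_divide[OF fpos[OF x]] fd[OF x]]]])
    have "(real n - 1) * (1 / f x * f' x) = (2 * real n - 2) * (F x * f' x) / (2 * F x * f x)"
      using Fpos[OF x] fpos[OF x] by (simp add: field_simps)
    also have "\<dots> \<le> real n * (f x)\<^sup>2 / (2 * F x * f x)"
      using le[OF x] Fpos[OF x] fpos[OF x] by (intro divide_right_mono) auto
    also have "\<dots> = real n / 2 * (1 / (2 * F x) * (2 * f x))"
      using Fpos[OF x] fpos[OF x] by (simp add: field_simps power2_eq_square)
    finally have "0 \<le> real n / 2 * (1 / (2 * F x) * (2 * f x)) - (real n - 1) * (1 / f x * f' x)" by linarith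
    then show "\<exists>y. (L has_real_derivative y) (at x) \<and> 0 \<le> y" using d by blast
  qed
  have pos: "0 < sqrt (2 * F x) ^ n / f x ^ (n - 1)" if "\<beta> < x" for x
    using Fpos[OF that] fpos[OF that] by simp
  have t: "\<beta> < t" using st by simp
  show ?thesis
    using \<open>L s \<le> L t\<close> unfolding lnJ[OF st(1), symmetric] lnJ[OF t, symmetric]
    by (rule ln_le_cancel_iff[OF pos[OF st(1)] pos[OF t], THEN iffD1])
qed

lemma quotient_antimono:
  fixes f f' :: "real \<Rightarrow> real"
  assumes st: "\<beta> < s" "s \<le> t"
    and fd: "\<And>t. \<beta> < t \<Longrightarrow> (f has_real_derivative f' t) (at t)"
    and le: "\<And>t. \<beta> < t \<Longrightarrow> f' t * (t - \<beta>) \<le> f t"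
  shows "f t / (t - \<beta>) \<le> f s / (s - \<beta>)"
proof (rule DERIV_nonpos_imp_nonincreasing[where f = "\<lambda>t. f t / (t - \<beta>)", OF st(2)])
  fix x assume "s \<le> x" "x \<le> t"
  then have x: "\<beta> < x" using st by simp
  then have nz: "x - \<beta> \<noteq> 0" by simp
  have "(f' x * (x - \<beta>) - f x * (1 - 0)) / ((x - \<beta>) * (x - \<beta>)) \<le> 0"
    using le[OF x] by (intro divide_nonpos_nonneg) auto
  then show "\<exists>y. ((\<lambda>t. f t / (t - \<beta>)) has_real_derivative y) (at x) \<and> y \<le> 0"
    using DERIV_divide[OF fd[OF x] DERIV_diff[OF DERIV_ident DERIV_const] nz] by blast
qed

lemma lipschitz_if_continuous_deriv:
  fixes f f' :: "real \<Rightarrow> real"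
  assumes fd: "\<And>t. 0 < t \<Longrightarrow> (f has_real_derivative f' t) (at t)" and c: "continuous_on {0<..} f'"
    and m: "0 < m"
  shows "\<exists>L\<ge>0. \<forall>x\<in>{m..M}. \<forall>y\<in>{m..M}. \<bar>f x - f y\<bar> \<le> L * \<bar>x - y\<bar>"
proof -
  have "compact (f' ` {m..M})"
    by (intro compact_continuous_image compact_Icc continuous_on_subset[OF c]) (use m in auto)
  then have "bounded (f' ` {m..M})" by (rule compact_imp_bounded)
  then obtain L where "\<forall>y\<in>f' ` {m..M}. norm y \<le> L" unfolding bounded_iff by blast
  then have L: "norm (f' x) \<le> L" if "x \<in> {m..M}" for x using that by blast
  have "norm (f x - f y) \<le> max L 0 * norm (x - y)" if "x \<in> {m..M}" "y \<in> {m..M}" for x y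
  proof (rule field_differentiable_bound[of "{m..M}" f f'])
    fix z assume z: "z \<in> {m..M}"
    then show "(f has_field_derivative f' z) (at z within {m..M})"
      using fd[of z] m by (auto intro: has_field_derivative_at_within)
    show "norm (f' z) \<le> max L 0" using L[OF z] by simp
  qed (use that in auto)
  then show ?thesis by (intro exI[of _ "max L 0"]) auto
qed

theorem theorem1p2:
  fixes n :: nat and f :: "real \<Rightarrow> real" and b \<beta> :: real
  assumes "n \<ge> 2"
    and "continuous_on UNIV f"
    and "\<forall>s. f (- s) = - f s"
    and "f 0 = 0"
    and "0 < b" and "b < \<beta>"
    and "\<forall>s>b. f s > 0"
    and "\<forall>s\<in>{0..b}. f s \<le> 0"
    and "\<exists>s\<in>{0..b}. f s \<noteq> 0"
    and "antideriv f \<beta> = 0"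
    and "f differentiable_on {0<..}"
    and "continuous_on {0<..} (deriv f)"
    and "set_integrable lborel {0<..<1} (deriv f)"
    and "((\<forall>s\<ge>\<beta>. f s \<ge> deriv f s * (s - \<beta>)) \<and>
          (\<forall>s>\<beta>. deriv (\<lambda>t. antideriv f t / f t) s \<ge> (real n - 2) / (2 * real n)))
       \<or> (n > 2 \<and>
          antimono_on {\<beta>..} (\<lambda>s. s * deriv f s / f s) \<and>
          \<beta> * deriv f \<beta> / f \<beta> \<le> real n / (real n - 2))"
  shows "\<forall>u v. radial_solution n f u \<and> u 0 > 0 \<and> one_sign_change_on {0<..} u \<and>
               radial_solution n f v \<and> v 0 > 0 \<and> one_sign_change_on {0<..} v
           \<longrightarrow> (\<forall>r\<ge>0. u r = v r)"
proof -
  define F where "F = antideriv f"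
  define K where "K = deriv (\<lambda>t. F t / f t)"
  have n2: "2 \<le> n" by fact
  have fc: "continuous_on UNIV f" by fact
  have odd: "f (- s) = - f s" for s using assms(3) by blast
  have b: "0 < b" "b < \<beta>" by fact+
  have \<beta>0: "0 < \<beta>" using b by simp
  have fpos: "0 < f s" if "b < s" for s using assms(7) that by blast
  have fpos': "0 < f s" if "\<beta> \<le> s" for s using fpos[of s] that b by simp
  have Fd: "(F has_real_derivative f s) (at s)" for s unfolding F_def by (rule antideriv_DERIV[OF fc])
  have F\<beta>: "F \<beta> = 0" unfolding F_def by fact
  have F0: "F 0 = 0" unfolding F_def antideriv_def by (simp add: zero_ereal_def)
  have Feven: "F (- s) = F s" for s unfolding F_def by (rule antideriv_even[OF fc odd])
  have Fmono: "F s < F t" if "b \<le> s" "s < t" for s t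
    by (rule DERIV_pos_imp_increasing_open[OF that(2)])
      (use Fd fpos that in \<open>auto intro!: continuous_at_imp_continuous_on DERIV_isCont[OF Fd] exI[of _ "f _"]\<close>)
  have Fpos: "0 < F s" if "\<beta> < s" for s using Fmono[of \<beta> s] F\<beta> b that by simp
  have fd: "(f has_real_derivative deriv f s) (at s)" if "0 < s" for s
  proof -
    have "f differentiable (at s within {0<..})"
      using assms(11) that unfolding differentiable_on_def by blast
    then have "f differentiable (at s)" using that at_within_open[of s "{0<..}"] by simp
    then show ?thesis by (simp add: DERIV_deriv_iff_real_differentiable)
  qed
  have fd\<beta>: "(f has_real_derivative deriv f s) (at s)" if "\<beta> \<le> s" for s using fd[of s] that \<beta>0 by simp
  have frac: "((\<lambda>t. F t / f t) has_real_derivative (f s * f s - F s * deriv f s) / (f s * f s)) (at s)"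
    if "\<beta> \<le> s" for s
    using DERIV_divide[OF Fd fd\<beta>[OF that]] fpos'[OF that] by simp
  have Keq: "K s = (f s * f s - F s * deriv f s) / (f s * f s)" if "\<beta> \<le> s" for s
    unfolding K_def by (rule DERIV_imp_deriv[OF frac[OF that]])
  have Kd: "((\<lambda>t. F t / f t) has_real_derivative K s) (at s)" if "\<beta> < s" for s
    using frac[of s] Keq[of s] that by simp
  have bound: "(2 * real n - 2) * (F s * deriv f s) \<le> real n * (f s)\<^sup>2"
    if "n > 2" "antimono_on {\<beta>..} (\<lambda>s. s * deriv f s / f s)" "\<beta> * deriv f \<beta> / f \<beta> \<le> real n / (real n - 2)"
      "\<beta> < s" for s
    by (rule F_deriv_le[OF that(1) \<beta>0 that(4) F\<beta> Fpos[OF that(4)] fpos' Fd fd\<beta> that(2,3)])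
  have Kge: "(real n - 2) / (2 * real n) \<le> K s" if s: "\<beta> < s" for s
    using assms(14)
  proof
    assume "(\<forall>s\<ge>\<beta>. f s \<ge> deriv f s * (s - \<beta>)) \<and>
          (\<forall>s>\<beta>. deriv (\<lambda>t. antideriv f t / f t) s \<ge> (real n - 2) / (2 * real n))"
    then show ?thesis using s unfolding K_def F_def by blast
  next
    assume B: "n > 2 \<and> antimono_on {\<beta>..} (\<lambda>s. s * deriv f s / f s) \<and>
          \<beta> * deriv f \<beta> / f \<beta> \<le> real n / (real n - 2)"
    have fs: "0 < f s * f s" using fpos'[of s] s by simp
    have n: "0 < real n" using n2 by simp
    have "(2 * real n - 2) * (F s * deriv f s) \<le> real n * (f s * f s)"
      using bound[OF _ _ _ s] B by (simp add: power2_eq_square)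
    then have "(2 * real n) * ((2 * real n - 2) * (F s * deriv f s)) \<le> (2 * real n) * (real n * (f s * f s))"
      using n by (intro mult_left_mono) auto
    also have "\<dots> = (2 * (real n * real n)) * (f s * f s)" by simp
    \<comment> \<open>(B) gives F f'/f^2 \<le> n/(2n-2), while (F/f)' = 1 - F f'/f^2 needs only the
      bound (n+2)/(2n). The latter is weaker because 2n^2 \<le> (2n-2)(n+2) for n \<ge> 2.\<close>
    also have "\<dots> \<le> ((2 * real n - 2) * (real n + 2)) * (f s * f s)"
      using fs n2 by (intro mult_right_mono) (auto simp: algebra_simps)
    finally have "(2 * real n - 2) * (2 * real n * (F s * deriv f s)) \<le> (2 * real n - 2) * ((real n + 2) * (f s * f s))"
      by (simp only: mult_ac)
    then have "2 * real n * (F s * deriv f s) \<le> (real n + 2) * (f s * f s)"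
      by (rule mult_left_le_imp_le) (use n2 in simp)
    then have "(real n - 2) * (f s * f s) \<le> 2 * real n * (f s * f s - F s * deriv f s)"
      by (simp add: algebra_simps)
    then show ?thesis using Keq[of s] s fs n by (simp add: divide_le_eq le_divide_eq mult_ac)
  qed
  interpret radial_nonlinearity n f F K b \<beta>
  proof
    show "F s < 0" if "b \<le> s" "s < \<beta>" for s using Fmono[OF that] F\<beta> by simp
    show "f s \<le> 0" if "0 \<le> s" "s \<le> b" for s using assms(8) that by auto
  qed (use n2 fc Fd odd Feven F0 F\<beta> b fpos Kd Kge in auto)
  have lip: "\<exists>L\<ge>0. \<forall>x\<in>{m..M}. \<forall>y\<in>{m..M}. \<bar>f x - f y\<bar> \<le> L * \<bar>x - y\<bar>" if "0 < m" for m M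
    by (rule lipschitz_if_continuous_deriv[OF fd assms(12) that])
  have alt: "(\<forall>s t. \<beta> < s \<longrightarrow> s \<le> t \<longrightarrow> f t / (t - \<beta>) \<le> f s / (s - \<beta>)) \<or>
      (\<forall>s t. \<beta> < s \<longrightarrow> s \<le> t \<longrightarrow>
         sqrt (2 * F s) ^ n / f s ^ (n - 1) \<le> sqrt (2 * F t) ^ n / f t ^ (n - 1))"
    using assms(14)
  proof
    assume "(\<forall>s\<ge>\<beta>. f s \<ge> deriv f s * (s - \<beta>)) \<and>
          (\<forall>s>\<beta>. deriv (\<lambda>t. antideriv f t / f t) s \<ge> (real n - 2) / (2 * real n))"
    then have A: "deriv f t * (t - \<beta>) \<le> f t" if "\<beta> < t" for t using that by simp
    have "f t / (t - \<beta>) \<le> f s / (s - \<beta>)" if "\<beta> < s" "s \<le> t" for s t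
      by (rule quotient_antimono[OF that fd\<beta> A]) auto
    then show ?thesis by blast
  next
    assume B: "n > 2 \<and> antimono_on {\<beta>..} (\<lambda>s. s * deriv f s / f s) \<and>
          \<beta> * deriv f \<beta> / f \<beta> \<le> real n / (real n - 2)"
    have "sqrt (2 * F s) ^ n / f s ^ (n - 1) \<le> sqrt (2 * F t) ^ n / f t ^ (n - 1)" if "\<beta> < s" "s \<le> t" for s t
      by (rule sqrt_F_power_div_mono[OF _ that Fpos fpos' Fd fd\<beta> bound]) (use B in auto)
    then show ?thesis by blast
  qed
  show ?thesis using at_most_one[OF _ _ _ _ _ _ lip alt] by blast
qed

end
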